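(* Let $k$ be an algebraically closed field of arbitrary characteristic and let $A \in M_n(k)$. Then there exist a semisimple element $S \in M_n(k)$ and an equipotent element $N \in M_n(k)$ such that: (1) the Zariski closure of $D(S)$ contains $D(A)$; (2) the Zariski closure of $D(A)$ contains $D(N)$; (3) the centralizers of $A$, $S$ and $N$ in $M_n(k)$ all have the same dimension; (4) for every $1 \le d < n$, the fixed point spaces $\mathcal{G}_d^A$, $\mathcal{G}_d^S$, $\mathcal{G}_d^N$ all have the same dimension.
   Context: $M_n(k)$ is the algebra of $n\times n$ matrices over $k$. For $A \in M_n(k)$, $D(A)$ denotes the set of all $B \in M_n(k)$ having the same Jordan canonical form as $A$ up to changing the eigenvalues, with the same number of distinct eigenvalues; that is, $B \in D(A)$ iff there is a bijection between the distinct eigenvalues of $A$ and those of $B$ such that corresponding eigenvalues have the same partition of Jordan block sizes in their generalized eigenspaces. A matrix is equipotent if it has a single eigenvalue. $\mathcal{G}_d$ is the Grassmannian of $d$-dimensional subspaces of $k^n$, and for $A \in M_n(k)$, $\mathcal{G}_d^A$ is the (closed) subvariety of $\mathcal{G}_d$ consisting of the subspaces $W$ with $AW \subseteq W$. *)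

theory Defs
  imports "Jordan_Normal_Form.Jordan_Normal_Form_Uniqueness" "HOL-Library.Extended_Nat"
begin

definition alg_closed_field :: "'k::field itself \<Rightarrow> bool" where
  "alg_closed_field _ \<longleftrightarrow> (\<forall>p :: 'k poly. degree p \<noteq> 0 \<longrightarrow> (\<exists>x. poly p x = 0))"

inductive_set polyfun :: "nat \<Rightarrow> nat \<Rightarrow> ('k::comm_ring_1 mat \<Rightarrow> 'k) set"
  for m n :: nat where
  const: "(\<lambda>M. c) \<in> polyfun m n"
| coord: "i < m \<Longrightarrow> j < n \<Longrightarrow> (\<lambda>M. M $$ (i, j)) \<in> polyfun m n"
| add: "p \<in> polyfun m n \<Longrightarrow> q \<in> polyfun m n \<Longrightarrow> (\<lambda>M. p M + q M) \<in> polyfun m n"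
| mult: "p \<in> polyfun m n \<Longrightarrow> q \<in> polyfun m n \<Longrightarrow> (\<lambda>M. p M * q M) \<in> polyfun m n"

definition zar_closed :: "nat \<Rightarrow> nat \<Rightarrow> 'k::comm_ring_1 mat set \<Rightarrow> bool" where
  "zar_closed m n Z \<longleftrightarrow>
     (\<exists>P \<subseteq> polyfun m n. Z = {M \<in> carrier_mat m n. \<forall>p \<in> P. p M = 0})"

definition zar_closure :: "nat \<Rightarrow> nat \<Rightarrow> 'k::comm_ring_1 mat set \<Rightarrow> 'k mat set" where
  "zar_closure m n S = \<Inter>{Z. zar_closed m n Z \<and> S \<subseteq> Z}"

definition Dset :: "nat \<Rightarrow> 'k::field mat \<Rightarrow> 'k mat set" where
  "Dset n A = {B \<in> carrier_mat n n. \<exists>n_as f.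
      jordan_nf A n_as \<and> inj_on f (snd ` set n_as) \<and>
      jordan_nf B (map (\<lambda>(m, a). (m, f a)) n_as)}"

definition semisimple :: "'k::field mat \<Rightarrow> bool" where
  "semisimple S \<longleftrightarrow> (\<exists>D. diagonal_mat D \<and> similar_mat S D)"

definition equipotent :: "'k::field mat \<Rightarrow> bool" where
  "equipotent N \<longleftrightarrow> (\<exists>c. {\<mu>. eigenvalue N \<mu>} = {c})"

definition centralizer :: "nat \<Rightarrow> 'k::field mat \<Rightarrow> 'k mat set" where
  "centralizer n A = {X \<in> carrier_mat n n. A * X = X * A}"

definition centralizer_dim :: "nat \<Rightarrow> 'k::field mat \<Rightarrow> nat" where
  "centralizer_dim n A =
     vectorspace.dim class_ring ((module_mat TYPE('k) n n)\<lparr>carrier := centralizer n A\<rparr>)"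

definition Grass :: "nat \<Rightarrow> nat \<Rightarrow> 'k::field vec set set" where
  "Grass n d = {W. subspace class_ring W (module_vec TYPE('k) n) \<and>
      vectorspace.dim class_ring ((module_vec TYPE('k) n)\<lparr>carrier := W\<rparr>) = d}"

definition stiefel :: "nat \<Rightarrow> nat \<Rightarrow> 'k::field mat set" where
  "stiefel n d = {M \<in> carrier_mat n d. vec_space.col_space n M \<in> Grass n d}"

text \<open>Closed subsets of the Grassmannian: those whose preimage in the Stiefel set is
  Zariski closed there (quotient topology, which is the Zariski topology of G_d).\<close>
definition grass_closed :: "nat \<Rightarrow> nat \<Rightarrow> 'k::field vec set set \<Rightarrow> bool" where
  "grass_closed n d F \<longleftrightarrow> F \<subseteq> Grass n d \<and>
     (\<exists>Z. zar_closed n d Z \<and>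
        {M \<in> stiefel n d. vec_space.col_space n M \<in> F} = stiefel n d \<inter> Z)"

definition fixed_grass :: "nat \<Rightarrow> nat \<Rightarrow> 'k::field mat \<Rightarrow> 'k vec set set" where
  "fixed_grass n d A = {W \<in> Grass n d. \<forall>w \<in> W. A *\<^sub>v w \<in> W}"

definition closedin_rel :: "('a set \<Rightarrow> bool) \<Rightarrow> 'a set \<Rightarrow> 'a set \<Rightarrow> bool" where
  "closedin_rel cl X C \<longleftrightarrow> (\<exists>F. cl F \<and> C = X \<inter> F)"

definition irreducible_rel :: "('a set \<Rightarrow> bool) \<Rightarrow> 'a set \<Rightarrow> 'a set \<Rightarrow> bool" where
  "irreducible_rel cl X C \<longleftrightarrow> closedin_rel cl X C \<and> C \<noteq> {} \<and>
     (\<forall>C1 C2. closedin_rel cl X C1 \<and> closedin_rel cl X C2 \<and> C \<subseteq> C1 \<union> C2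
         \<longrightarrow> C \<subseteq> C1 \<or> C \<subseteq> C2)"

definition krull_dim :: "('a set \<Rightarrow> bool) \<Rightarrow> 'a set \<Rightarrow> enat" where
  "krull_dim cl X = Sup {enat m | m. \<exists>Z :: nat \<Rightarrow> 'a set.
      (\<forall>i \<le> m. irreducible_rel cl X (Z i)) \<and> (\<forall>i < m. Z i \<subset> Z (Suc i))}"

end

theory Submission
  imports Defs "HOL-Library.Function_Algebras" "Jordan_Normal_Form.DL_Rank"
    "Jordan_Normal_Form.Jordan_Normal_Form_Existence"
begin

text \<open>
  Fix a Young diagram with boxes \<open>(b,h)\<close>, \<open>b < m h\<close>, for a decreasing sequence \<open>m\<close>, and let
  \<open>J(c)\<close> act on functions on it by \<open>(J(c) f)(b,h) = c h * f(b,h) + f(b,h+1)\<close>. Sorting the pairs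
  (eigenvalue \<open>a\<close>, \<open>j\<close>) by the number of Jordan blocks of \<open>a\<close> of size more than \<open>j\<close> shows that every
  \<open>A\<close> is similar to some \<open>J(c)\<close>; take \<open>S = J(s)\<close> with \<open>s\<close> injective and \<open>N = J(0)\<close> on the same diagram.

  Closures: conjugates of \<open>J(c + t s)\<close> are in \<open>D(S)\<close> for all but finitely many \<open>t\<close>, and conjugates of
  \<open>J(a + t c)\<close> are in \<open>D(A)\<close> for \<open>t \<noteq> 0\<close>; let \<open>t\<close> tend to \<open>0\<close> along these polynomial curves.

  Centralizers: a matrix commuting with \<open>J(c)\<close> is determined by its columns at the ends of the rows
  of the diagram, and the column ending a row of length \<open>\<mu>\<close> can be any function supported on \<open>h < \<mu>\<close>.

  Invariant subspaces: the dimension of \<open>\<G>\<^sub>d\<^sup>J\<close> is the maximum of \<open>\<Sum>h. d\<^sub>h (m\<^sub>h - d\<^sub>h)\<close> over all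
  \<open>d\<^sub>h \<le> m\<^sub>h\<close> of sum \<open>d\<close>, whatever \<open>c\<close>. With \<open>T h = (J - c (h-1)) \<dots> (J - c 0)\<close>, the
  dimensions \<open>d\<^sub>h\<close> of \<open>T h W / T (h+1) W\<close> stratify the invariant subspaces, and reduced echelon forms, lifted step by
  step along \<open>J - c h\<close>, cover each stratum by finitely many polynomial families with
  \<open>\<Sum>h. d\<^sub>h (m\<^sub>h - d\<^sub>h)\<close> parameters. A chain of irreducible closed sets of length \<open>l\<close> yields \<open>l\<close> algebraically
  independent functions on one such family, so \<open>l\<close> is at most the number of parameters by counting
  monomials. Conversely the maximum is attained at a decreasing \<open>d\<^sub>h\<close>, for which an explicit family of
  invariant subspaces carries a chain of that length, obtained by letting its parameters vary one after another.
\<close>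

section \<open>Polynomial families\<close>

text \<open>The reason that \<open>c\<close> does not matter: \<open>jop c\<close> adds
  \<open>f (b,Suc h)\<close> with coefficient one, so the kernel of \<open>T h\<close> consists of
  the functions supported on the layers below \<open>h\<close>, for every \<open>c\<close>. Hence on
  the image of \<open>T h\<close> the operator \<open>jop c - c h\<close> has a kernel spanned by
  \<open>m h\<close> vectors, the images of the unit functions of layer \<open>h\<close>. Choosing
  d_h new directions among them costs d_h (m_h - d_h) parameters, as in a Grassmannian. The obstacle
  on the geometric side: the Grassmannian is a quotient of the set of full-rank matrices, so a
  function on an affine chart is a fraction whose denominator is a power of a determinant
  \<open>det (L * M)\<close>. Such functions are carried around as numerators together with the
  exponent, which keeps all degrees countable. A stratum enters only through finitely many
  polynomial families that cover it. Each family yields its own algebraic relation; the product of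
  these relations vanishes on an irreducible set, hence one factor does. A decreasing d_h matters
  below because it cuts out a subdiagram, and a deformation of its rows gives the explicit
  family.\<close>

lemma alg_closed_infinite:
  assumes "alg_closed_field TYPE('k::field)"
  shows "infinite (UNIV :: 'k set)"
proof
  assume fin: "finite (UNIV :: 'k set)"
  define p :: "'k poly" where "p = (\<Prod>a\<in>UNIV. [:-a, 1:]) + 1"
  have deg: "degree (\<Prod>a\<in>(UNIV::'k set). [:-a, 1:]) = card (UNIV :: 'k set)"
    by (subst degree_prod_eq_sum_degree) auto
  have pos: "card (UNIV :: 'k set) > 0" using fin by (simp add: card_gt_0_iff)
  have "degree p = card (UNIV :: 'k set)" unfolding p_def using deg pos
    by (subst degree_add_eq_left) auto
  with pos have "degree p \<noteq> 0" by simp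
  then obtain x where "poly p x = 0" using assms unfolding alg_closed_field_def by blast
  moreover have "poly p x = 1" unfolding p_def using fin by (auto simp: poly_prod)
  ultimately show False by simp
qed

text \<open>Parameters are whole sequences, of which a member of \<open>parpoly e\<close> may use
  the first \<open>e\<close> entries. One fixed type for every \<open>e\<close> lets families be
  extended by further parameters.\<close>

inductive_set parpoly :: "nat \<Rightarrow> ((nat \<Rightarrow> 'k::comm_ring_1) \<Rightarrow> 'k) set" for e :: nat where
  const: "(\<lambda>u. c) \<in> parpoly e"
| coord: "i < e \<Longrightarrow> (\<lambda>u. u i) \<in> parpoly e"
| add: "f \<in> parpoly e \<Longrightarrow> g \<in> parpoly e \<Longrightarrow> (\<lambda>u. f u + g u) \<in> parpoly e"
| mult: "f \<in> parpoly e \<Longrightarrow> g \<in> parpoly e \<Longrightarrow> (\<lambda>u. f u * g u) \<in> parpoly e"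

lemma parpoly_diff:
  assumes "f \<in> parpoly e" "g \<in> parpoly e" shows "(\<lambda>u. f u - g u) \<in> parpoly e"
  using parpoly.add[OF assms(1) parpoly.mult[OF parpoly.const[of "-1"] assms(2)]] by simp

lemma parpoly_sum:
  assumes "\<And>i. i \<in> I \<Longrightarrow> f i \<in> parpoly e" shows "(\<lambda>u. \<Sum>i\<in>I. f i u) \<in> parpoly e"
  using assms by (induction I rule: infinite_finite_induct) (auto intro: parpoly.intros)

lemma parpoly_mono: "f \<in> parpoly e \<Longrightarrow> e \<le> e' \<Longrightarrow> f \<in> parpoly e'"
  by (induction rule: parpoly.induct) (auto intro: parpoly.intros)

lemma parpoly_line:
  assumes "f \<in> parpoly e"
  shows "\<exists>P. \<forall>t. f (\<lambda>i. u i + t * (v i - u i)) = poly P t"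
  using assms
proof (induction rule: parpoly.induct)
  case (const c) show ?case by (rule exI[of _ "[:c:]"]) simp
next
  case (coord i) show ?case by (rule exI[of _ "[:u i, v i - u i:]"]) simp
next
  case (add f g)
  then obtain P Q where "\<forall>t. f (\<lambda>i. u i + t * (v i - u i)) = poly P t"
    "\<forall>t. g (\<lambda>i. u i + t * (v i - u i)) = poly Q t" by blast
  then show ?case by (intro exI[of _ "P + Q"]) simp
next
  case (mult f g)
  then obtain P Q where "\<forall>t. f (\<lambda>i. u i + t * (v i - u i)) = poly P t"
    "\<forall>t. g (\<lambda>i. u i + t * (v i - u i)) = poly Q t" by blast
  then show ?case by (intro exI[of _ "P * Q"]) simp
qed

text \<open>Irreducibility of affine space, seen on the line through \<open>u\<close> and
  \<open>v\<close>: the product of both restrictions is a nonzero polynomial in one variable. The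
  point found lies on that line, hence in every linear subspace that contains \<open>u\<close> and
  \<open>v\<close>.\<close>

lemma parpoly_common_nonzero:
  fixes f g :: "(nat \<Rightarrow> 'k::field) \<Rightarrow> 'k"
  assumes inf: "infinite (UNIV :: 'k set)" and f: "f \<in> parpoly e" "f u \<noteq> 0"
    and g: "g \<in> parpoly e" "g v \<noteq> 0"
  shows "\<exists>t. f (\<lambda>i. u i + t * (v i - u i)) \<noteq> 0 \<and> g (\<lambda>i. u i + t * (v i - u i)) \<noteq> 0"
proof -
  from parpoly_line[OF f(1)] obtain P where P: "\<And>t. f (\<lambda>i. u i + t * (v i - u i)) = poly P t" by blast
  from parpoly_line[OF g(1)] obtain Q where Q: "\<And>t. g (\<lambda>i. u i + t * (v i - u i)) = poly Q t" by blast
  have "P \<noteq> 0" using P[of 0] f(2) by auto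
  moreover have "Q \<noteq> 0" using Q[of 1] g(2) by auto
  ultimately have "finite {t. poly (P * Q) t = 0}" by (intro poly_roots_finite) simp
  then obtain t where "poly (P * Q) t \<noteq> 0" using inf
    by (metis (mono_tags, lifting) UNIV_eq_I mem_Collect_eq)
  then show ?thesis using P Q by auto
qed

lemma polyfun_comp_parpoly:
  assumes "p \<in> polyfun n d" and "\<And>i j. i < n \<Longrightarrow> j < d \<Longrightarrow> (\<lambda>u. F u $$ (i,j)) \<in> parpoly e"
  shows "(\<lambda>u. p (F u)) \<in> parpoly e"
  using assms by (induction rule: polyfun.induct) (auto intro: parpoly.intros)

lemma polyfun_curve:
  assumes "p \<in> polyfun n d"
    and "\<And>i j. i < n \<Longrightarrow> j < d \<Longrightarrow> \<exists>Q. \<forall>t. M t $$ (i,j) = poly Q t"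
  shows "\<exists>Q. \<forall>t. p (M t) = poly Q t"
  using assms
proof (induction rule: polyfun.induct)
  case (const c) show ?case by (rule exI[of _ "[:c:]"]) simp
next
  case (add p q)
  then obtain P Q where "\<forall>t. p (M t) = poly P t" "\<forall>t. q (M t) = poly Q t" by blast
  then show ?case by (intro exI[of _ "P + Q"]) simp
next
  case (mult p q)
  then obtain P Q where "\<forall>t. p (M t) = poly P t" "\<forall>t. q (M t) = poly Q t" by blast
  then show ?case by (intro exI[of _ "P * Q"]) simp
qed auto

text \<open>A polynomial that vanishes on \<open>S\<close> becomes, along the curve, a polynomial in
  \<open>t\<close> with infinitely many roots; so it is zero and vanishes at \<open>t0\<close>
  too.\<close>

lemma zar_closure_curve:
  fixes M :: "'k::field \<Rightarrow> 'k mat"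
  assumes inf: "infinite (UNIV :: 'k set)" and M: "M t0 \<in> carrier_mat n d"
    and "\<And>i j. i < n \<Longrightarrow> j < d \<Longrightarrow> \<exists>Q. \<forall>t. M t $$ (i,j) = poly Q t"
    and fin: "finite {t. M t \<notin> S}"
  shows "M t0 \<in> zar_closure n d S"
  unfolding zar_closure_def
proof (intro InterI, clarify)
  fix Z assume "zar_closed n d Z" and S: "S \<subseteq> Z"
  then obtain P where P: "P \<subseteq> polyfun n d" and Z: "Z = {M \<in> carrier_mat n d. \<forall>p \<in> P. p M = 0}"
    unfolding zar_closed_def by blast
  have "p (M t0) = 0" if p: "p \<in> P" for p
  proof -
    obtain Q where Q: "\<And>t. p (M t) = poly Q t"
      using polyfun_curve[of p n d M] assms(3) p P by blast
    have "UNIV = {t. M t \<notin> S} \<union> {t. poly Q t = 0}"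
    proof -
      have "p (M t) = 0" if "M t \<in> S" for t using that S Z p by blast
      then have "poly Q t = 0" if "M t \<in> S" for t using that Q[of t] by simp
      then show ?thesis by blast
    qed
    then have "infinite {t. poly Q t = 0}" using fin inf by (metis finite_Un)
    then have "Q = 0" using poly_roots_finite by blast
    then show ?thesis using Q by simp
  qed
  then show "M t0 \<in> Z" using M Z by blast
qed

section \<open>Function spaces and monomials of bounded degree\<close>

definition fscale :: "'k::field \<Rightarrow> ('x \<Rightarrow> 'k) \<Rightarrow> 'x \<Rightarrow> 'k" where
  "fscale c f = (\<lambda>x. c * f x)"

interpretation fv: vector_space fscale
  by unfold_locales (auto simp: fscale_def fun_eq_iff algebra_simps)

text \<open>The exponent of each variable is bounded separately: the number of monomials is then at
  most \<open>(D + 1) ^ e\<close>, and the bounds add under multiplication.\<close>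

definition par_monos :: "nat \<Rightarrow> nat \<Rightarrow> ((nat \<Rightarrow> 'k::field) \<Rightarrow> 'k) set" where
  "par_monos e D = (\<lambda>a u. \<Prod>i<e. u i ^ a i) ` PiE {..<e} (\<lambda>_. {..D})"

definition mpol :: "nat \<Rightarrow> nat \<Rightarrow> ((nat \<Rightarrow> 'k::field) \<Rightarrow> 'k) set" where
  "mpol e D = fv.span (par_monos e D)"

lemma finite_par_monos: "finite (par_monos e D)"
  unfolding par_monos_def by (intro finite_imageI finite_PiE) auto

lemma card_par_monos: "card (par_monos e D) \<le> (D + 1) ^ e"
proof -
  have "card (par_monos e D) \<le> card (PiE {..<e} (\<lambda>_. {..D}))"
    unfolding par_monos_def by (intro card_image_le finite_PiE) auto
  also have "\<dots> = (D + 1) ^ e" by (simp add: card_PiE)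
  finally show ?thesis .
qed

lemma par_monosI:
  assumes "\<And>i. i < e \<Longrightarrow> a i \<le> D" shows "(\<lambda>u. \<Prod>i<e. u i ^ a i) \<in> par_monos e D"
proof -
  have "(\<lambda>u. \<Prod>i<e. u i ^ a i) = (\<lambda>u::nat \<Rightarrow> 'a. \<Prod>i<e. u i ^ restrict a {..<e} i)" by auto
  moreover have "restrict a {..<e} \<in> PiE {..<e} (\<lambda>_. {..D})" using assms by auto
  ultimately show ?thesis unfolding par_monos_def by blast
qed

lemma mpol_mono: "D \<le> D' \<Longrightarrow> mpol e D \<subseteq> mpol e D'"
  unfolding mpol_def par_monos_def
  by (intro fv.span_mono image_mono PiE_mono) simp

lemma mpol_add:
  assumes "f \<in> mpol e D" "g \<in> mpol e D" shows "(\<lambda>u. f u + g u) \<in> mpol e D"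
proof -
  have "f + g \<in> mpol e D" using assms unfolding mpol_def by (rule fv.span_add)
  moreover have "f + g = (\<lambda>u. f u + g u)" by (rule ext) simp
  ultimately show ?thesis by simp
qed

lemma mpol_const: "(\<lambda>u. c) \<in> mpol e D"
proof -
  have "(\<lambda>u. \<Prod>i<e. u i ^ 0) \<in> par_monos e D" by (rule par_monosI) simp
  then have "fscale c (\<lambda>u. \<Prod>i<e. u i ^ 0) \<in> mpol e D" unfolding mpol_def
    by (intro fv.span_scale fv.span_base)
  then show ?thesis by (simp add: fscale_def)
qed

lemma mpol_coord:
  assumes i: "i < e" shows "(\<lambda>u::nat \<Rightarrow> 'k::field. u i) \<in> mpol e 1"
proof -
  have "(\<lambda>u::nat \<Rightarrow> 'k. \<Prod>j<e. u j ^ (if j = i then 1 else 0)) \<in> par_monos e 1" by (rule par_monosI) simp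
  moreover have "(\<lambda>u::nat \<Rightarrow> 'k. \<Prod>j<e. u j ^ (if j = i then 1 else 0)) = (\<lambda>u. u i)"
    using i by (auto simp: fun_eq_iff if_distrib[of "power _"] cong: if_cong)
  ultimately have "(\<lambda>u::nat \<Rightarrow> 'k. u i) \<in> par_monos e 1" by simp
  then show ?thesis unfolding mpol_def by (rule fv.span_base)
qed

lemma mpol_mult:
  assumes f: "f \<in> mpol e D" and g: "g \<in> mpol e D'"
  shows "(\<lambda>u. f u * g u) \<in> mpol e (D + D')"
proof -
  have 1: "(\<lambda>u. f u * g u) \<in> mpol e (D + D')" if f: "f \<in> par_monos e D" and g: "g \<in> par_monos e D'" for f g
  proof -
    from f obtain a where a: "a \<in> PiE {..<e} (\<lambda>_. {..D})" "f = (\<lambda>u. \<Prod>i<e. u i ^ a i)"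
      unfolding par_monos_def by blast
    from g obtain b where b: "b \<in> PiE {..<e} (\<lambda>_. {..D'})" "g = (\<lambda>u. \<Prod>i<e. u i ^ b i)"
      unfolding par_monos_def by blast
    have "(\<lambda>u. f u * g u) = (\<lambda>u. \<Prod>i<e. u i ^ (a i + b i))"
      unfolding a b by (simp only: power_add prod.distrib)
    moreover have "\<dots> \<in> par_monos e (D + D')" 
      by (rule par_monosI) (use a(1) b(1) in \<open>simp add: PiE_iff add_mono\<close>)
    ultimately show ?thesis unfolding mpol_def by (simp add: fv.span_base)
  qed
  \<comment> \<open>Bilinear extension in two rounds: for fixed \<open>g\<close>, the functions
    whose product with \<open>g\<close> has the right degree form a subspace. Fact \<open>2\<close>
    frees the first factor, the final step the second.\<close>
  have sub: "fv.subspace {f. (\<lambda>u. f u * g u) \<in> mpol e (D + D')}" for g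
  proof (rule fv.subspaceI)
    show "0 \<in> {f. (\<lambda>u. f u * g u) \<in> mpol e (D + D')}" using mpol_const[of 0] by simp
  next
    fix x y assume "x \<in> {f. (\<lambda>u. f u * g u) \<in> mpol e (D + D')}" "y \<in> {f. (\<lambda>u. f u * g u) \<in> mpol e (D + D')}"
    then show "x + y \<in> {f. (\<lambda>u. f u * g u) \<in> mpol e (D + D')}"
      using mpol_add[of "\<lambda>u. x u * g u" e "D + D'" "\<lambda>u. y u * g u"] by (simp add: plus_fun_def algebra_simps)
  next
    fix c x assume "x \<in> {f. (\<lambda>u. f u * g u) \<in> mpol e (D + D')}"
    then show "fscale c x \<in> {f. (\<lambda>u. f u * g u) \<in> mpol e (D + D')}"
      using fv.span_scale[of "\<lambda>u. x u * g u" _ c] unfolding mpol_def by (simp add: fscale_def algebra_simps)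
  qed
  have 2: "(\<lambda>u. f u * g u) \<in> mpol e (D + D')" if f: "f \<in> mpol e D" and g: "g \<in> par_monos e D'" for f g
    using fv.span_subspace_induct[OF f[unfolded mpol_def] sub[of g]] 1[OF _ g] by blast
  have "(\<lambda>u. g u * f u) \<in> mpol e (D + D')"
    using fv.span_subspace_induct[OF g[unfolded mpol_def] sub[of f]] 2[OF f] by (simp add: mult.commute)
  then show ?thesis by (simp add: mult.commute)
qed

lemma mpol_power: "f \<in> mpol e D \<Longrightarrow> (\<lambda>u. f u ^ k) \<in> mpol e (D * k)"
proof (induction k)
  case 0 show ?case using mpol_const[of 1] by simp
next
  case (Suc k) then show ?case using mpol_mult[of f e D "\<lambda>u. f u ^ k" "D * k"] by simp
qed

lemma mpol_prod:
  "finite I \<Longrightarrow> (\<And>i. i \<in> I \<Longrightarrow> f i \<in> mpol e D) \<Longrightarrow> (\<lambda>u. \<Prod>i\<in>I. f i u) \<in> mpol e (D * card I)"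
proof (induction I rule: finite_induct)
  case empty show ?case using mpol_const[of 1] by simp
next
  case (insert x I)
  then show ?case using mpol_mult[of "f x" e D "\<lambda>u. \<Prod>i\<in>I. f i u" "D * card I"] by simp
qed

lemma parpoly_mpol: "f \<in> parpoly e \<Longrightarrow> \<exists>D. f \<in> mpol e D"
proof (induction rule: parpoly.induct)
  case (const c) show ?case using mpol_const by blast
next
  case (coord i) then show ?case using mpol_coord by blast
next
  case (add f g)
  then obtain D D' where "f \<in> mpol e D" "g \<in> mpol e D'" by blast
  then have "f \<in> mpol e (D + D')" "g \<in> mpol e (D + D')" using mpol_mono[of D "D + D'" e] mpol_mono[of D' "D + D'" e] by auto
  then show ?case using mpol_add by blast
next
  case (mult f g) then show ?case using mpol_mult by blast
qed

lemma fun_sum_apply: "(\<Sum>i\<in>I. F i) x = (\<Sum>i\<in>I. (F i x :: 'k::comm_monoid_add))"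
  by (induction I rule: infinite_finite_induct) auto

lemma linear_relation:
  fixes F :: "'i \<Rightarrow> 'x \<Rightarrow> 'k::field"
  assumes I: "finite I" and B: "finite B" and card: "card B < card I" and "\<And>i. i \<in> I \<Longrightarrow> F i \<in> fv.span B"
  shows "\<exists>c. (\<exists>i\<in>I. c i \<noteq> 0) \<and> (\<forall>x. (\<Sum>i\<in>I. c i * F i x) = 0)"
\<comment> \<open>Dependence of the image of \<open>I\<close> as a set does not see two indices with
  the same function; for those the coefficients 1 and -1 give the relation.\<close>
proof (cases "inj_on F I")
  case False
  then obtain i j where ij: "i \<in> I" "j \<in> I" "i \<noteq> j" "F i = F j" unfolding inj_on_def by blast
  define c where "c l = (if l = i then 1 else if l = j then -1 else (0::'k))" for l
  have "(\<Sum>l\<in>I. c l * F l x) = 0" for x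
  proof -
    have "(\<Sum>l\<in>I. c l * F l x) = (\<Sum>l\<in>{i,j}. c l * F l x)"
      by (rule sum.mono_neutral_right) (use ij I in \<open>auto simp: c_def\<close>)
    also have "\<dots> = 0" using ij by (simp add: c_def)
    finally show ?thesis .
  qed
  moreover have "c i \<noteq> 0" by (simp add: c_def)
  ultimately show ?thesis using ij by blast
next
  case True
  have "F ` I \<subseteq> fv.span B" using assms(4) by blast
  moreover have "card (F ` I) = card I" using True by (rule card_image)
  ultimately have "fv.dependent (F ` I)"
    using fv.independent_span_bound[OF B, of "F ` I"] card by auto
  then obtain c where c: "\<exists>v\<in>F ` I. c v \<noteq> 0" "(\<Sum>v\<in>F ` I. fscale (c v) v) = 0"
    using fv.dependent_finite[of "F ` I"] I by auto
  have "(\<Sum>i\<in>I. c (F i) * F i x) = 0" for x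
    using c(2) True by (auto simp: sum.reindex fun_eq_iff fun_sum_apply fscale_def)
  then show ?thesis using c(1) by (intro exI[of _ "\<lambda>i. c (F i)"]) auto
qed

section \<open>The Grassmannian\<close>

text \<open>Independent subsets of \<open>W\<close> stay independent in \<open>V\<close>, so their
  size is bounded by the dimension of \<open>V\<close> and a maximal one exists.\<close>

lemma (in vectorspace) fin_dim_subspace:
  assumes fd: "fin_dim" and sub: "subspace K W V"
  shows "vectorspace.fin_dim K (vs W)"
proof -
  interpret Wv: vectorspace K "vs W" by (rule subspace_is_vs[OF sub])
  have smod: "submodule K W V" using sub unfolding subspace_def by blast
  have WV: "W \<subseteq> carrier V" using smod unfolding submodule_def by blast
  have "finite S \<and> card S \<le> dim" if "S \<subseteq> carrier (vs W) \<and> Wv.lin_indpt S" for S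
  proof -
    have S: "S \<subseteq> W" "Wv.lin_indpt S" using that by auto
    have "lin_indpt S" using S(2) span_li_not_depend(2)[OF S(1) smod] by simp
    then show ?thesis using li_le_dim[OF fd, of S] S(1) WV by blast
  qed
  moreover have "{} \<subseteq> carrier (vs W) \<and> Wv.lin_indpt {}" unfolding Wv.lin_dep_def by auto
  ultimately obtain B where "finite B" "maximal B (\<lambda>S. S \<subseteq> carrier (vs W) \<and> Wv.lin_indpt S)"
    using maximal_exists[of "\<lambda>S. S \<subseteq> carrier (vs W) \<and> Wv.lin_indpt S" dim "{}"] by blast
  then have "finite B" "Wv.basis B" using Wv.max_li_is_basis by auto
  then show ?thesis unfolding Wv.fin_dim_def Wv.basis_def by blast
qed

section \<open>Matrices of full column rank and the subspaces they span\<close>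

definition inj_mat :: "'k::field mat \<Rightarrow> bool" where
  "inj_mat M \<longleftrightarrow> (\<forall>v\<in>carrier_vec (dim_col M). M *\<^sub>v v = 0\<^sub>v (dim_row M) \<longrightarrow> v = 0\<^sub>v (dim_col M))"

definition mat_range :: "'k::field mat \<Rightarrow> 'k vec set" where
  "mat_range M = (\<lambda>v. M *\<^sub>v v) ` carrier_vec (dim_col M)"

lemma inj_matI:
  assumes "M \<in> carrier_mat n d" and "\<And>v. v \<in> carrier_vec d \<Longrightarrow> M *\<^sub>v v = 0\<^sub>v n \<Longrightarrow> v = 0\<^sub>v d"
  shows "inj_mat M"
  using assms unfolding inj_mat_def by auto

lemma inj_matD:
  "inj_mat M \<Longrightarrow> M \<in> carrier_mat n d \<Longrightarrow> v \<in> carrier_vec d \<Longrightarrow> M *\<^sub>v v = 0\<^sub>v n \<Longrightarrow> v = 0\<^sub>v d"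
  unfolding inj_mat_def by auto

lemma mat_unit_vec_col:
  assumes "M \<in> carrier_mat n d" "j < d"
  shows "M *\<^sub>v unit_vec d j = (col M j :: 'k::field vec)"
  using assms by (intro eq_vecI) (auto simp: scalar_prod_right_unit)

lemma inj_mat_eqD:
  assumes "inj_mat M" "M \<in> carrier_mat n d" "v \<in> carrier_vec d" "w \<in> carrier_vec d"
    "M *\<^sub>v v = M *\<^sub>v w"
  shows "v = w"
proof -
  have "M *\<^sub>v (v - w) = M *\<^sub>v v - M *\<^sub>v w" by (rule mult_minus_distrib_mat_vec[OF assms(2-4)])
  also have "\<dots> = 0\<^sub>v n" unfolding assms(5) using assms(2,4) by (intro minus_cancel_vec) simp
  finally have "M *\<^sub>v (v - w) = 0\<^sub>v n" .
  then have z: "v - w = 0\<^sub>v d" using assms by (intro inj_matD[OF assms(1,2)]) auto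
  show ?thesis
  proof (rule eq_vecI)
    fix i assume "i < dim_vec w"
    then have i: "i < d" using assms by simp
    then have "(v - w) $ i = 0" using z by simp
    then show "v $ i = w $ i" using i assms by simp
  qed (use assms in simp)
qed

lemma square_inj_mat_iff_det:
  assumes "M \<in> carrier_mat d d"
  shows "inj_mat M \<longleftrightarrow> det M \<noteq> 0"
  unfolding det_0_iff_vec_prod_zero_field[OF assms] inj_mat_def using assms by blast

lemma col_space_mat_range:
  assumes "M \<in> carrier_mat n d"
  shows "vec_space.col_space n M = mat_range M"
  unfolding vec_space.col_space_eq[OF assms] mat_range_def using assms by auto

lemma mat_rank_iff_inj_mat:
  fixes M :: "'k::field mat"
  assumes M: "M \<in> carrier_mat n d"
  shows "vec_space.rank n M = d \<longleftrightarrow> inj_mat M"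
proof -
  interpret vec_space "TYPE('k)" n .
  show ?thesis
  proof
    assume r: "rank M = d"
    \<comment> \<open>Independence of \<open>set (cols M)\<close> ignores repetitions, so
      distinctness of the columns has to be extracted from the rank first.\<close>
    have dist: "distinct (cols M)"
    proof (rule ccontr)
      assume nd: "\<not> distinct (cols M)"
      obtain S where S: "maximal S (\<lambda>T. T \<subseteq> set (cols M) \<and> lin_indpt T)"
        using maximal_exists[of "(\<lambda>T. T \<subseteq> set (cols M) \<and> lin_indpt T)" "card (set (cols M))" "{}"]
        by (meson List.finite_set card_mono empty_iff empty_subsetI finite_lin_indpt2 rev_finite_subset)
      then have "card S \<le> card (set (cols M))" by (simp add: card_mono maximal_def)
      also have "\<dots> < d" using nd M by (metis card_distinct card_length carrier_matD(2) cols_length nat_less_le)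
      finally show False using rank_card_indpt[OF M S] r by simp
    qed
    have "lin_indpt (set (cols M))" by (rule full_rank_lin_indpt[OF M r dist])
    then show "inj_mat M" using lin_depI[OF M _ _ _ dist] M by (intro inj_matI) auto
  next
    assume inj: "inj_mat M"
    have dist: "distinct (cols M)"
    proof (rule ccontr)
      assume "\<not> distinct (cols M)"
      then obtain i j where ij: "i < d" "j < d" "i \<noteq> j" "col M i = col M j"
        using M by (auto simp: distinct_conv_nth)
      have "M *\<^sub>v unit_vec d i = M *\<^sub>v unit_vec d j"
        using ij(4) mat_unit_vec_col[OF M ij(1)] mat_unit_vec_col[OF M ij(2)] by simp
      then have "unit_vec d i = (unit_vec d j :: 'k vec)" by (rule inj_mat_eqD[OF inj M unit_vec_carrier unit_vec_carrier])
      then have "unit_vec d i $ i = (unit_vec d j $ i :: 'k)" by simp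
      then show False using ij by simp
    qed
    have "lin_indpt (set (cols M))"
    proof
      assume "lin_dep (set (cols M))"
      from lin_depE[OF M this dist] obtain v where "v \<in> carrier_vec d" "v \<noteq> 0\<^sub>v d" "M *\<^sub>v v = 0\<^sub>v n" .
      then show False using inj_matD[OF inj M] by blast
    qed
    then show "rank M = d" using lin_indpt_full_rank[OF M dist] by blast
  qed
qed

lemma mat_range_subspace:
  fixes M :: "'k::field mat"
  assumes M: "M \<in> carrier_mat n d"
  shows "subspace class_ring (mat_range M) (module_vec TYPE('k) n)"
proof -
  interpret vec_space "TYPE('k)" n .
  have "set (cols M) \<subseteq> carrier_vec n" using M cols_dim by blast
  then have "subspace class_ring (span (set (cols M))) V" by (intro span_is_subspace) simp
  then show ?thesis using col_space_mat_range[OF M] unfolding col_space_def by simp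
qed

lemma mat_range_dim:
  fixes M :: "'k::field mat"
  assumes M: "M \<in> carrier_mat n d"
  shows "vectorspace.dim class_ring ((module_vec TYPE('k) n)\<lparr>carrier := mat_range M\<rparr>) = vec_space.rank n M"
proof -
  interpret vec_space "TYPE('k)" n .
  show ?thesis unfolding rank_def col_space_mat_range[OF M, symmetric] col_space_def by simp
qed

lemma stiefel_eq: "stiefel n d = {M \<in> carrier_mat n d. inj_mat M}"
proof -
  have "vec_space.col_space n M \<in> Grass n d \<longleftrightarrow> inj_mat M" if M: "M \<in> carrier_mat n d" for M :: "'a mat"
    unfolding Grass_def col_space_mat_range[OF M]
    using mat_range_subspace[OF M] mat_range_dim[OF M] mat_rank_iff_inj_mat[OF M] by simp
  then show ?thesis unfolding stiefel_def by blast
qed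

lemma Grass_eq: "(Grass n d :: 'k::field vec set set) = mat_range ` stiefel n (d::nat)"
proof (intro equalityI subsetI)
  fix W :: "'k vec set" assume W: "W \<in> Grass n d"
  interpret vec_space "TYPE('k)" n .
  have sub: "subspace class_ring W V" and dim: "vectorspace.dim class_ring (V\<lparr>carrier := W\<rparr>) = d"
    using W unfolding Grass_def by auto
  interpret Wv: vectorspace class_ring "V\<lparr>carrier := W\<rparr>" by (rule subspace_is_vs[OF sub])
  have "Wv.fin_dim" by (rule fin_dim_subspace[OF fin_dim sub])
  then obtain B where B: "finite B" "Wv.basis B" using Wv.finite_basis_exists by blast
  have WV: "W \<subseteq> carrier_vec n" using sub unfolding subspace_def submodule_def by auto
  have BW: "B \<subseteq> W" using B(2) unfolding Wv.basis_def by auto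
  have spanB: "span B = W"
    using B(2) span_li_not_depend(1)[OF BW] sub unfolding Wv.basis_def subspace_def by auto
  have cB: "card B = d" using Wv.dim_basis[OF B] dim by simp
  obtain xs where xs: "set xs = B" "distinct xs" using finite_distinct_list[OF B(1)] by blast
  define M where "M = mat_of_cols n xs"
  have len: "length xs = d" using xs cB distinct_card by fastforce
  have M: "M \<in> carrier_mat n d" unfolding M_def using len by auto
  have cols: "cols M = xs" unfolding M_def using xs BW WV by (intro cols_mat_of_cols) auto
  have rg: "mat_range M = W" using col_space_mat_range[OF M] spanB xs cols unfolding col_space_def by simp
  then have "M \<in> stiefel n d" unfolding stiefel_def using W M col_space_mat_range[OF M] by simp
  then show "W \<in> mat_range ` stiefel n d" using rg by blast
next
  fix W :: "'k vec set" assume "W \<in> mat_range ` stiefel n d"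
  then obtain M where M: "M \<in> carrier_mat n d" "vec_space.col_space n M \<in> Grass n d" "W = mat_range M"
    unfolding stiefel_def by blast
  then show "W \<in> Grass n d" using col_space_mat_range[OF M(1)] by simp
qed

text \<open>Two bases of one subspace differ by an invertible matrix: the fibres of
  \<open>mat_range\<close> on the Stiefel set are the orbits of right multiplication by
  GL_d.\<close>

lemma stiefel_same_range:
  assumes M: "M \<in> stiefel n d" and M': "M' \<in> stiefel n d" and eq: "mat_range M = mat_range M'"
  shows "\<exists>g \<in> carrier_mat d d. inj_mat g \<and> M' = M * g"
proof -
  have Mc: "M \<in> carrier_mat n d" "M' \<in> carrier_mat n d" "inj_mat M" "inj_mat M'" using M M' by (auto simp: stiefel_eq)
  have "\<exists>v \<in> carrier_vec d. M *\<^sub>v v = col M' j" if "j < d" for j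
  proof -
    have "M' *\<^sub>v unit_vec d j \<in> mat_range M'" unfolding mat_range_def using Mc by auto
    then have "col M' j \<in> mat_range M" using eq mat_unit_vec_col[OF Mc(2) that] by simp
    then show ?thesis unfolding mat_range_def using Mc by auto
  qed
  then obtain v where v: "\<And>j. j < d \<Longrightarrow> v j \<in> carrier_vec d \<and> M *\<^sub>v v j = col M' j" by metis
  define g where "g = mat_of_cols d (map v [0..<d])"
  have g: "g \<in> carrier_mat d d" unfolding g_def by auto
  have eqm: "M' = M * g"
  proof (rule mat_col_eqI)
    fix j assume "j < dim_col (M * g)"
    then have j: "j < d" using g by auto
    have "col (M * g) j = M *\<^sub>v col g j" using Mc g j by (intro col_mult2) auto
    also have "col g j = v j" unfolding g_def using j v by (subst col_mat_of_cols) auto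
    finally show "col M' j = col (M * g) j" using v j by simp
  qed (use Mc g in auto)
  have "inj_mat g"
  proof (rule inj_matI[OF g])
    fix w assume w: "w \<in> carrier_vec d" "g *\<^sub>v w = 0\<^sub>v d"
    have "M' *\<^sub>v w = 0\<^sub>v n" unfolding eqm using assoc_mult_mat_vec[OF Mc(1) g w(1)] w(2) Mc(1) by auto
    then show "w = 0\<^sub>v d" using inj_matD Mc w by blast
  qed
  then show ?thesis using g eqm by blast
qed

text \<open>A zero locus on the Stiefel set descends to the Grassmannian if it is a union of orbits
  of right multiplication; otherwise the preimage of its image would be larger. The hypothesis
  \<open>inv\<close> expresses this.\<close>

lemma grass_closedI:
  assumes P: "P \<subseteq> polyfun n d"
    and inv: "\<And>M g. M \<in> stiefel n d \<Longrightarrow> g \<in> carrier_mat d d \<Longrightarrow> inj_mat g \<Longrightarrow>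
        \<forall>p\<in>P. p M = 0 \<Longrightarrow> \<forall>p\<in>P. p (M * g) = 0"
  shows "grass_closed n d {W. \<exists>M \<in> stiefel n d. mat_range M = W \<and> (\<forall>p\<in>P. p M = 0)}" (is "grass_closed n d ?F")
  unfolding grass_closed_def
proof (intro conjI exI)
  show "?F \<subseteq> Grass n d" unfolding Grass_eq by auto
  show "zar_closed n d {M \<in> carrier_mat n d. \<forall>p\<in>P. p M = 0}" unfolding zar_closed_def using P by blast
  have cs: "vec_space.col_space n M = mat_range M" if "M \<in> stiefel n d" for M :: "'a mat"
    using that by (intro col_space_mat_range) (auto simp: stiefel_eq)
  show "{M \<in> stiefel n d. vec_space.col_space n M \<in> ?F} = stiefel n d \<inter> {M \<in> carrier_mat n d. \<forall>p\<in>P. p M = 0}"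
  proof (intro equalityI subsetI)
    fix M assume "M \<in> {M \<in> stiefel n d. vec_space.col_space n M \<in> ?F}"
    then have M: "M \<in> stiefel n d" "mat_range M \<in> ?F" using cs by auto
    then obtain M' where M': "M' \<in> stiefel n d" "mat_range M' = mat_range M" "\<forall>p\<in>P. p M' = 0" by auto
    from stiefel_same_range[OF M'(1) M(1) M'(2)] obtain g where "g \<in> carrier_mat d d" "inj_mat g" "M = M' * g" by blast
    then have "\<forall>p\<in>P. p M = 0" using inv[OF M'(1)] M'(3) by blast
    then show "M \<in> stiefel n d \<inter> {M \<in> carrier_mat n d. \<forall>p\<in>P. p M = 0}" using M by (auto simp: stiefel_eq)
  next
    fix M assume "M \<in> stiefel n d \<inter> {M \<in> carrier_mat n d. \<forall>p\<in>P. p M = 0}"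
    then show "M \<in> {M \<in> stiefel n d. vec_space.col_space n M \<in> ?F}" using cs by auto
  qed
qed

lemma grass_closedE:
  assumes "grass_closed n d F"
  obtains P where "P \<subseteq> polyfun n d"
    "\<And>M. M \<in> stiefel n d \<Longrightarrow> mat_range M \<in> F \<longleftrightarrow> (\<forall>p\<in>P. p M = 0)"
proof -
  obtain Z where Z: "zar_closed n d Z"
    "{M \<in> stiefel n d. vec_space.col_space n M \<in> F} = stiefel n d \<inter> Z"
    using assms unfolding grass_closed_def by blast
  obtain P where P: "P \<subseteq> polyfun n d" "Z = {M \<in> carrier_mat n d. \<forall>p\<in>P. p M = 0}"
    using Z(1) unfolding zar_closed_def by blast
  have "mat_range M \<in> F \<longleftrightarrow> (\<forall>p\<in>P. p M = 0)" if M: "M \<in> stiefel n d" for M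
  proof -
    have "M \<in> carrier_mat n d" using M by (simp add: stiefel_eq)
    then have "M \<in> Z \<longleftrightarrow> (\<forall>p\<in>P. p M = 0)" "vec_space.col_space n M = mat_range M"
      using P(2) col_space_mat_range by auto
    moreover have "vec_space.col_space n M \<in> F \<longleftrightarrow> M \<in> Z" using Z(2) M by blast
    ultimately show ?thesis by simp
  qed
  then show ?thesis using that P by blast
qed

lemma grass_closed_Inter:
  assumes "\<And>F. F \<in> \<F> \<Longrightarrow> grass_closed n d F" and ne: "\<F> \<noteq> {}"
  shows "grass_closed n d (\<Inter>\<F>)"
proof -
  have "\<forall>F\<in>\<F>. \<exists>P. P \<subseteq> polyfun n d \<and> (\<forall>M\<in>stiefel n d. mat_range M \<in> F \<longleftrightarrow> (\<forall>p\<in>P. p M = 0))"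
    using assms(1) grass_closedE by metis
  then obtain P where P: "\<And>F. F \<in> \<F> \<Longrightarrow> P F \<subseteq> polyfun n d"
    "\<And>F M. F \<in> \<F> \<Longrightarrow> M \<in> stiefel n d \<Longrightarrow> mat_range M \<in> F \<longleftrightarrow> (\<forall>p\<in>P F. p M = 0)" by metis
  have cs: "vec_space.col_space n M = mat_range M" if "M \<in> stiefel n d" for M :: "'a mat"
    using that by (intro col_space_mat_range) (auto simp: stiefel_eq)
  show ?thesis unfolding grass_closed_def
  proof (intro conjI exI)
    show "\<Inter>\<F> \<subseteq> Grass n d" using assms unfolding grass_closed_def by blast
    show "zar_closed n d {M \<in> carrier_mat n d. \<forall>p\<in>\<Union>(P ` \<F>). p M = 0}"
      unfolding zar_closed_def using P(1) by blast
    have "M \<in> carrier_mat n d" if "M \<in> stiefel n d" for M :: "'a mat" using that by (simp add: stiefel_eq)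
    then show "{M \<in> stiefel n d. vec_space.col_space n M \<in> \<Inter>\<F>} =
        stiefel n d \<inter> {M \<in> carrier_mat n d. \<forall>p\<in>\<Union>(P ` \<F>). p M = 0}"
      using P(2) cs by auto
  qed
qed

section \<open>Charts and bounds for the Krull dimension\<close>

lemma polyfun_sum:
  assumes "\<And>i. i \<in> I \<Longrightarrow> f i \<in> polyfun n d" shows "(\<lambda>M. \<Sum>i\<in>I. f i M) \<in> polyfun n d"
  using assms by (induction I rule: infinite_finite_induct) (auto intro: polyfun.intros)

lemma polyfun_prod:
  assumes "\<And>i. i \<in> I \<Longrightarrow> f i \<in> polyfun n d" shows "(\<lambda>M. \<Prod>i\<in>I. f i M) \<in> polyfun n d"
  using assms by (induction I rule: infinite_finite_induct) (auto intro: polyfun.intros)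

lemma polyfun_power:
  assumes "f \<in> polyfun n d" shows "(\<lambda>M. f M ^ k) \<in> polyfun n d"
  using assms by (induction k) (auto intro: polyfun.intros)

lemma polyfun_det:
  assumes F: "\<And>M. F M \<in> carrier_mat r r"
    and "\<And>i j. i < r \<Longrightarrow> j < r \<Longrightarrow> (\<lambda>M. F M $$ (i,j)) \<in> polyfun n d"
  shows "(\<lambda>M. det (F M)) \<in> polyfun n d"
proof -
  have "(\<lambda>M. det (F M)) = (\<lambda>M. \<Sum>p\<in>{p. p permutes {0..<r}}. signof p * (\<Prod>i = 0..<r. F M $$ (i, p i)))"
    using F by (intro ext det_def')
  also have "\<dots> \<in> polyfun n d"
  proof (intro polyfun_sum polyfun.mult[OF polyfun.const] polyfun_prod assms(2))
    fix p i assume "p \<in> {p. p permutes {0..<r}}" "i \<in> {0..<r}"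
    then show "i < r" "p i < r" using permutes_in_image[of p "{0..<r}" i] by auto
  qed
  finally show ?thesis .
qed

text \<open>The product \<open>L * M\<close> written entrywise, so that its entries are polynomial
  functions of \<open>M\<close> also where the dimensions of \<open>M\<close> do not fit.\<close>
definition lmul :: "nat \<Rightarrow> nat \<Rightarrow> 'k::comm_ring_1 mat \<Rightarrow> 'k mat \<Rightarrow> 'k mat" where
  "lmul n d L M = mat d d (\<lambda>(i,j). \<Sum>k<n. L $$ (i,k) * M $$ (k,j))"

lemma lmul_carrier [simp]: "lmul n d L M \<in> carrier_mat d d"
  by (simp add: lmul_def)

lemma lmul_eq:
  assumes "L \<in> carrier_mat d n" "M \<in> carrier_mat n d" shows "lmul n d L M = L * M"
  using assms by (intro eq_matI) (auto simp: lmul_def scalar_prod_def lessThan_atLeast0)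

lemma polyfun_lmul_entry:
  assumes "i < d" "j < d" shows "(\<lambda>M. lmul n d L M $$ (i,j)) \<in> polyfun n d"
proof -
  have "(\<lambda>M. lmul n d L M $$ (i,j)) = (\<lambda>M. \<Sum>k<n. L $$ (i,k) * M $$ (k,j))"
    using assms by (simp add: lmul_def)
  also have "\<dots> \<in> polyfun n d"
    using assms by (intro polyfun_sum polyfun.mult polyfun.const polyfun.coord) auto
  finally show ?thesis .
qed

lemma polyfun_det_lmul: "(\<lambda>M. det (lmul n d L M)) \<in> polyfun n d"
  by (intro polyfun_det polyfun_lmul_entry) auto

lemma polyfun_cofactor_lmul:
  assumes "i < d" "j < d" shows "(\<lambda>M. cofactor (lmul n d L M) i j) \<in> polyfun n d"
  unfolding cofactor_def
proof (intro polyfun.mult[OF polyfun.const] polyfun_det)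
  show "mat_delete (lmul n d L M) i j \<in> carrier_mat (d - 1) (d - 1)" for M
    by (rule mat_delete_carrier) simp
  fix k l assume kl: "k < d - 1" "l < d - 1"
  let ?k = "if k < i then k else Suc k" and ?l = "if l < j then l else Suc l"
  have "(\<lambda>M. mat_delete (lmul n d L M) i j $$ (k,l)) = (\<lambda>M. lmul n d L M $$ (?k,?l))"
  proof
    fix M
    have "dim_row (lmul n d L M) = d" "dim_col (lmul n d L M) = d" by (simp_all add: lmul_def)
    then show "mat_delete (lmul n d L M) i j $$ (k,l) = lmul n d L M $$ (?k,?l)"
      using kl by (simp add: mat_delete_def)
  qed
  moreover have "(\<lambda>M. lmul n d L M $$ (?k,?l)) \<in> polyfun n d"
    using kl assms by (intro polyfun_lmul_entry) auto
  ultimately show "(\<lambda>M. mat_delete (lmul n d L M) i j $$ (k,l)) \<in> polyfun n d" by simp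
qed

lemma grass_closed_Grass: "grass_closed n d (Grass n d :: 'k::field vec set set)"
proof -
  have "grass_closed n d {W :: 'k vec set. \<exists>M \<in> stiefel n d. mat_range M = W \<and> (\<forall>p\<in>{}. p M = (0::'k))}"
    by (rule grass_closedI) simp_all
  moreover have "{W :: 'k vec set. \<exists>M \<in> stiefel n d. mat_range M = W \<and> (\<forall>p\<in>{}. p M = (0::'k))} = Grass n d"
    unfolding Grass_eq by blast
  ultimately show ?thesis by simp
qed

text \<open>Replacing \<open>M\<close> by \<open>M * g\<close> multiplies \<open>det (L * M)\<close>
  by \<open>det g\<close>, so its vanishing depends on the subspace alone. The locus consists of the
  subspaces that meet the kernel of \<open>L\<close> nontrivially; its complement is an affine
  chart.\<close>

lemma grass_closed_degenerate:
  fixes L :: "'k::field mat"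
  assumes L: "L \<in> carrier_mat d n"
  shows "grass_closed n d {W. \<exists>M \<in> stiefel n d. mat_range M = W \<and> \<not> inj_mat (L * M)}"
proof -
  have iff: "det (lmul n d L M) = 0 \<longleftrightarrow> \<not> inj_mat (L * M)" if "M \<in> carrier_mat n d" for M
    using square_inj_mat_iff_det[of "L * M" d] lmul_eq[OF L that] that L by auto
  have st: "M \<in> carrier_mat n d" if "M \<in> stiefel n d" for M :: "'k mat" using that by (simp add: stiefel_eq)
  have "grass_closed n d {W. \<exists>M \<in> stiefel n d. mat_range M = W \<and> (\<forall>p\<in>{\<lambda>M. det (lmul n d L M)}. p M = 0)}"
  proof (rule grass_closedI)
    show "{\<lambda>M. det (lmul n d L M)} \<subseteq> polyfun n d" using polyfun_det_lmul by blast
    fix M g :: "'k mat"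
    assume M: "M \<in> stiefel n d" and g: "g \<in> carrier_mat d d" and "\<forall>p\<in>{\<lambda>M. det (lmul n d L M)}. p M = 0"
    then have 0: "det (L * M) = 0" using lmul_eq[OF L st[OF M]] by simp
    have "lmul n d L (M * g) = L * (M * g)" using st[OF M] g by (intro lmul_eq[OF L]) auto
    also have "\<dots> = (L * M) * g" using st[OF M] g L by (intro assoc_mult_mat[symmetric]) auto
    finally have "det (lmul n d L (M * g)) = det (L * M) * det g" using st[OF M] g L det_mult[of "L * M" d g] by auto
    then show "\<forall>p\<in>{\<lambda>M. det (lmul n d L M)}. p (M * g) = 0" using 0 by simp
  qed
  moreover have "{W. \<exists>M \<in> stiefel n d. mat_range M = W \<and> (\<forall>p\<in>{\<lambda>M. det (lmul n d L M)}. p M = 0)}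
      = {W. \<exists>M \<in> stiefel n d. mat_range M = W \<and> \<not> inj_mat (L * M)}"
    using iff st by auto
  ultimately show ?thesis by simp
qed

lemma mat_range_degenerate_iff:
  fixes L :: "'k::field mat"
  assumes L: "L \<in> carrier_mat d n" and M: "M \<in> stiefel n d"
  shows "(\<exists>M' \<in> stiefel n d. mat_range M' = mat_range M \<and> \<not> inj_mat (L * M')) \<longleftrightarrow> \<not> inj_mat (L * M)"
proof
  assume "\<exists>M' \<in> stiefel n d. mat_range M' = mat_range M \<and> \<not> inj_mat (L * M')"
  then obtain M' where M': "M' \<in> stiefel n d" "mat_range M' = mat_range M" "\<not> inj_mat (L * M')" by blast
  have c: "M \<in> carrier_mat n d" "M' \<in> carrier_mat n d" using M M' by (auto simp: stiefel_eq)
  from stiefel_same_range[OF M'(1) M M'(2)] obtain g where g: "g \<in> carrier_mat d d" "M = M' * g" by blast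
  have "det (L * M') = 0" using square_inj_mat_iff_det[of "L * M'" d] M'(3) L c by auto
  moreover have "L * M = (L * M') * g" unfolding g(2) using L c g by (intro assoc_mult_mat[symmetric]) auto
  ultimately have "det (L * M) = 0" using det_mult[of "L * M'" d g] L c g by auto
  then show "\<not> inj_mat (L * M)" using square_inj_mat_iff_det[of "L * M" d] L c by auto
qed (use M in blast)

text \<open>\<open>Z i\<close> is the closure in \<open>X\<close> of the image of the first
  \<open>i\<close> coordinate directions, and it is irreducible because a linear space is. The
  matrix \<open>L i\<close> tests whether \<open>u i\<close> vanishes: its degeneracy locus contains
  the image of \<open>U i\<close> and misses a point of the image of \<open>U (Suc i)\<close>, so
  each inclusion is strict.\<close>

theorem krull_dim_lower_bound:
  fixes \<Phi> :: "(nat \<Rightarrow> 'k::field) \<Rightarrow> 'k mat"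
  assumes inf: "infinite (UNIV :: 'k set)"
    and st: "\<And>u. \<Phi> u \<in> stiefel n d" and X: "\<And>u. mat_range (\<Phi> u) \<in> X"
    and pol: "\<And>i j. i < n \<Longrightarrow> j < d \<Longrightarrow> (\<lambda>u. \<Phi> u $$ (i,j)) \<in> parpoly e"
    and L: "\<And>i. i < e \<Longrightarrow> L i \<in> carrier_mat d n"
    and Linj: "\<And>i u. i < e \<Longrightarrow> inj_mat (L i * \<Phi> u) \<longleftrightarrow> u i \<noteq> 0"
  shows "enat e \<le> krull_dim (grass_closed n d) X"
proof -
  \<comment> \<open>\<open>U 0\<close> is the single point 0, so \<open>Z 0\<close>, ...,
    \<open>Z e\<close> form a chain with \<open>e\<close> steps.\<close>
  define U :: "nat \<Rightarrow> (nat \<Rightarrow> 'k) set" where "U i = {u. \<forall>j\<ge>i. u j = 0}" for i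
  define img where "img i = (\<lambda>u. mat_range (\<Phi> u)) ` U i" for i
  define Z where "Z i = X \<inter> \<Inter>{F. grass_closed n d F \<and> img i \<subseteq> F}" for i
  have imgZ: "img i \<subseteq> Z i" for i unfolding Z_def img_def using X by auto
  have Zmin: "Z i \<subseteq> F" if "grass_closed n d F" "img i \<subseteq> F" for i F unfolding Z_def using that by auto
  have 0: "(\<lambda>_. 0) \<in> U i" for i unfolding U_def by auto
  have irr: "irreducible_rel (grass_closed n d) X (Z i)" for i
    unfolding irreducible_rel_def
  proof (intro conjI allI impI)
    have "img i \<subseteq> Grass n d" unfolding img_def Grass_eq using st by auto
    then have "grass_closed n d (\<Inter>{F. grass_closed n d F \<and> img i \<subseteq> F})"
      by (intro grass_closed_Inter) (use grass_closed_Grass in auto)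
    then show "closedin_rel (grass_closed n d) X (Z i)" unfolding closedin_rel_def Z_def by blast
    show "Z i \<noteq> {}" using imgZ 0 unfolding img_def by blast
    fix C1 C2 assume "closedin_rel (grass_closed n d) X C1 \<and> closedin_rel (grass_closed n d) X C2 \<and> Z i \<subseteq> C1 \<union> C2"
    then obtain F1 F2 where F: "grass_closed n d F1" "grass_closed n d F2" "C1 = X \<inter> F1" "C2 = X \<inter> F2"
      and sub: "Z i \<subseteq> C1 \<union> C2" unfolding closedin_rel_def by blast
    from grass_closedE[OF F(1)] obtain P1 where P1: "P1 \<subseteq> polyfun n d"
      "\<And>M. M \<in> stiefel n d \<Longrightarrow> mat_range M \<in> F1 \<longleftrightarrow> (\<forall>p\<in>P1. p M = 0)" by blast
    from grass_closedE[OF F(2)] obtain P2 where P2: "P2 \<subseteq> polyfun n d"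
      "\<And>M. M \<in> stiefel n d \<Longrightarrow> mat_range M \<in> F2 \<longleftrightarrow> (\<forall>p\<in>P2. p M = 0)" by blast
    have "img i \<subseteq> F1 \<or> img i \<subseteq> F2"
    proof (rule ccontr)
      assume "\<not> (img i \<subseteq> F1 \<or> img i \<subseteq> F2)"
      then obtain u v where u: "u \<in> U i" "mat_range (\<Phi> u) \<notin> F1" and v: "v \<in> U i" "mat_range (\<Phi> v) \<notin> F2"
        unfolding img_def by blast
      obtain p where p: "p \<in> P1" "p (\<Phi> u) \<noteq> 0" using u(2) P1(2)[OF st] by blast
      obtain q where q: "q \<in> P2" "q (\<Phi> v) \<noteq> 0" using v(2) P2(2)[OF st] by blast
      have pp: "(\<lambda>u. p (\<Phi> u)) \<in> parpoly e" "(\<lambda>u. q (\<Phi> u)) \<in> parpoly e"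
        using polyfun_comp_parpoly[of p n d \<Phi> e] polyfun_comp_parpoly[of q n d \<Phi> e] p(1) q(1) P1(1) P2(1) pol
        by blast+
      from parpoly_common_nonzero[OF inf pp(1) p(2) pp(2) q(2)] obtain t
        where t: "p (\<Phi> (\<lambda>i. u i + t * (v i - u i))) \<noteq> 0" "q (\<Phi> (\<lambda>i. u i + t * (v i - u i))) \<noteq> 0" by blast
      define w where "w = (\<lambda>i. u i + t * (v i - u i))"
      have "w \<in> U i" using u(1) v(1) unfolding U_def w_def by auto
      then have "mat_range (\<Phi> w) \<in> F1 \<union> F2" using imgZ sub F(3,4) unfolding img_def by blast
      then show False using P1(2)[OF st] P2(2)[OF st] t p(1) q(1) unfolding w_def[symmetric] by blast
    qed
    then show "Z i \<subseteq> C1 \<or> Z i \<subseteq> C2" using Zmin F unfolding Z_def by blast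
  qed
  have strict: "Z i \<subset> Z (Suc i)" if i: "i < e" for i
  proof -
    have "img i \<subseteq> img (Suc i)" unfolding img_def U_def by auto
    then have sub: "Z i \<subseteq> Z (Suc i)" unfolding Z_def by blast
    let ?F = "{W. \<exists>M \<in> stiefel n d. mat_range M = W \<and> \<not> inj_mat (L i * M)}"
    have Fiff: "mat_range (\<Phi> u) \<in> ?F \<longleftrightarrow> u i = 0" for u
      using mat_range_degenerate_iff[OF L[OF i] st] Linj[OF i] by auto
    have "img i \<subseteq> ?F" using Fiff unfolding img_def U_def by auto
    then have ZF: "Z i \<subseteq> ?F" by (rule Zmin[OF grass_closed_degenerate[OF L[OF i]]])
    define u where "u j = (if j = i then 1 else (0::'k))" for j
    have "u \<in> U (Suc i)" unfolding U_def u_def by auto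
    then have "mat_range (\<Phi> u) \<in> Z (Suc i)" using imgZ unfolding img_def by blast
    moreover have "mat_range (\<Phi> u) \<notin> ?F" unfolding Fiff by (simp add: u_def)
    ultimately show ?thesis using sub ZF by blast
  qed
  show ?thesis unfolding krull_dim_def
    by (rule Sup_upper) (use irr strict in blast)
qed

section \<open>Affine charts of the Grassmannian and homogenization\<close>

interpretation fvp: vector_space_pair fscale fscale
  by unfold_locales

lemma fscale_apply [simp]: "fscale c f x = c * f x"
  by (simp add: fscale_def)

definition vfun :: "'k::field vec \<Rightarrow> nat \<Rightarrow> 'k" where
  "vfun v = (\<lambda>i. if i < dim_vec v then v $ i else 0)"

lemma vfun_eq_sum:
  assumes "v \<in> carrier_vec d"
  shows "vfun v = (\<Sum>j<d. fscale (v $ j) (\<lambda>i. if i = j then 1 else 0))"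
proof
  fix i
  have "(\<Sum>j<d. v $ j * (if i = j then 1 else 0)) = (\<Sum>j<d. if j = i then v $ j else 0)"
    by (intro sum.cong) auto
  then show "vfun v i = (\<Sum>j<d. fscale (v $ j) (\<lambda>i. if i = j then 1 else 0)) i"
    using assms by (auto simp: vfun_def fun_sum_apply)
qed

lemma inj_mat_left_inverse:
  fixes M :: "'k::field mat"
  assumes M: "M \<in> carrier_mat n d" and inj: "inj_mat M"
  shows "\<exists>L \<in> carrier_mat d n. L * M = 1\<^sub>m d"
proof -
  \<comment> \<open>Vectors of any length become sequences that vanish beyond it, which makes
    \<open>M\<close> a linear map of one sequence space to itself; its left inverse on
    \<open>V\<close> then yields the entries of \<open>L\<close>.\<close>
  define V :: "(nat \<Rightarrow> 'k) set" where "V = {f. \<forall>i\<ge>d. f i = 0}"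
  define F :: "(nat \<Rightarrow> 'k) \<Rightarrow> nat \<Rightarrow> 'k" where
    "F f = (\<lambda>i. if i < n then (\<Sum>j<d. M $$ (i,j) * f j) else 0)" for f
  have lin: "Vector_Spaces.linear fscale fscale F"
    unfolding Vector_Spaces.linear_iff using fv.vector_space_axioms
    by (auto simp: F_def fun_eq_iff algebra_simps sum.distrib sum_distrib_left)
  have sub: "fv.subspace V" unfolding V_def by (intro fv.subspaceI) auto
  have Fv: "F f = vfun (M *\<^sub>v vec d f)" for f
    using M by (auto simp: F_def vfun_def fun_eq_iff scalar_prod_def lessThan_atLeast0)
  have "inj_on F V"
    unfolding fvp.linear_inj_on_iff_eq_0[OF lin sub]
  proof (intro ballI impI)
    fix f assume f: "f \<in> V" "F f = 0"
    have "M *\<^sub>v vec d f = 0\<^sub>v n"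
    proof (rule eq_vecI)
      fix i assume "i < dim_vec (0\<^sub>v n)"
      then have i: "i < n" by simp
      have "(M *\<^sub>v vec d f) $ i = vfun (M *\<^sub>v vec d f) i" using i M by (simp add: vfun_def)
      also have "\<dots> = 0" using f(2) unfolding Fv by simp
      finally show "(M *\<^sub>v vec d f) $ i = 0\<^sub>v n $ i" using i by simp
    qed (use M in auto)
    then have z: "vec d f = 0\<^sub>v d" using inj_matD[OF inj M] by auto
    show "f = 0"
    proof
      fix i
      show "f i = 0 i"
      proof (cases "i < d")
        case True
        then have "vec d f $ i = 0" using z by simp
        then show ?thesis using True by simp
      qed (use f(1) in \<open>auto simp: V_def\<close>)
    qed
  qed
  from fvp.linear_exists_left_inverse_on[OF lin sub this] obtain g where
    g: "Vector_Spaces.linear fscale fscale g" "\<forall>v\<in>V. g (F v) = v" by blast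
  define L where "L = mat d n (\<lambda>(i,j). g (\<lambda>k. if k = j then 1 else 0) i)"
  have L: "L \<in> carrier_mat d n" unfolding L_def by simp
  have "L * M = 1\<^sub>m d"
  proof (rule eq_matI)
    fix i j assume "i < dim_row (1\<^sub>m d :: 'k mat)" "j < dim_col (1\<^sub>m d :: 'k mat)"
    then have ij: "i < d" "j < d" by auto
    let ?\<delta> = "\<lambda>j k. if k = j then 1 else (0::'k)"
    have "?\<delta> j \<in> V" using ij unfolding V_def by auto
    then have gF: "g (F (?\<delta> j)) = ?\<delta> j" using g(2) by blast
    have "vec d (?\<delta> j) = unit_vec d j" using ij by (intro eq_vecI) auto
    then have "F (?\<delta> j) = vfun (col M j)" unfolding Fv using mat_unit_vec_col[OF M ij(2)] by simp
    also have "\<dots> = (\<Sum>k<n. fscale (col M j $ k) (?\<delta> k))" using M by (intro vfun_eq_sum) auto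
    finally have "g (F (?\<delta> j)) = g (\<Sum>k<n. fscale (col M j $ k) (?\<delta> k))" by (rule arg_cong)
    also have "\<dots> = (\<Sum>k<n. fscale (col M j $ k) (g (?\<delta> k)))"
      unfolding fvp.linear_sum[OF g(1)] fvp.linear_scale[OF g(1)] ..
    finally have "g (F (?\<delta> j)) = (\<Sum>k<n. fscale (col M j $ k) (g (?\<delta> k)))" .
    then have "g (F (?\<delta> j)) i = (\<Sum>k<n. col M j $ k * g (?\<delta> k) i)" by (simp add: fun_sum_apply)
    then have "?\<delta> j i = (\<Sum>k<n. col M j $ k * g (?\<delta> k) i)" unfolding gF .
    moreover have "(L * M) $$ (i,j) = (\<Sum>k<n. g (?\<delta> k) i * col M j $ k)"
      using ij M L by (simp add: scalar_prod_def lessThan_atLeast0 L_def)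
    ultimately show "(L * M) $$ (i,j) = 1\<^sub>m d $$ (i,j)" using ij by (simp add: mult.commute)
  qed (use M L in auto)
  then show ?thesis using L by blast
qed

lemma mat_range_mult_invertible:
  fixes N :: "'k::field mat"
  assumes N: "N \<in> carrier_mat n d" and g: "g \<in> carrier_mat d d" and h: "h \<in> carrier_mat d d"
    and gh: "g * h = 1\<^sub>m d"
  shows "mat_range (N * g) = mat_range N"
proof (intro equalityI subsetI)
  fix w assume "w \<in> mat_range (N * g)"
  then obtain v where v: "v \<in> carrier_vec d" "w = (N * g) *\<^sub>v v" unfolding mat_range_def using g by auto
  then have "w = N *\<^sub>v (g *\<^sub>v v)" using N g by (simp add: assoc_mult_mat_vec)
  then show "w \<in> mat_range N" unfolding mat_range_def using g N v by auto
next
  fix w assume "w \<in> mat_range N"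
  then obtain v where v: "v \<in> carrier_vec d" "w = N *\<^sub>v v" unfolding mat_range_def using N by auto
  have "(N * g) *\<^sub>v (h *\<^sub>v v) = N *\<^sub>v ((g * h) *\<^sub>v v)" using N g h v by (simp add: assoc_mult_mat_vec)
  then have "w = (N * g) *\<^sub>v (h *\<^sub>v v)" using gh v by simp
  then show "w \<in> mat_range (N * g)" unfolding mat_range_def using g h v by auto
qed

text \<open>The matrix \<open>N\<close> is \<open>M\<close> times the inverse of
  \<open>L * M\<close>, the only representative of the subspace with \<open>L * N = 1\<close>. The
  inverse is the adjugate divided by the determinant.\<close>

lemma chart_normalize:
  fixes M :: "'k::field mat"
  assumes L: "L \<in> carrier_mat d n" and M: "M \<in> carrier_mat n d" and det: "det (L * M) \<noteq> 0"
  shows "\<exists>N \<in> carrier_mat n d. L * N = 1\<^sub>m d \<and> M = N * (L * M) \<and> mat_range N = mat_range M"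
proof -
  let ?g = "L * M"
  have g: "?g \<in> carrier_mat d d" using L M by auto
  define h where "h = (1 / det ?g) \<cdot>\<^sub>m adj_mat ?g"
  have h: "h \<in> carrier_mat d d" unfolding h_def using adj_mat(1)[OF g] by simp
  have gh: "?g * h = 1\<^sub>m d"
    unfolding h_def mult_smult_distrib[OF g adj_mat(1)[OF g]] adj_mat(2)[OF g]
    by (intro eq_matI) (use det in auto)
  have hg: "h * ?g = 1\<^sub>m d" using mat_mult_left_right_inverse[OF g h gh] .
  let ?N = "M * h"
  have "L * ?N = 1\<^sub>m d" using assoc_mult_mat[OF L M h] gh by simp
  moreover have "M = ?N * ?g" using assoc_mult_mat[OF M h g] hg M by simp
  moreover have "mat_range ?N = mat_range M" by (rule mat_range_mult_invertible[OF M h g hg])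
  ultimately show ?thesis using M h by (intro bexI[of _ ?N]) auto
qed

text \<open>In the chart coordinate \<open>N\<close>, which is \<open>M\<close> times the inverse of
  \<open>L * M\<close>, the value \<open>p N\<close> is a fraction in the entries of
  \<open>M\<close> with a power of \<open>det (L * M)\<close> below; \<open>q\<close> is its
  numerator. For \<open>M = N * g\<close> the matrix \<open>L * M\<close> is \<open>g\<close>, hence
  the factor \<open>det g ^ s\<close>.\<close>

definition homogenizes :: "nat \<Rightarrow> nat \<Rightarrow> 'k::field mat \<Rightarrow> ('k mat \<Rightarrow> 'k) \<Rightarrow> nat \<Rightarrow> ('k mat \<Rightarrow> 'k) \<Rightarrow> bool" where
  "homogenizes n d L p s q \<longleftrightarrow> (\<forall>N g. N \<in> carrier_mat n d \<longrightarrow> g \<in> carrier_mat d d \<longrightarrow> L * N = 1\<^sub>m d \<longrightarrow>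
    q (N * g) = det g ^ s * p N)"

lemma homogenizesD:
  "homogenizes n d L p s q \<Longrightarrow> N \<in> carrier_mat n d \<Longrightarrow> g \<in> carrier_mat d d \<Longrightarrow> L * N = 1\<^sub>m d \<Longrightarrow>
    q (N * g) = det g ^ s * p N"
  unfolding homogenizes_def by blast

lemma lmul_chart:
  assumes "L \<in> carrier_mat d n" "N \<in> carrier_mat n d" "g \<in> carrier_mat d d" "L * N = 1\<^sub>m d"
  shows "lmul n d L (N * g) = g"
proof -
  have "lmul n d L (N * g) = L * (N * g)" using assms by (intro lmul_eq) auto
  also have "\<dots> = g" using assoc_mult_mat[OF assms(1-3)] assms(3,4) by simp
  finally show ?thesis .
qed

text \<open>Serves to bring several functions to one common exponent.\<close>

lemma homogenizes_shift:
  assumes L: "L \<in> carrier_mat d n" and h: "homogenizes n d L p s q"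
  shows "homogenizes n d L p (s + t) (\<lambda>M. det (lmul n d L M) ^ t * q M)"
  unfolding homogenizes_def
  by (auto simp: lmul_chart[OF L] homogenizesD[OF h] power_add)

lemma polyfun_homogenize:
  fixes p :: "'k::field mat \<Rightarrow> 'k"
  assumes L: "L \<in> carrier_mat d n" and "p \<in> polyfun n d"
  shows "\<exists>s. \<exists>q\<in>polyfun n d. homogenizes n d L p s q"
  using assms(2)
proof (induction rule: polyfun.induct)
  case (const c)
  have "homogenizes n d L (\<lambda>M. c) 0 (\<lambda>M. c)" by (simp add: homogenizes_def)
  then show ?case using polyfun.const by blast
next
  case (coord i j)
  \<comment> \<open>Cramer's rule: \<open>N * g\<close> times the adjugate of \<open>g\<close> is
    \<open>det g\<close> times \<open>N\<close>. As \<open>lmul n d L (N * g)\<close> is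
    \<open>g\<close>, the sum is entry \<open>(i,j)\<close> of that product.\<close>
  let ?q = "\<lambda>M. \<Sum>k<d. M $$ (i,k) * cofactor (lmul n d L M) j k"
  have "homogenizes n d L (\<lambda>M. M $$ (i,j)) 1 ?q"
    unfolding homogenizes_def
  proof (intro allI impI)
    fix N g :: "'k mat" assume N: "N \<in> carrier_mat n d" and g: "g \<in> carrier_mat d d" and LN: "L * N = 1\<^sub>m d"
    have "?q (N * g) = ((N * g) * adj_mat g) $$ (i,j)"
      unfolding lmul_chart[OF L N g LN] using coord N g
      by (simp add: scalar_prod_def lessThan_atLeast0 adj_mat_def)
    also have "(N * g) * adj_mat g = N * (det g \<cdot>\<^sub>m 1\<^sub>m d)"
      using assoc_mult_mat[OF N g adj_mat(1)[OF g]] adj_mat(2)[OF g] by simp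
    also have "\<dots> = det g \<cdot>\<^sub>m N" using N mult_smult_distrib[OF N one_carrier_mat, of "det g"] by simp
    finally show "?q (N * g) = det g ^ 1 * N $$ (i,j)" using coord N by simp
  qed
  moreover have "?q \<in> polyfun n d"
    using coord by (intro polyfun_sum polyfun.mult polyfun.coord polyfun_cofactor_lmul) auto
  ultimately show ?case by blast
next
  case (add p1 p2)
  then obtain s1 q1 s2 q2 where q: "q1 \<in> polyfun n d" "q2 \<in> polyfun n d"
    "homogenizes n d L p1 s1 q1" "homogenizes n d L p2 s2 q2" by blast
  let ?D = "\<lambda>M. det (lmul n d L M)"
  \<comment> \<open>Each summand is multiplied by the power of the determinant that the other one
    carries, which gives the common exponent \<open>s1 + s2\<close>.\<close>
  let ?q = "\<lambda>M. ?D M ^ s2 * q1 M + ?D M ^ s1 * q2 M"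
  have "homogenizes n d L (\<lambda>M. p1 M + p2 M) (s1 + s2) ?q"
    unfolding homogenizes_def
    by (auto simp: lmul_chart[OF L] homogenizesD[OF q(3)] homogenizesD[OF q(4)] power_add algebra_simps)
  moreover have "?q \<in> polyfun n d"
    using q by (intro polyfun.add polyfun.mult polyfun_power polyfun_det_lmul) auto
  ultimately show ?case by blast
next
  case (mult p1 p2)
  then obtain s1 q1 s2 q2 where q: "q1 \<in> polyfun n d" "q2 \<in> polyfun n d"
    "homogenizes n d L p1 s1 q1" "homogenizes n d L p2 s2 q2" by blast
  have "homogenizes n d L (\<lambda>M. p1 M * p2 M) (s1 + s2) (\<lambda>M. q1 M * q2 M)"
    unfolding homogenizes_def
    by (auto simp: homogenizesD[OF q(3)] homogenizesD[OF q(4)] power_add algebra_simps)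
  moreover have "(\<lambda>M. q1 M * q2 M) \<in> polyfun n d" using q by (intro polyfun.mult)
  ultimately show ?case by blast
qed

text \<open>The functions of \<open>R\<close> that vanish on \<open>Y\<close> form a prime ideal;
  for polynomial functions this is irreducibility of \<open>Y\<close>.\<close>

definition prime_on :: "('x \<Rightarrow> 'k::field) set \<Rightarrow> 'x set \<Rightarrow> bool" where
  "prime_on R Y \<longleftrightarrow> Y \<noteq> {} \<and> (\<forall>f\<in>R. \<forall>g\<in>R. (\<forall>x\<in>Y. f x * g x = 0) \<longrightarrow> (\<forall>x\<in>Y. f x = 0) \<or> (\<forall>x\<in>Y. g x = 0))"

lemma prime_onD:
  assumes "prime_on R Y" "f \<in> R" "g \<in> R" "\<And>x. x \<in> Y \<Longrightarrow> f x * g x = 0"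
  shows "(\<forall>x\<in>Y. f x = 0) \<or> (\<forall>x\<in>Y. g x = 0)"
  using assms unfolding prime_on_def by simp

lemma prime_on_prod:
  assumes pr: "prime_on (polyfun n d) Y" and "finite I" and "\<And>i. i \<in> I \<Longrightarrow> f i \<in> polyfun n d"
    and "\<forall>x\<in>Y. (\<Prod>i\<in>I. f i x) = 0"
  shows "\<exists>i\<in>I. \<forall>x\<in>Y. f i x = 0"
  using assms(2-)
proof (induction I rule: finite_induct)
  case empty then show ?case using pr unfolding prime_on_def by auto
next
  case (insert i I)
  have "f i \<in> polyfun n d" "(\<lambda>x. \<Prod>j\<in>I. f j x) \<in> polyfun n d" using insert by (auto intro!: polyfun_prod)
  from prime_onD[OF pr this] have "(\<forall>x\<in>Y. f i x = 0) \<or> (\<forall>x\<in>Y. (\<Prod>j\<in>I. f j x) = 0)"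
    using insert by simp
  then show ?case using insert by blast
qed

text \<open>A chain forces independence: the function that separates the last two sets vanishes on
  the smaller of them, so setting it to 0 in a relation gives a relation one step down the
  chain.\<close>

lemma chain_alg_independent:
  fixes f :: "nat \<Rightarrow> 'k::field mat \<Rightarrow> 'k"
  assumes "\<And>i. i < m \<Longrightarrow> prime_on (polyfun n d) (Y (Suc i))" and "Y 0 \<noteq> {}"
    and "\<And>i. i < m \<Longrightarrow> Y i \<subseteq> Y (Suc i)"
    and "\<And>i. i < m \<Longrightarrow> f i \<in> polyfun n d"
    and "\<And>i x. i < m \<Longrightarrow> x \<in> Y i \<Longrightarrow> f i x = 0"
    and "\<And>i. i < m \<Longrightarrow> \<exists>x \<in> Y (Suc i). f i x \<noteq> 0"
    and "\<forall>x\<in>Y m. (\<Sum>a\<in>PiE {..<m} (\<lambda>_. {..<S}). c a * (\<Prod>i<m. f i x ^ a i)) = 0"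
  shows "\<forall>a\<in>PiE {..<m} (\<lambda>_. {..<S}). c a = 0"
  using assms
proof (induction m arbitrary: c)
  case 0
  then show ?case by auto
next
  case (Suc m)
  let ?E = "PiE {..<m} (\<lambda>_. {..<S})"
  let ?mon = "\<lambda>a x. \<Prod>i<m. f i x ^ a i"
  have IH: "\<forall>a\<in>?E. c a = 0" if "\<forall>x\<in>Y m. (\<Sum>a\<in>?E. c a * ?mon a x) = 0" for c
    by (rule Suc.IH) (use Suc.prems that in \<open>auto\<close>)
  \<comment> \<open>The relation is read as a polynomial in \<open>f m\<close> with \<open>T\<close>
    coefficients. The lowest coefficient vanishes on \<open>Y m\<close>, where \<open>f m\<close> is
    0, hence is trivial by \<open>IH\<close>. What remains is divisible by \<open>f m\<close>, which
    may be cancelled because \<open>Y (Suc m)\<close> is prime and \<open>f m\<close> is not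
    identically 0 on it.\<close>
  have inner: "\<forall>k<T. \<forall>a\<in>?E. c k a = 0"
    if "\<forall>x\<in>Y (Suc m). (\<Sum>k<T. f m x ^ k * (\<Sum>a\<in>?E. c k a * ?mon a x)) = 0" for c T
    using that
  proof (induction T arbitrary: c)
    case 0 then show ?case by simp
  next
    case (Suc T)
    let ?G = "\<lambda>k x. \<Sum>a\<in>?E. c k a * ?mon a x"
    have split: "(\<Sum>k<Suc T. f m x ^ k * ?G k x) = ?G 0 x + f m x * (\<Sum>k<T. f m x ^ k * ?G (Suc k) x)" for x
      by (subst sum.lessThan_Suc_shift) (simp add: sum_distrib_left algebra_simps del: sum.lessThan_Suc)
    have "?G 0 x = 0" if "x \<in> Y m" for x
    proof -
      have "x \<in> Y (Suc m)" "f m x = 0" using that Suc.prems \<open>\<And>i. i < Suc m \<Longrightarrow> Y i \<subseteq> Y (Suc i)\<close>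
        \<open>\<And>i x. i < Suc m \<Longrightarrow> x \<in> Y i \<Longrightarrow> f i x = 0\<close> by blast+
      then have "(\<Sum>k<Suc T. f m x ^ k * ?G k x) = 0" using Suc.prems by blast
      then show ?thesis unfolding split using \<open>f m x = 0\<close> by simp
    qed
    then have c0: "\<forall>a\<in>?E. c 0 a = 0" using IH[of "c 0"] by blast
    have z: "f m x * (\<Sum>k<T. f m x ^ k * ?G (Suc k) x) = 0" if "x \<in> Y (Suc m)" for x
    proof -
      have "(\<Sum>k<Suc T. f m x ^ k * ?G k x) = 0" using Suc.prems that by blast
      then show ?thesis unfolding split using c0 by simp
    qed
    have pf: "(\<lambda>x. \<Sum>k<T. f m x ^ k * ?G (Suc k) x) \<in> polyfun n d" "f m \<in> polyfun n d"
      using \<open>\<And>i. i < Suc m \<Longrightarrow> f i \<in> polyfun n d\<close>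
      by (auto intro!: polyfun_sum polyfun.mult polyfun_power polyfun.const polyfun_prod)
    have "(\<forall>x\<in>Y (Suc m). f m x = 0) \<or> (\<forall>x\<in>Y (Suc m). (\<Sum>k<T. f m x ^ k * ?G (Suc k) x) = 0)"
      by (rule prime_onD[OF _ pf(2,1) z]) (use \<open>\<And>i. i < Suc m \<Longrightarrow> prime_on (polyfun n d) (Y (Suc i))\<close> in auto)
    then have "\<forall>x\<in>Y (Suc m). (\<Sum>k<T. f m x ^ k * ?G (Suc k) x) = 0"
      using \<open>\<And>i. i < Suc m \<Longrightarrow> \<exists>x \<in> Y (Suc i). f i x \<noteq> 0\<close>[of m] by blast
    then have "\<forall>k<T. \<forall>a\<in>?E. c (Suc k) a = 0" by (rule Suc.IH)
    then show ?case using c0 by (auto simp: less_Suc_eq_0_disj)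
  qed
  have E: "PiE {..<Suc m} (\<lambda>_. {..<S}) = (\<lambda>(k,a). a(m := k)) ` ({..<S} \<times> ?E)"
    unfolding lessThan_Suc PiE_insert_eq by simp
  have injE: "inj_on (\<lambda>(k,a). a(m := k)) ({..<S} \<times> ?E)"
    using inj_combinator[of m "{..<m}" "\<lambda>_. {..<S}"] by simp
  have "(\<Sum>a\<in>PiE {..<Suc m} (\<lambda>_. {..<S}). c a * (\<Prod>i<Suc m. f i x ^ a i))
     = (\<Sum>k<S. f m x ^ k * (\<Sum>a\<in>?E. c (a(m := k)) * ?mon a x))" for x
  proof -
    have "(\<Sum>a\<in>PiE {..<Suc m} (\<lambda>_. {..<S}). c a * (\<Prod>i<Suc m. f i x ^ a i))
       = (\<Sum>(k,a)\<in>{..<S} \<times> ?E. c (a(m := k)) * (\<Prod>i<Suc m. f i x ^ (a(m := k)) i))"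
      unfolding E sum.reindex[OF injE] by (simp add: case_prod_unfold)
    also have "\<dots> = (\<Sum>k<S. \<Sum>a\<in>?E. c (a(m := k)) * (\<Prod>i<Suc m. f i x ^ (a(m := k)) i))"
      by (rule sum.cartesian_product[symmetric])
    also have "\<dots> = (\<Sum>k<S. f m x ^ k * (\<Sum>a\<in>?E. c (a(m := k)) * ?mon a x))"
      unfolding sum_distrib_left
    proof (intro sum.cong refl)
      fix k a
      have "(\<Prod>i<m. f i x ^ (a(m := k)) i) = ?mon a x" by (intro prod.cong) auto
      then show "c (a(m := k)) * (\<Prod>i<Suc m. f i x ^ (a(m := k)) i) = f m x ^ k * (c (a(m := k)) * ?mon a x)"
        by (simp add: algebra_simps)
    qed
    finally show ?thesis .
  qed
  then have "\<forall>x\<in>Y (Suc m). (\<Sum>k<S. f m x ^ k * (\<Sum>a\<in>?E. c (a(m := k)) * ?mon a x)) = 0"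
    using Suc.prems(7) by simp
  from inner[OF this] show ?case unfolding E by auto
qed

lemma stiefel_if_range_Grass:
  assumes "M \<in> carrier_mat n d" "mat_range M \<in> Grass n d" shows "M \<in> stiefel n d"
  using assms col_space_mat_range[OF assms(1)] unfolding stiefel_def by simp

text \<open>Each subspace in \<open>Z\<close> on which \<open>L\<close> is injective has exactly one
  basis matrix with \<open>L * N = 1\<close>, so this set is the part of \<open>Z\<close> in the
  affine chart of \<open>L\<close>.\<close>

definition chart :: "nat \<Rightarrow> nat \<Rightarrow> 'k::field mat \<Rightarrow> 'k vec set set \<Rightarrow> 'k mat set" where
  "chart n d L Z = {N \<in> carrier_mat n d. L * N = 1\<^sub>m d \<and> mat_range N \<in> Z}"

lemma chart_stiefel:
  assumes L: "L \<in> carrier_mat d n" and N: "N \<in> carrier_mat n d" and LN: "L * N = 1\<^sub>m d"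
  shows "N \<in> stiefel n d"
proof -
  have "inj_mat N"
  proof (rule inj_matI[OF N])
    fix v assume v: "v \<in> carrier_vec d" "N *\<^sub>v v = 0\<^sub>v n"
    have "(L * N) *\<^sub>v v = L *\<^sub>v (N *\<^sub>v v)" by (rule assoc_mult_mat_vec[OF L N v(1)])
    also have "\<dots> = 0\<^sub>v d" unfolding v(2) using L by auto
    finally show "v = 0\<^sub>v d" unfolding LN using v(1) by simp
  qed
  then show ?thesis using N by (simp add: stiefel_eq)
qed

text \<open>The zeros of a polynomial on the chart become a closed set of the whole Grassmannian
  once the complement of the chart is thrown in.\<close>

lemma grass_closed_chart_zeros:
  fixes L :: "'k::field mat"
  assumes L: "L \<in> carrier_mat d n" and p: "p \<in> polyfun n d"
  shows "\<exists>F. grass_closed n d F \<and> (\<forall>M \<in> stiefel n d. det (L * M) = 0 \<longrightarrow> mat_range M \<in> F) \<and>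
     (\<forall>N \<in> carrier_mat n d. L * N = 1\<^sub>m d \<longrightarrow> (mat_range N \<in> F \<longleftrightarrow> p N = 0))"
proof -
  obtain s q where q: "q \<in> polyfun n d" "homogenizes n d L p s q" using polyfun_homogenize[OF L p] by blast
  let ?D = "\<lambda>M. det (lmul n d L M)"
  \<comment> \<open>The factor \<open>?D M\<close> puts the complement of the chart into the zero
    set. There homogeneity of \<open>q\<close> says nothing, as it concerns products
    \<open>N * g\<close> with \<open>L * N = 1\<close> only.\<close>
  let ?q = "\<lambda>M. ?D M * q M"
  define F where "F = {W. \<exists>M \<in> stiefel n d. mat_range M = W \<and> (\<forall>p\<in>{?q}. p M = 0)}"
  have inv: "?q (M * g) = 0" if M: "M \<in> stiefel n d" and g: "g \<in> carrier_mat d d" and z: "?q M = 0" for M g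
  proof -
    have Mc: "M \<in> carrier_mat n d" using M by (simp add: stiefel_eq)
    have D: "?D (M * g) = ?D M * det g"
    proof -
      have "lmul n d L (M * g) = L * (M * g)" using Mc g by (intro lmul_eq[OF L]) auto
      also have "\<dots> = lmul n d L M * g" using assoc_mult_mat[OF L Mc g] lmul_eq[OF L Mc] by simp
      finally show ?thesis using det_mult[OF lmul_carrier g, of n L M] by simp
    qed
    show ?thesis
    proof (cases "?D M = 0")
      case True then show ?thesis using D by simp
    next
      case False
      then have "det (L * M) \<noteq> 0" using lmul_eq[OF L Mc] by simp
      from chart_normalize[OF L Mc this] obtain N where N: "N \<in> carrier_mat n d" "L * N = 1\<^sub>m d" "M = N * (L * M)" by blast
      have g0: "L * M \<in> carrier_mat d d" using L Mc by simp
      have "q M = det (L * M) ^ s * p N" using homogenizesD[OF q(2) N(1) g0 N(2)] N(3) by simp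
      then have "p N = 0" using z False lmul_eq[OF L Mc] by simp
      moreover have "M * g = N * ((L * M) * g)" using N(3) assoc_mult_mat[OF N(1) g0 g] by simp
      ultimately have "q (M * g) = 0" using homogenizesD[OF q(2) N(1) _ N(2), of "(L * M) * g"] g0 g by simp
      then show ?thesis by simp
    qed
  qed
  have cl: "grass_closed n d F" unfolding F_def
    by (rule grass_closedI) (use inv q polyfun_det_lmul in \<open>auto intro!: polyfun.mult\<close>)
  have iff: "mat_range M \<in> F \<longleftrightarrow> ?q M = 0" if M: "M \<in> stiefel n d" for M
  proof
    assume "mat_range M \<in> F"
    then obtain M' where M': "M' \<in> stiefel n d" "mat_range M' = mat_range M" "?q M' = 0" unfolding F_def by auto
    from stiefel_same_range[OF M'(1) M M'(2)] obtain g where "g \<in> carrier_mat d d" "M = M' * g" by blast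
    then show "?q M = 0" using inv[OF M'(1) _ M'(3)] by simp
  qed (use M in \<open>auto simp: F_def\<close>)
  show ?thesis
  proof (intro exI conjI ballI impI)
    show "grass_closed n d F" by (rule cl)
    show "mat_range M \<in> F" if "M \<in> stiefel n d" "det (L * M) = 0" for M
      using iff[OF that(1)] that lmul_eq[OF L, of M] by (auto simp: stiefel_eq)
    show "mat_range N \<in> F \<longleftrightarrow> p N = 0" if N: "N \<in> carrier_mat n d" "L * N = 1\<^sub>m d" for N
    proof -
      have "?D N = 1" using lmul_eq[OF L N(1)] N(2) by simp
      moreover have "q N = p N" using homogenizesD[OF q(2) N(1) one_carrier_mat N(2)] N(1) by simp
      ultimately show ?thesis using iff[OF chart_stiefel[OF L N]] by simp
    qed
  qed
qed

lemma chart_point: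
  fixes L :: "'k::field mat"
  assumes L: "L \<in> carrier_mat d n" and M: "M \<in> stiefel n d" and W: "mat_range M \<in> Z" and det: "det (L * M) \<noteq> 0"
  shows "\<exists>N \<in> chart n d L Z. mat_range N = mat_range M"
proof -
  have "M \<in> carrier_mat n d" using M by (simp add: stiefel_eq)
  from chart_normalize[OF L this det] show ?thesis unfolding chart_def using W by auto
qed

text \<open>If \<open>f * g\<close> vanishes on the chart, the closed sets that
  \<open>grass_closed_chart_zeros\<close> assigns to \<open>f\<close> and \<open>g\<close> cover
  \<open>Z\<close>, since both contain the complement of the chart; irreducibility of
  \<open>Z\<close> picks one of them.\<close>

lemma chart_prime:
  fixes L :: "'k::field mat"
  assumes L: "L \<in> carrier_mat d n" and X: "X \<subseteq> Grass n d"
    and irr: "irreducible_rel (grass_closed n d) X Z" and ne: "chart n d L Z \<noteq> {}"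
  shows "prime_on (polyfun n d) (chart n d L Z)"
  unfolding prime_on_def
proof (intro conjI ballI impI)
  show "chart n d L Z \<noteq> {}" by (rule ne)
  fix f g assume f: "f \<in> polyfun n d" and g: "g \<in> polyfun n d" and z: "\<forall>x\<in>chart n d L Z. f x * g x = 0"
  have ZX: "Z \<subseteq> X" using irr unfolding irreducible_rel_def closedin_rel_def by blast
  obtain F where F: "grass_closed n d F" "\<And>M. M \<in> stiefel n d \<Longrightarrow> det (L * M) = 0 \<Longrightarrow> mat_range M \<in> F"
     "\<And>N. N \<in> carrier_mat n d \<Longrightarrow> L * N = 1\<^sub>m d \<Longrightarrow> mat_range N \<in> F \<longleftrightarrow> f N = 0"
    using grass_closed_chart_zeros[OF L f] by blast
  obtain G where G: "grass_closed n d G" "\<And>M. M \<in> stiefel n d \<Longrightarrow> det (L * M) = 0 \<Longrightarrow> mat_range M \<in> G"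
     "\<And>N. N \<in> carrier_mat n d \<Longrightarrow> L * N = 1\<^sub>m d \<Longrightarrow> mat_range N \<in> G \<longleftrightarrow> g N = 0"
    using grass_closed_chart_zeros[OF L g] by blast
  have "Z \<subseteq> (X \<inter> F) \<union> (X \<inter> G)"
  proof
    fix W assume W: "W \<in> Z"
    then obtain M where M: "M \<in> stiefel n d" "W = mat_range M" using ZX X unfolding Grass_eq by blast
    show "W \<in> (X \<inter> F) \<union> (X \<inter> G)"
    proof (cases "det (L * M) = 0")
      case True then show ?thesis using F(2) M W ZX by blast
    next
      case False
      from chart_point[OF L M(1) _ False] obtain N where N: "N \<in> chart n d L Z" "mat_range N = W" using M W by blast
      have "f N = 0 \<or> g N = 0" using z N(1) by auto
      then show ?thesis using F(3)[of N] G(3)[of N] N W ZX unfolding chart_def by blast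
    qed
  qed
  then have "Z \<subseteq> X \<inter> F \<or> Z \<subseteq> X \<inter> G"
    using irr F(1) G(1) unfolding irreducible_rel_def closedin_rel_def by blast
  then show "(\<forall>x\<in>chart n d L Z. f x = 0) \<or> (\<forall>x\<in>chart n d L Z. g x = 0)"
    using F(3) G(3) unfolding chart_def by blast
qed

text \<open>An irreducible \<open>Z'\<close> is not covered by \<open>Z\<close> and the complement
  of the chart, so it has a point in the chart and outside \<open>Z\<close>; an equation of
  \<open>Z\<close> that fails there is the required function.\<close>

lemma chart_separate:
  fixes L :: "'k::field mat"
  assumes L: "L \<in> carrier_mat d n" and X: "X \<subseteq> Grass n d"
    and cl: "closedin_rel (grass_closed n d) X Z" and irr: "irreducible_rel (grass_closed n d) X Z'"
    and less: "Z \<subset> Z'" and ne: "chart n d L Z \<noteq> {}"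
  shows "\<exists>f\<in>polyfun n d. (\<forall>x\<in>chart n d L Z. f x = 0) \<and> (\<exists>x\<in>chart n d L Z'. f x \<noteq> 0)"
proof -
  obtain F where F: "grass_closed n d F" "Z = X \<inter> F" using cl unfolding closedin_rel_def by blast
  from grass_closedE[OF F(1)] obtain P where P: "P \<subseteq> polyfun n d"
    "\<And>M. M \<in> stiefel n d \<Longrightarrow> mat_range M \<in> F \<longleftrightarrow> (\<forall>p\<in>P. p M = 0)" by blast
  let ?Q = "{W. \<exists>M \<in> stiefel n d. mat_range M = W \<and> \<not> inj_mat (L * M)}"
  have Z'X: "Z' \<subseteq> X" using irr unfolding irreducible_rel_def closedin_rel_def by blast
  obtain N0 where N0: "N0 \<in> chart n d L Z" using ne by blast
  have N0': "N0 \<in> carrier_mat n d" "L * N0 = 1\<^sub>m d" "mat_range N0 \<in> Z" using N0 unfolding chart_def by auto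
  have "inj_mat (L * N0)" using square_inj_mat_iff_det[of "L * N0" d] N0' L by simp
  then have "mat_range N0 \<notin> ?Q" using mat_range_degenerate_iff[OF L chart_stiefel[OF L N0'(1,2)]] by simp
  then have "\<not> Z' \<subseteq> X \<inter> ?Q" using N0'(3) less by blast
  moreover have "\<not> Z' \<subseteq> Z" using less by blast
  moreover have "closedin_rel (grass_closed n d) X (X \<inter> ?Q)"
    unfolding closedin_rel_def using grass_closed_degenerate[OF L] by blast
  ultimately have "\<not> Z' \<subseteq> Z \<union> (X \<inter> ?Q)" using irr cl unfolding irreducible_rel_def by blast
  then obtain W where W: "W \<in> Z'" "W \<notin> Z" "W \<notin> ?Q" using Z'X by blast
  obtain M where M: "M \<in> stiefel n d" "W = mat_range M" using W(1) Z'X X unfolding Grass_eq by blast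
  have Mc: "M \<in> carrier_mat n d" using M by (simp add: stiefel_eq)
  have "inj_mat (L * M)" using W(3) M by blast
  then have "det (L * M) \<noteq> 0" using square_inj_mat_iff_det[of "L * M" d] L Mc by simp
  from chart_point[OF L M(1) _ this, of Z'] obtain N where N: "N \<in> chart n d L Z'" "mat_range N = W" using M W by blast
  have Nc: "N \<in> carrier_mat n d" "L * N = 1\<^sub>m d" using N unfolding chart_def by auto
  have "W \<notin> F" using W Z'X F(2) by blast
  then obtain p where p: "p \<in> P" "p N \<noteq> 0" using P(2)[OF chart_stiefel[OF L Nc]] N(2) by blast
  have "p x = 0" if x: "x \<in> chart n d L Z" for x
  proof -
    have "x \<in> carrier_mat n d" "L * x = 1\<^sub>m d" "mat_range x \<in> F" using x F(2) unfolding chart_def by auto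
    then show ?thesis using P(2)[OF chart_stiefel[OF L]] p(1) by blast
  qed
  then show ?thesis using p N P(1) by blast
qed

section \<open>Upper bound for the Krull dimension by counting monomials\<close>

lemma counting_exponent:
  assumes "e < m" shows "\<exists>S. (D * S * m + 1) ^ e < S ^ (m::nat)"
proof -
  define K where "K = D * m + 1"
  \<comment> \<open>Since \<open>D * S * m + 1 \<le> S * K\<close>, the left side is at most
    \<open>S ^ e * K ^ e\<close>; an \<open>S\<close> larger than \<open>K ^ e\<close> makes this
    less than \<open>S ^ Suc e\<close>.\<close>
  define S where "S = K ^ e + 1"
  have S1: "S \<ge> 1" unfolding S_def by simp
  have "D * S * m + 1 \<le> S * K" unfolding K_def using S1 by (simp add: algebra_simps)
  then have "(D * S * m + 1) ^ e \<le> (S * K) ^ e" by (intro power_mono) auto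
  also have "\<dots> = S ^ e * K ^ e" by (simp add: power_mult_distrib)
  also have "\<dots> < S ^ e * S" using S1 unfolding S_def by (intro mult_strict_left_mono) auto
  also have "\<dots> = S ^ Suc e" by simp
  also have "\<dots> \<le> S ^ m" using assms S1 by (intro power_increasing) auto
  finally show ?thesis by blast
qed

text \<open>The matrices of a family are arbitrary bases, not the normalized ones of a chart, so the
  separating functions are evaluated on them in homogenized form and a power of a determinant is
  cancelled afterwards. The product of the relations of all families vanishes on the chart of the
  largest set, which is prime, so one relation holds on all of it, contrary to
  \<open>chain_alg_independent\<close>.\<close>

theorem krull_dim_upper_bound:
  fixes X :: "'k::field vec set set"
  assumes X: "X \<subseteq> Grass n d" and fin: "finite \<Psi>"
    and car: "\<And>\<phi> u. \<phi> \<in> \<Psi> \<Longrightarrow> \<phi> u \<in> carrier_mat n d"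
    and pol: "\<And>\<phi> i j. \<phi> \<in> \<Psi> \<Longrightarrow> i < n \<Longrightarrow> j < d \<Longrightarrow> (\<lambda>u. \<phi> u $$ (i,j)) \<in> parpoly e"
    and cover: "\<And>W. W \<in> X \<Longrightarrow> \<exists>\<phi>\<in>\<Psi>. \<exists>u. mat_range (\<phi> u) = W"
  shows "krull_dim (grass_closed n d) X \<le> enat e"
  unfolding krull_dim_def
proof (rule Sup_least, clarify)
  fix m Z assume irr: "\<forall>i\<le>m. irreducible_rel (grass_closed n d) X (Z i)" and str: "\<forall>i<m. Z i \<subset> Z (Suc i)"
  show "enat m \<le> enat e"
  proof (rule ccontr)
    assume "\<not> enat m \<le> enat e"
    then have em: "e < m" by simp
    have ZX: "Z i \<subseteq> X" if "i \<le> m" for i using irr that unfolding irreducible_rel_def closedin_rel_def by blast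
    obtain W0 where W0: "W0 \<in> Z 0" using irr unfolding irreducible_rel_def by blast
    then obtain M0 where M0: "M0 \<in> stiefel n d" "W0 = mat_range M0" using ZX[of 0] X unfolding Grass_eq by blast
    have M0c: "M0 \<in> carrier_mat n d" "inj_mat M0" using M0 by (auto simp: stiefel_eq)
    \<comment> \<open>\<open>L\<close> is taken from a point of the smallest set \<open>Z 0\<close>,
      so every member of the chain meets the chart.\<close>
    obtain L where L: "L \<in> carrier_mat d n" "L * M0 = 1\<^sub>m d" using inj_mat_left_inverse[OF M0c] by blast
    let ?Y = "\<lambda>i. chart n d L (Z i)"
    have Y0: "M0 \<in> ?Y 0" using M0c L W0 M0 unfolding chart_def by auto
    have Zmono: "Z 0 \<subseteq> Z i" if "i \<le> m" for i using that
      by (induction i) (use str in \<open>auto simp: Suc_le_eq\<close>)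
    have Yne: "?Y i \<noteq> {}" if "i \<le> m" for i using Y0 Zmono[OF that] unfolding chart_def by blast
    have prime: "prime_on (polyfun n d) (?Y i)" if "i \<le> m" for i
      using chart_prime[OF L(1) X _ Yne[OF that]] irr that by blast
    have "\<exists>f. f\<in>polyfun n d \<and> (\<forall>x\<in>?Y i. f x = 0) \<and> (\<exists>x\<in>?Y (Suc i). f x \<noteq> 0)" if "i < m" for i
    proof -
      have "closedin_rel (grass_closed n d) X (Z i)" using irr that unfolding irreducible_rel_def by simp
      moreover have "irreducible_rel (grass_closed n d) X (Z (Suc i))" "Z i \<subset> Z (Suc i)" "i \<le> m"
        using irr str that by auto
      ultimately show ?thesis using chart_separate[OF L(1) X _ _ _ Yne, of i "Z (Suc i)"] by blast
    qed
    then obtain f where f: "\<And>i. i < m \<Longrightarrow> f i \<in> polyfun n d" "\<And>i x. i < m \<Longrightarrow> x \<in> ?Y i \<Longrightarrow> f i x = 0"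
      "\<And>i. i < m \<Longrightarrow> \<exists>x\<in>?Y (Suc i). f i x \<noteq> 0" by metis
    have "\<exists>s q. q \<in> polyfun n d \<and> homogenizes n d L (f i) s q" if "i < m" for i
      using polyfun_homogenize[OF L(1) f(1)[OF that]] by blast
    then obtain s0 q0 where q0: "\<And>i. i < m \<Longrightarrow> q0 i \<in> polyfun n d" "\<And>i. i < m \<Longrightarrow> homogenizes n d L (f i) (s0 i) (q0 i)"
      by metis
    \<comment> \<open>A common exponent for all separating functions: \<open>s\<close> is at least
      every \<open>s0 i\<close>.\<close>
    define s where "s = (\<Sum>i<m. s0 i)"
    define D where "D = (\<lambda>M. det (lmul n d L M))"
    define h where "h i = (\<lambda>M. D M ^ (s - s0 i) * q0 i M)" for i
    have Dp: "D \<in> polyfun n d" unfolding D_def by (rule polyfun_det_lmul)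
    have hp: "h i \<in> polyfun n d" if "i < m" for i
      unfolding h_def using q0(1)[OF that] Dp by (intro polyfun.mult polyfun_power)
    have hh: "homogenizes n d L (f i) s (h i)" if "i < m" for i
    proof -
      have "s0 i \<le> s" unfolding s_def using that by (intro member_le_sum) auto
      then show ?thesis using homogenizes_shift[OF L(1) q0(2)[OF that], of "s - s0 i"] unfolding h_def D_def by simp
    qed
    define rel where "rel \<phi> S c \<longleftrightarrow> (\<exists>a\<in>PiE {..<m} (\<lambda>_. {..<S}). c a \<noteq> 0) \<and>
       (\<forall>N\<in>?Y m. (\<exists>u. mat_range (\<phi> u) = mat_range N) \<longrightarrow>
          (\<Sum>a\<in>PiE {..<m} (\<lambda>_. {..<S}). c a * (\<Prod>i<m. f i N ^ a i)) = 0)"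
      for \<phi> :: "(nat \<Rightarrow> 'k) \<Rightarrow> 'k mat" and S :: nat and c
    have "\<exists>S c. rel \<phi> S c" if \<phi>: "\<phi> \<in> \<Psi>" for \<phi>
    proof -
      have "(\<lambda>u. h i (\<phi> u)) \<in> parpoly e" if "i < m" for i
        using polyfun_comp_parpoly[OF hp[OF that], of \<phi> e] pol[OF \<phi>] by blast
      then have "\<forall>i. \<exists>D. i < m \<longrightarrow> (\<lambda>u. h i (\<phi> u)) \<in> mpol e D" using parpoly_mpol by blast
      then obtain D1 where D1: "\<And>i. i < m \<Longrightarrow> (\<lambda>u. h i (\<phi> u)) \<in> mpol e (D1 i)" by metis
      have "(\<lambda>u. D (\<phi> u) ^ s) \<in> parpoly e"
        using polyfun_comp_parpoly[OF polyfun_power[OF Dp], of \<phi> e s] pol[OF \<phi>] by blast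
      then obtain D2 where D2: "(\<lambda>u. D (\<phi> u) ^ s) \<in> mpol e D2" using parpoly_mpol by blast
      define E where "E = D2 + (\<Sum>i<m. D1 i)"
      have E1: "(\<lambda>u. h i (\<phi> u)) \<in> mpol e E" if "i < m" for i
      proof -
        have "D1 i \<le> (\<Sum>i<m. D1 i)" using that by (intro member_le_sum) auto
        then have "D1 i \<le> E" unfolding E_def by simp
        then show ?thesis using D1[OF that] mpol_mono by blast
      qed
      have E2: "(\<lambda>u. D (\<phi> u) ^ s) \<in> mpol e E" using D2 mpol_mono[of D2 E e] unfolding E_def by auto
      obtain S where S: "(E * S * m + 1) ^ e < S ^ m" using counting_exponent[OF em] by blast
      let ?I = "PiE {..<m} (\<lambda>_. {..<S})"
      \<comment> \<open>Padding with powers of \<open>D (\<phi> u) ^ s\<close> brings every factor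
        to total exponent \<open>S\<close>, so that all \<open>G a\<close> carry the same power of
        \<open>det g\<close>. A linear relation between them is then one between the monomials in
        the \<open>f i\<close>.\<close>
      define G where "G a = (\<lambda>u. \<Prod>i<m. h i (\<phi> u) ^ a i * (D (\<phi> u) ^ s) ^ (S - a i))" for a
      have "G a \<in> fv.span (par_monos e (E * S * m))" if a: "a \<in> ?I" for a
      proof -
        have "(\<lambda>u. h i (\<phi> u) ^ a i * (D (\<phi> u) ^ s) ^ (S - a i)) \<in> mpol e (E * S)" if i: "i < m" for i
        proof -
          have "(\<lambda>u. h i (\<phi> u) ^ a i * (D (\<phi> u) ^ s) ^ (S - a i)) \<in> mpol e (E * a i + E * (S - a i))"
            by (intro mpol_mult mpol_power E1 E2 i)
          moreover have "E * a i + E * (S - a i) = E * S"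
          proof -
            have "a i \<in> {..<S}" using a i by (auto simp: PiE_iff)
            then show ?thesis by (simp add: distrib_left[symmetric])
          qed
          ultimately show ?thesis by simp
        qed
        then have "G a \<in> mpol e (E * S * card {..<m})" unfolding G_def by (intro mpol_prod) auto
        then show ?thesis unfolding mpol_def by simp
      qed
      moreover have "card (par_monos e (E * S * m) :: ((nat \<Rightarrow> 'k) \<Rightarrow> 'k) set) < card ?I"
        using S card_par_monos[of e "E * S * m", where ?'a='k] by (simp add: card_PiE)
      moreover have "finite ?I" by (intro finite_PiE) auto
      ultimately obtain c where c: "\<exists>a\<in>?I. c a \<noteq> 0" "\<And>u. (\<Sum>a\<in>?I. c a * G a u) = 0"
        using linear_relation[OF _ finite_par_monos, of ?I e "E * S * m" G] by blast
      have "(\<Sum>a\<in>?I. c a * (\<Prod>i<m. f i N ^ a i)) = 0"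
        if N: "N \<in> ?Y m" and u: "mat_range (\<phi> u) = mat_range N" for N u
      proof -
        have Nc: "N \<in> carrier_mat n d" "L * N = 1\<^sub>m d" "mat_range N \<in> Z m" using N unfolding chart_def by auto
        have Nst: "N \<in> stiefel n d" by (rule chart_stiefel[OF L(1) Nc(1,2)])
        have "\<phi> u \<in> stiefel n d" using stiefel_if_range_Grass[OF car[OF \<phi>]] u Nc(3) ZX[of m] X by auto
        from stiefel_same_range[OF Nst this u[symmetric]] obtain g where
          g: "g \<in> carrier_mat d d" "inj_mat g" "\<phi> u = N * g" by blast
        have dg: "det g \<noteq> 0" using square_inj_mat_iff_det[OF g(1)] g(2) by simp
        have Du: "D (\<phi> u) = det g" unfolding D_def g(3) using lmul_chart[OF L(1) Nc(1) g(1) Nc(2)] by simp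
        have hu: "h i (\<phi> u) = det g ^ s * f i N" if "i < m" for i
          unfolding g(3) by (rule homogenizesD[OF hh[OF that] Nc(1) g(1) Nc(2)])
        have Gu: "G a u = (det g ^ s) ^ (S * m) * (\<Prod>i<m. f i N ^ a i)" if a: "a \<in> ?I" for a
        proof -
          have "G a u = (\<Prod>i<m. (det g ^ s) ^ S * f i N ^ a i)"
            unfolding G_def
          proof (intro prod.cong refl)
            fix i assume "i \<in> {..<m}"
            then have i: "i < m" "a i < S" using a by (auto simp: PiE_iff)
            have "h i (\<phi> u) ^ a i * (D (\<phi> u) ^ s) ^ (S - a i)
               = ((det g ^ s) ^ a i * (det g ^ s) ^ (S - a i)) * f i N ^ a i"
              unfolding hu[OF i(1)] Du power_mult_distrib by (simp add: mult_ac)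
            also have "(det g ^ s) ^ a i * (det g ^ s) ^ (S - a i) = (det g ^ s) ^ S"
              using i(2) by (simp add: power_add[symmetric])
            finally show "h i (\<phi> u) ^ a i * (D (\<phi> u) ^ s) ^ (S - a i) = (det g ^ s) ^ S * f i N ^ a i" .
          qed
          also have "\<dots> = (det g ^ s) ^ (S * m) * (\<Prod>i<m. f i N ^ a i)"
            by (simp add: prod.distrib power_mult)
          finally show ?thesis .
        qed
        have "(\<Sum>a\<in>?I. c a * G a u) = (\<Sum>a\<in>?I. (det g ^ s) ^ (S * m) * (c a * (\<Prod>i<m. f i N ^ a i)))"
          by (intro sum.cong refl) (simp add: Gu mult_ac)
        also have "\<dots> = (det g ^ s) ^ (S * m) * (\<Sum>a\<in>?I. c a * (\<Prod>i<m. f i N ^ a i))"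
          by (rule sum_distrib_left[symmetric])
        finally have "(det g ^ s) ^ (S * m) * (\<Sum>a\<in>?I. c a * (\<Prod>i<m. f i N ^ a i)) = 0" using c(2) by simp
        then show ?thesis using dg by simp
      qed
      then have "rel \<phi> S c" unfolding rel_def using c(1) by blast
      then show ?thesis by blast
    qed
    then obtain S c where "\<And>\<phi>. \<phi> \<in> \<Psi> \<Longrightarrow> rel \<phi> (S \<phi>) (c \<phi>)" by metis
    then have Sc: "\<And>\<phi>. \<phi> \<in> \<Psi> \<Longrightarrow> \<exists>a\<in>PiE {..<m} (\<lambda>_. {..<S \<phi>}). c \<phi> a \<noteq> 0"
      "\<And>\<phi> N u. \<phi> \<in> \<Psi> \<Longrightarrow> N\<in>?Y m \<Longrightarrow> mat_range (\<phi> u) = mat_range N \<Longrightarrow>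
          (\<Sum>a\<in>PiE {..<m} (\<lambda>_. {..<S \<phi>}). c \<phi> a * (\<Prod>i<m. f i N ^ a i)) = 0"
      unfolding rel_def by blast+
    define R where "R \<phi> N = (\<Sum>a\<in>PiE {..<m} (\<lambda>_. {..<S \<phi>}). c \<phi> a * (\<Prod>i<m. f i N ^ a i))" for \<phi> N
    have Rp: "R \<phi> \<in> polyfun n d" for \<phi>
      unfolding R_def using f(1) by (intro polyfun_sum polyfun.mult polyfun.const polyfun_prod polyfun_power) auto
    have "\<forall>N\<in>?Y m. (\<Prod>\<phi>\<in>\<Psi>. R \<phi> N) = 0"
    proof
      fix N assume N: "N \<in> ?Y m"
      then have "mat_range N \<in> X" using ZX[of m] unfolding chart_def by auto
      then obtain \<phi> u where "\<phi> \<in> \<Psi>" "mat_range (\<phi> u) = mat_range N" using cover by blast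
      then have "R \<phi> N = 0" "\<phi> \<in> \<Psi>" using Sc(2) N unfolding R_def by auto
      then show "(\<Prod>\<phi>\<in>\<Psi>. R \<phi> N) = 0" using fin by (intro prod_zero) auto
    qed
    from prime_on_prod[OF prime[OF order_refl] fin Rp this] obtain \<phi> where \<phi>: "\<phi> \<in> \<Psi>" "\<forall>N\<in>?Y m. R \<phi> N = 0" by blast
    have "\<forall>a\<in>PiE {..<m} (\<lambda>_. {..<S \<phi>}). c \<phi> a = 0"
    proof (rule chain_alg_independent[of m n d ?Y f])
      show "?Y i \<subseteq> ?Y (Suc i)" if "i < m" for i using str that unfolding chart_def by auto
    qed (use prime Y0 f \<phi>(2) in \<open>auto simp: R_def\<close>)
    then show False using Sc(1)[OF \<phi>(1)] by blast
  qed
qed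

section \<open>The generic family of invariant subspaces\<close>

text \<open>\<open>m h\<close> is the number of boxes with second coordinate \<open>h\<close>; a
  decreasing \<open>m\<close> is the partition conjugate to the row lengths.\<close>

definition young :: "(nat \<Rightarrow> nat) \<Rightarrow> (nat \<times> nat) set" where
  "young m = {(b,h). b < m h}"

definition supp_in :: "(nat \<times> nat) set \<Rightarrow> (nat \<times> nat \<Rightarrow> 'k::field) set" where
  "supp_in D = {f. \<forall>p. p \<notin> D \<longrightarrow> f p = 0}"

definition jop :: "(nat \<Rightarrow> 'k::field) \<Rightarrow> (nat \<times> nat \<Rightarrow> 'k) \<Rightarrow> nat \<times> nat \<Rightarrow> 'k" where
  "jop c f = (\<lambda>(b,h). c h * f (b,h) + f (b,Suc h))"

text \<open>The operator \<open>jop c\<close> minus the scalar \<open>c i\<close>. Its diagonal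
  coefficient vanishes in layer \<open>h = i\<close>, on which the cancellations below rest.\<close>

definition jshift :: "(nat \<Rightarrow> 'k::field) \<Rightarrow> nat \<Rightarrow> (nat \<times> nat \<Rightarrow> 'k) \<Rightarrow> nat \<times> nat \<Rightarrow> 'k" where
  "jshift c i f = (\<lambda>(b,h). (c h - c i) * f (b,h) + f (b,Suc h))"

lemma jop_jshift: "jop c f p = c i * f p + jshift c i f p"
  by (cases p) (simp add: jop_def jshift_def algebra_simps)

text \<open>Since \<open>m\<close> is decreasing, a box \<open>(b,Suc h)\<close> of the diagram has
  \<open>(b,h)\<close> in it as well, so no value is moved out of the diagram.\<close>

lemma jshift_supp:
  assumes "antimono m" "f \<in> supp_in (young m)" shows "jshift c i f \<in> supp_in (young m)"
proof -
  have "jshift c i f (b,h) = 0" if "\<not> b < m h" for b h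
  proof -
    have "m (Suc h) \<le> m h" using assms(1) by (simp add: antimonoD)
    then have "\<not> b < m (Suc h)" using that by simp
    then show ?thesis using that assms(2) by (auto simp: jshift_def supp_in_def young_def)
  qed
  then show ?thesis by (auto simp: supp_in_def young_def)
qed

text \<open>As \<open>d\<close> is decreasing, \<open>young d\<close> is itself a diagram. The
  subspaces constructed have a basis indexed by its boxes; when all parameters are 0 this is the
  coordinate subspace of functions supported on \<open>young d\<close>.\<close>

locale generic_subspace =
  fixes m d :: "nat \<Rightarrow> nat" and c :: "nat \<Rightarrow> 'k::field" and K :: nat
  assumes m_anti: "antimono m" and d_anti: "antimono d" and d_le: "d h \<le> m h"
    and m_zero: "h \<ge> K \<Longrightarrow> m h = 0"
begin

text \<open>The length of row \<open>b\<close> of \<open>young d\<close>.\<close>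

definition \<nu> :: "nat \<Rightarrow> nat" where "\<nu> b = (LEAST h. d h \<le> b)"

lemma less_d_iff: "b < d h \<longleftrightarrow> h < \<nu> b"
proof
  assume b: "b < d h"
  show "h < \<nu> b"
  proof (rule ccontr)
    assume "\<not> h < \<nu> b"
    then have "d h \<le> d (\<nu> b)" using d_anti by (simp add: antimonoD)
    moreover have "d (\<nu> b) \<le> b" unfolding \<nu>_def
      by (rule LeastI[of _ K]) (use d_le[of K] m_zero[of K] in simp)
    ultimately show False using b by simp
  qed
next
  assume "h < \<nu> b"
  then show "b < d h" unfolding \<nu>_def using not_less_Least by (metis not_le)
qed

text \<open>The triple \<open>(b,b',h)\<close> is the coefficient, in the generator of row
  \<open>b\<close>, of the box \<open>(b',h)\<close>, which lies in \<open>young m\<close> but not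
  in \<open>young d\<close>. The condition \<open>b < d h\<close> restricts to the layers that row
  \<open>b\<close> reaches.\<close>

definition pars :: "(nat \<times> nat \<times> nat) set" where
  "pars = {(b,b',h). b < d h \<and> d h \<le> b' \<and> b' < m h}"

lemma finite_young: "finite (young m)"
proof (rule finite_subset)
  show "young m \<subseteq> {..<m 0} \<times> {..<K}"
  proof
    fix p assume "p \<in> young m"
    then obtain b h where p: "p = (b,h)" "b < m h" by (auto simp: young_def)
    have "h < K" using p m_zero[of h] by (cases "h < K") auto
    moreover have "b < m 0" using p m_anti antimonoD[of m 0 h] by simp
    ultimately show "p \<in> {..<m 0} \<times> {..<K}" using p by simp
  qed
qed simp

lemma young_d_subset: "young d \<subseteq> young m"
  using d_le by (auto simp: young_def intro: less_le_trans)

lemma finite_young_d: "finite (young d)"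
  using young_d_subset finite_young by (rule finite_subset)

lemma card_pars: "finite pars" "card pars = (\<Sum>h<K. d h * (m h - d h))"
proof -
  have h: "h < K" if "b < d h" for b h
  proof (rule ccontr)
    assume "\<not> h < K"
    then show False using that d_le[of h] m_zero[of h] by simp
  qed
  have eq: "pars = (\<lambda>(h,b,b'). (b,b',h)) ` (SIGMA h:{..<K}. {..<d h} \<times> {d h..<m h})"
    unfolding pars_def using h by (auto simp: image_iff)
  have inj: "inj_on (\<lambda>(h,b,b'). (b,b',h)) (SIGMA h:{..<K}. {..<d h} \<times> {d h..<m h})"
    by (auto simp: inj_on_def)
  show "finite pars" unfolding eq by auto
  show "card pars = (\<Sum>h<K. d h * (m h - d h))"
    unfolding eq card_image[OF inj] by (subst card_SigmaI) auto
qed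

text \<open>The generator of row \<open>b\<close>: the end box of the row plus free coefficients off
  \<open>young d\<close>. The other vectors of the row arise from it by applying the operator, which
  makes the span invariant.\<close>

definition wtop :: "(nat \<times> nat \<times> nat \<Rightarrow> 'k) \<Rightarrow> nat \<Rightarrow> nat \<times> nat \<Rightarrow> 'k" where
  "wtop x b = (\<lambda>p. if fst p = b then (if Suc (snd p) = \<nu> b then 1 else 0)
     else if (b,p) \<in> pars then x (b,p) else 0)"

fun wk :: "(nat \<times> nat \<times> nat \<Rightarrow> 'k) \<Rightarrow> nat \<Rightarrow> nat \<Rightarrow> nat \<times> nat \<Rightarrow> 'k" where
  "wk x b 0 = wtop x b"
| "wk x b (Suc k) = jshift c (\<nu> b - Suc k) (wk x b k)"

text \<open>Indexing by boxes: after \<open>\<nu> b - Suc h\<close> steps the leading box has moved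
  from the end of row \<open>b\<close> to \<open>(b,h)\<close>.\<close>

definition w :: "(nat \<times> nat \<times> nat \<Rightarrow> 'k) \<Rightarrow> nat \<times> nat \<Rightarrow> nat \<times> nat \<Rightarrow> 'k" where
  "w x q = wk x (fst q) (\<nu> (fst q) - Suc (snd q))"

text \<open>The step from \<open>k\<close> to \<open>Suc k\<close> clears layer
  \<open>\<nu> b - Suc k\<close>: there the diagonal coefficient of \<open>jshift\<close> is 0, and
  the layer above is 0 already.\<close>

lemma wk_high:
  assumes "h \<ge> \<nu> b - k" shows "wk x b k (b',h) = 0"
  using assms
proof (induction k arbitrary: h)
  case 0
  then have "\<not> b < d h" using less_d_iff by simp
  then show ?case using 0 by (auto simp: wtop_def pars_def)
next
  case (Suc k)
  show ?case
  proof (cases "h = \<nu> b - Suc k")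
    case True
    have "wk x b k (b', Suc h) = 0" using Suc.IH[of "Suc h"] True by simp
    then show ?thesis by (simp add: jshift_def True)
  next
    case False
    then have "h \<ge> \<nu> b - k" using Suc.prems by simp
    then show ?thesis using Suc.IH[of h] Suc.IH[of "Suc h"] by (simp add: jshift_def)
  qed
qed

lemma wk_own:
  assumes "k < \<nu> b" shows "wk x b k (b,h) = (if h = \<nu> b - Suc k then 1 else 0)"
  using assms
proof (induction k arbitrary: h)
  case 0
  then show ?case by (auto simp: wtop_def)
next
  case (Suc k)
  then show ?case by (auto simp: jshift_def)
qed

lemma wk_row_zero: "b' < b \<Longrightarrow> wk x b k (b',h) = 0"
proof (induction k arbitrary: h)
  case 0
  have "(b,b',h) \<notin> pars"
  proof
    assume "(b,b',h) \<in> pars"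
    then have "b < d h" "d h \<le> b'" by (auto simp: pars_def)
    then show False using 0 by simp
  qed
  then show ?case using 0 by (simp add: wtop_def)
next
  case (Suc k) then show ?case by (simp add: jshift_def)
qed

lemma wk_supp:
  assumes "0 < \<nu> b" shows "wk x b k \<in> supp_in (young m)"
proof (induction k)
  case 0
  have "b < m h" if "Suc h = \<nu> b" for h using that less_d_iff[of b h] d_le[of h] by simp
  then show ?case by (auto simp: supp_in_def young_def wtop_def pars_def)
next
  case (Suc k) then show ?case using jshift_supp[OF m_anti] by simp
qed

lemma young_d_iff: "(b,h) \<in> young d \<longleftrightarrow> h < \<nu> b"
  using less_d_iff by (simp add: young_def)

lemma w_supp: "q \<in> young d \<Longrightarrow> w x q \<in> supp_in (young m)"
  using wk_supp by (cases q) (auto simp: w_def young_d_iff)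

lemma w_self: "q \<in> young d \<Longrightarrow> w x q q = 1"
  using wk_own by (cases q) (auto simp: w_def young_d_iff)

lemma w_triangular:
  assumes "(b,h) \<in> young d" "w x (b,h) (b',h') \<noteq> 0"
  shows "h' < h \<or> (h' = h \<and> b \<le> b')"
proof -
  have h: "h < \<nu> b" using assms by (simp add: young_d_iff)
  have "\<not> h' \<ge> \<nu> b - (\<nu> b - Suc h)" using assms(2) wk_high by (auto simp: w_def)
  then have "h' \<le> h" using h by simp
  moreover have "b \<le> b'" using assms(2) wk_row_zero[of b' b] by (auto simp: w_def not_less[symmetric])
  ultimately show ?thesis by auto
qed

lemma w_top_other:
  assumes "Suc h = \<nu> b" "p \<in> young d" "p \<noteq> (b,h)" shows "w x (b,h) p = 0"
proof -
  obtain b' h' where p: "p = (b',h')" by fastforce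
  have "(b,p) \<notin> pars" using assms(2) by (auto simp: p pars_def young_def)
  moreover have "w x (b,h) = wtop x b" using assms(1) by (simp add: w_def)
  ultimately show ?thesis using assms p by (auto simp: wtop_def)
qed

lemma w_top_par: "Suc h = \<nu> b \<Longrightarrow> (b,p) \<in> pars \<Longrightarrow> w x (b,h) p = x (b,p)"
  by (auto simp: w_def wtop_def pars_def)

lemma w_invariant:
  assumes "(b,h) \<in> young d"
  shows "jop c (w x (b,h)) p = c h * w x (b,h) p + (if h = 0 then 0 else w x (b,h - 1) p)"
proof -
  have h: "h < \<nu> b" using assms by (simp add: young_d_iff)
  have "jshift c h (w x (b,h)) p = (if h = 0 then 0 else w x (b,h - 1) p)"
  proof (cases h)
    case 0
    obtain b' h' where p: "p = (b',h')" by fastforce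
    have hi: "w x (b,h) (b'',h'') = 0" if "h'' > 0" for b'' h''
      using wk_high[of b "\<nu> b - Suc h" h'' x b''] that h 0 by (simp add: w_def)
    show ?thesis using hi 0 by (cases h') (auto simp: p jshift_def)
  next
    case (Suc h0)
    have "w x (b,h0) = wk x b (Suc (\<nu> b - Suc h))" using h Suc by (simp add: w_def Suc_diff_Suc)
    moreover have "\<nu> b - Suc (\<nu> b - Suc h) = h" using h by simp
    ultimately show ?thesis using Suc by (simp add: w_def)
  qed
  then show ?thesis using jop_jshift[of c "w x (b,h)" p h] by simp
qed

text \<open>The vectors are unitriangular for the order by decreasing layer, then increasing row.
  Equations at the boxes of \<open>Q\<close> may be missing: the vectors of row ends vanish at all
  other boxes of \<open>young d\<close>, so they do not disturb the triangular system.\<close>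

lemma w_independent:
  assumes tops: "\<And>b h. (b,h) \<in> Q \<Longrightarrow> Suc h = \<nu> b"
    and zero: "\<And>p. p \<in> young d - Q \<Longrightarrow> (\<Sum>q\<in>young d. v q * w x q p) = 0"
    and q: "q \<in> young d - Q"
  shows "v q = 0"
proof (rule ccontr)
  assume nz: "v q \<noteq> 0"
  define S where "S = {q \<in> young d - Q. v q \<noteq> 0}"
  \<comment> \<open>Encodes the lexicographic order: larger layer first, then smaller row, using
    \<open>b < m 0\<close>.\<close>
  define key where "key = (\<lambda>(b,h). h * Suc (m 0) + (m 0 - b))"
  have "finite S" unfolding S_def using finite_young_d by simp
  moreover have "q \<in> S" unfolding S_def using nz q by blast
  ultimately have fin: "finite (key ` S)" "key ` S \<noteq> {}" by auto
  from Max_in[OF this] obtain p where p: "p \<in> S" "key p = Max (key ` S)" by (metis imageE)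
  have pmax: "key q \<le> key p" if "q \<in> S" for q unfolding p(2) using fin that by (intro Max_ge) auto
  obtain bp hp where pp: "p = (bp,hp)" by fastforce
  have pd: "p \<in> young d - Q" "v p \<noteq> 0" using p(1) unfolding S_def by auto
  have bound: "b < m 0" if "(b,h) \<in> young d" for b h
    using that young_d_subset m_anti antimonoD[of m 0 h] by (auto simp: young_def)
  have "v q * w x q p = 0" if q: "q \<in> young d" "q \<noteq> p" for q
  proof (rule ccontr)
    assume "v q * w x q p \<noteq> 0"
    then have nz: "v q \<noteq> 0" "w x q p \<noteq> 0" by auto
    obtain b h where qq: "q = (b,h)" by fastforce
    have "q \<notin> Q" using w_top_other[of h b p x] tops[of b h] nz(2) pd(1) q(2) qq by auto
    then have "q \<in> S" using q nz unfolding S_def by simp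
    then have le: "h * Suc (m 0) + (m 0 - b) \<le> hp * Suc (m 0) + (m 0 - bp)" using pmax[of q] qq pp unfolding key_def by simp
    have "hp < h \<or> (hp = h \<and> b \<le> bp)" using w_triangular[of b h x bp hp] nz(2) q qq pp by simp
    moreover have b: "bp < m 0" "b < m 0" using bound pd(1) q pp qq by auto
    moreover have "\<not> hp < h"
    proof
      assume "hp < h"
      then have "hp * Suc (m 0) + Suc (m 0) \<le> h * Suc (m 0)"
        using mult_le_mono1[of "Suc hp" h "Suc (m 0)"] by simp
      then show False using le by linarith
    qed
    ultimately have eq: "hp = h" "b \<le> bp" by auto
    then have "m 0 - b \<le> m 0 - bp" using le by simp
    then have "b = bp" using eq b by simp
    then show False using q(2) pp qq eq by simp
  qed
  then have "(\<Sum>q\<in>young d - {p}. v q * w x q p) = 0" by (intro sum.neutral) blast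
  then have "(\<Sum>q\<in>young d. v q * w x q p) = v p * w x p p"
    using sum.remove[OF finite_young_d, of p "\<lambda>q. v q * w x q p"] pd(1) by simp
  then show False using zero[OF pd(1)] w_self[of p x] pd by simp
qed

lemma w_parpoly:
  assumes "\<And>r. r \<in> pars \<Longrightarrow> (\<lambda>u. x u r) \<in> parpoly e"
  shows "(\<lambda>u. w (x u) q p) \<in> parpoly e"
proof -
  have "(\<lambda>u. wk (x u) b k p) \<in> parpoly e" for b k p
  proof (induction k arbitrary: p)
    case 0
    show ?case
      by (cases "fst p = b"; cases "Suc (snd p) = \<nu> b"; cases "(b,p) \<in> pars")
        (simp_all add: wtop_def parpoly.const assms)
  next
    case (Suc k)
    obtain b' h where p: "p = (b',h)" by fastforce
    show ?case using Suc by (auto simp: p jshift_def intro!: parpoly.add parpoly.mult parpoly.const)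
  qed
  then show ?thesis unfolding w_def .
qed

end

section \<open>The operator as a matrix, and the lower bound for its invariant subspaces\<close>

definition jent :: "(nat \<Rightarrow> 'k::field) \<Rightarrow> nat \<times> nat \<Rightarrow> nat \<times> nat \<Rightarrow> 'k" where
  "jent c p q = (if p = q then c (snd p) else if fst p = fst q \<and> Suc (snd p) = snd q then 1 else 0)"

definition jmat :: "(nat \<Rightarrow> 'k::field) \<Rightarrow> (nat \<times> nat) list \<Rightarrow> 'k mat" where
  "jmat c ps = mat (length ps) (length ps) (\<lambda>(i,j). jent c (ps ! i) (ps ! j))"

lemma jmat_carrier [simp]: "jmat c ps \<in> carrier_mat (length ps) (length ps)"
  by (simp add: jmat_def)

lemma sum_nth_distinct:
  assumes "distinct ps" shows "(\<Sum>j<length ps. g (ps ! j)) = sum g (set ps)"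
  using sum.reindex_bij_betw[OF bij_betw_nth[OF assms refl refl], of g] by simp

lemma jent_sum_right:
  assumes fin: "finite D" and p: "(b,h) \<in> D" and f: "(b,Suc h) \<notin> D \<Longrightarrow> f (b,Suc h) = 0"
  shows "(\<Sum>q\<in>D. jent c (b,h) q * f q) = c h * f (b,h) + f (b,Suc h)"
proof -
  have "(\<Sum>q\<in>D. jent c (b,h) q * f q) = (\<Sum>q\<in>D. (if q = (b,h) then c h * f q else 0) + (if q = (b,Suc h) then f q else 0))"
    by (intro sum.cong) (auto simp: jent_def)
  also have "\<dots> = c h * f (b,h) + f (b,Suc h)"
    using fin p f by (simp add: sum.distrib)
  finally show ?thesis .
qed

lemma jent_sum_left:
  assumes fin: "finite D" and p: "(b,h) \<in> D" and f: "h > 0 \<Longrightarrow> (b,h - 1) \<in> D"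
  shows "(\<Sum>q\<in>D. f q * jent c q (b,h)) = c h * f (b,h) + (if h = 0 then 0 else f (b,h - 1))"
proof -
  have "(\<Sum>q\<in>D. f q * jent c q (b,h)) = (\<Sum>q\<in>D. (if q = (b,h) then c h * f q else 0) + (if q = (b,h - 1) then (if h = 0 then 0 else f q) else 0))"
    by (intro sum.cong) (auto simp: jent_def)
  also have "\<dots> = c h * f (b,h) + (if h = 0 then 0 else f (b,h - 1))"
    using fin p f by (simp add: sum.distrib)
  finally show ?thesis .
qed

lemma jmat_mult_vec:
  assumes "distinct ps" "set ps = young m" "f \<in> supp_in (young m)"
  shows "jmat c ps *\<^sub>v vec (length ps) (\<lambda>i. f (ps ! i)) = vec (length ps) (\<lambda>i. jop c f (ps ! i))"
proof (rule eq_vecI)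
  fix i assume "i < dim_vec (vec (length ps) (\<lambda>i. jop c f (ps ! i)))"
  then have i: "i < length ps" by simp
  obtain b h where p: "ps ! i = (b,h)" by fastforce
  have "(b,h) \<in> young m" using i p assms(2) nth_mem by metis
  moreover have "finite (young m)" using assms(2) by (metis List.finite_set)
  moreover have "f (b,Suc h) = 0" if "(b,Suc h) \<notin> young m" using assms(3) that by (auto simp: supp_in_def)
  ultimately have "(\<Sum>q\<in>set ps. jent c (b,h) q * f q) = c h * f (b,h) + f (b,Suc h)"
    unfolding assms(2) by (intro jent_sum_right)
  then show "(jmat c ps *\<^sub>v vec (length ps) (\<lambda>i. f (ps ! i))) $ i = vec (length ps) (\<lambda>i. jop c f (ps ! i)) $ i"
    using i p sum_nth_distinct[OF assms(1), of "\<lambda>q. jent c (b,h) q * f q"]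
    by (simp add: jmat_def scalar_prod_def lessThan_atLeast0 jop_def)
qed (simp add: jmat_def)

lemma card_young:
  assumes "\<And>h. h \<ge> K \<Longrightarrow> d h = 0" shows "card (young d) = (\<Sum>h<K. d h)" "finite (young d)"
proof -
  have h: "h < K" if "b < d h" for b h using assms[of h] that by (cases "h < K") auto
  have eq: "young d = (\<lambda>(h,b). (b,h)) ` (SIGMA h:{..<K}. {..<d h})"
    unfolding young_def using h by (auto simp: image_iff)
  have inj: "inj_on (\<lambda>(h,b). (b,h)) (SIGMA h:{..<K}. {..<d h})" by (auto simp: inj_on_def)
  show "finite (young d)" unfolding eq by auto
  show "card (young d) = (\<Sum>h<K. d h)" unfolding eq card_image[OF inj] by (subst card_SigmaI) auto
qed

lemma similar_matE:
  assumes sim: "similar_mat A B" and B: "B \<in> carrier_mat n n"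
  obtains P Q where "A \<in> carrier_mat n n" "P \<in> carrier_mat n n" "Q \<in> carrier_mat n n"
    "P * Q = 1\<^sub>m n" "Q * P = 1\<^sub>m n" "A = P * B * Q"
proof -
  from sim obtain P Q where wit: "similar_mat_wit A B P Q" unfolding similar_mat_def by blast
  have "B \<in> carrier_mat (dim_row A) (dim_row A)" using similar_mat_witD[OF refl wit] by blast
  then have "n = dim_row A" using B carrier_matD(1) by metis
  from similar_mat_witD[OF this wit] show ?thesis using that by blast
qed

text \<open>The matrix \<open>L0 i * Q\<close> reads the coordinates at the boxes of
  \<open>young dd\<close>, with the end of the row of parameter \<open>i\<close> replaced by the box
  of that parameter. In the column of this row end only the replaced coordinate can be nonzero, and
  it is the parameter itself.\<close>

theorem fixed_grass_dim_lower:
  fixes A :: "'k::field mat"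
  assumes inf: "infinite (UNIV :: 'k set)" and sim: "similar_mat A (jmat c ps)"
    and ps: "distinct ps" "set ps = young m" "length ps = n"
    and m: "antimono m" "\<And>h. h \<ge> K \<Longrightarrow> m h = 0"
    and dd: "antimono dd" "\<And>h. dd h \<le> m h" "(\<Sum>h<K. dd h) = d"
  shows "enat (\<Sum>h<K. dd h * (m h - dd h)) \<le> krull_dim (grass_closed n d) (fixed_grass n d A)"
proof -
  interpret generic_subspace m dd c K using m dd by unfold_locales auto
  define e where "e = (\<Sum>h<K. dd h * (m h - dd h))"
  have dd0: "dd h = 0" if "h \<ge> K" for h using dd(2)[of h] m(2)[OF that] by simp
  define J where "J = jmat c ps"
  have J: "J \<in> carrier_mat n n" unfolding J_def using ps(3) jmat_carrier[of c ps] by simp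
  from similar_matE[OF sim[folded J_def] J] obtain P Q where
    A: "A \<in> carrier_mat n n" "P \<in> carrier_mat n n" "Q \<in> carrier_mat n n" "P * Q = 1\<^sub>m n" "Q * P = 1\<^sub>m n" "A = P * J * Q" .
  obtain pv where pv: "set pv = young dd" "distinct pv" using finite_distinct_list[OF finite_young_d] by blast
  have lpv: "length pv = d" using distinct_card[OF pv(2)] pv(1) card_young(1)[of K dd] dd0 dd(3) by simp
  obtain pl where pl: "set pl = pars" "distinct pl" using finite_distinct_list[OF card_pars(1)] by blast
  have lpl: "length pl = e" using distinct_card[OF pl(2)] pl(1) card_pars(2) e_def by simp
  define ix where "ix = the_inv_into {..<e} (nth pl)"
  have ix: "ix (pl ! i) = i" if "i < e" for i
    unfolding ix_def using bij_betw_nth[OF pl(2) refl refl] lpl that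
    by (intro the_inv_into_f_f) (auto simp: bij_betw_def)
  have ixl: "ix r < e" if "r \<in> pars" for r
    using that pl(1) ix lpl by (metis in_set_conv_nth)
  define x where "x u r = u (ix r)" for u :: "nat \<Rightarrow> 'k" and r
  have xpol: "(\<lambda>u. x u r) \<in> parpoly e" if "r \<in> pars" for r
    unfolding x_def using ixl[OF that] by (rule parpoly.coord)
  define iv where "iv = the_inv_into {..<d} (nth pv)"
  have iv: "iv (pv ! i) = i" if "i < d" for i
    unfolding iv_def using bij_betw_nth[OF pv(2) refl refl] lpv that
    by (intro the_inv_into_f_f) (auto simp: bij_betw_def)
  have pvsum: "(\<Sum>k<d. w y (pv ! k) p * v $ k) = (\<Sum>q\<in>young dd. v $ iv q * w y q p)" for y v p
  proof -
    have "(\<Sum>k<d. w y (pv ! k) p * v $ k) = (\<Sum>k<length pv. v $ iv (pv ! k) * w y (pv ! k) p)"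
      unfolding lpv by (intro sum.cong refl) (simp add: iv)
    then show ?thesis using sum_nth_distinct[OF pv(2), of "\<lambda>q. v $ iv q * w y q p"] pv(1) by simp
  qed
  define M0 where "M0 u = mat n d (\<lambda>(i,j). w (x u) (pv ! j) (ps ! i))" for u
  define \<Phi> where "\<Phi> u = P * M0 u" for u
  have M0: "M0 u \<in> carrier_mat n d" for u unfolding M0_def by simp
  have \<Phi>c: "\<Phi> u \<in> carrier_mat n d" for u unfolding \<Phi>_def using A M0[of u] by simp
  have Q\<Phi>: "Q * \<Phi> u = M0 u" for u
    unfolding \<Phi>_def using assoc_mult_mat[OF A(3,2) M0[of u]] A(5) M0[of u] by simp
  have vz: "v = 0\<^sub>v d" if v: "v \<in> carrier_vec d" and z: "\<And>q. q \<in> young dd \<Longrightarrow> v $ iv q = 0" for v :: "'k vec"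
  proof (rule eq_vecI)
    fix i assume "i < dim_vec (0\<^sub>v d)"
    then have i: "i < d" by simp
    then have "pv ! i \<in> young dd" using pv(1) lpv nth_mem by metis
    then show "v $ i = 0\<^sub>v d $ i" using z[of "pv ! i"] iv[OF i] i by simp
  qed (use v in simp)
  have st: "\<Phi> u \<in> stiefel n d" for u
  proof -
    have "inj_mat (\<Phi> u)"
    proof (rule inj_matI[OF \<Phi>c])
      fix v assume v: "v \<in> carrier_vec d" "\<Phi> u *\<^sub>v v = 0\<^sub>v n"
      have "M0 u *\<^sub>v v = Q *\<^sub>v (\<Phi> u *\<^sub>v v)" unfolding Q\<Phi>[symmetric] by (rule assoc_mult_mat_vec[OF A(3) \<Phi>c v(1)])
      also have "\<dots> = 0\<^sub>v n" unfolding v(2) using A(3) by auto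
      finally have M0v: "M0 u *\<^sub>v v = 0\<^sub>v n" .
      have "(\<Sum>q\<in>young dd. v $ iv q * w (x u) q p) = 0" if p: "p \<in> young dd - {}" for p
      proof -
        have "p \<in> set ps" using p young_d_subset ps(2) by blast
        then obtain i where i: "i < n" "p = ps ! i" using ps(3) by (metis in_set_conv_nth)
        have "(M0 u *\<^sub>v v) $ i = (\<Sum>k<d. w (x u) (pv ! k) p * v $ k)"
          using i v(1) by (simp add: M0_def scalar_prod_def lessThan_atLeast0)
        then show ?thesis using M0v i(1) pvsum by simp
      qed
      then have "v $ iv q = 0" if "q \<in> young dd" for q
        using w_independent[of "{}" "\<lambda>q. v $ iv q" "x u" q] that by blast
      then show "v = 0\<^sub>v d" using vz v(1) by blast
    qed
    then show ?thesis using \<Phi>c by (simp add: stiefel_eq)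
  qed
  \<comment> \<open>The operator restricted to the subspace has the matrix \<open>jmat c pv\<close>
    of the subdiagram.\<close>
  have JM0: "J * M0 u = M0 u * jmat c pv" for u
  proof (rule eq_matI)
    have C: "jmat c pv \<in> carrier_mat d d" using jmat_carrier[of c pv] lpv by simp
    fix i j assume "i < dim_row (M0 u * jmat c pv)" "j < dim_col (M0 u * jmat c pv)"
    then have ij: "i < n" "j < d" using M0[of u] C by auto
    obtain b h where q: "pv ! j = (b,h)" by fastforce
    have qd: "(b,h) \<in> young dd" using q ij pv(1) lpv nth_mem by metis
    have "col (M0 u) j = vec n (\<lambda>i. w (x u) (b,h) (ps ! i))" using ij q by (auto simp: M0_def)
    then have "(J * M0 u) $$ (i,j) = (J *\<^sub>v vec (length ps) (\<lambda>i. w (x u) (b,h) (ps ! i))) $ i"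
      using ij J M0[of u] ps(3) by simp
    also have "\<dots> = jop c (w (x u) (b,h)) (ps ! i)"
      unfolding J_def jmat_mult_vec[OF ps(1,2) w_supp[OF qd]] using ij ps(3) by simp
    also have "\<dots> = c h * w (x u) (b,h) (ps ! i) + (if h = 0 then 0 else w (x u) (b,h - 1) (ps ! i))"
      by (rule w_invariant[OF qd])
    also have "\<dots> = (\<Sum>q\<in>young dd. w (x u) q (ps ! i) * jent c q (b,h))"
    proof (rule jent_sum_left[symmetric, OF finite_young_d qd])
      show "(b,h - 1) \<in> young dd" using qd antimonoD[OF dd(1), of "h - 1" h] by (auto simp: young_def)
    qed
    also have "\<dots> = (M0 u * jmat c pv) $$ (i,j)"
      using ij q lpv pv(1) sum_nth_distinct[OF pv(2), of "\<lambda>q. w (x u) q (ps ! i) * jent c q (b,h)"]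
      by (simp add: M0_def jmat_def scalar_prod_def lessThan_atLeast0)
    finally show "(J * M0 u) $$ (i,j) = (M0 u * jmat c pv) $$ (i,j)" .
  qed (use J M0[of u] lpv in \<open>auto simp: jmat_def\<close>)
  have X: "mat_range (\<Phi> u) \<in> fixed_grass n d A" for u
  proof -
    have C: "jmat c pv \<in> carrier_mat d d" using jmat_carrier[of c pv] lpv by simp
    have "A * \<Phi> u = (P * J) * (Q * \<Phi> u)" unfolding A(6) using A J \<Phi>c[of u] by (intro assoc_mult_mat) auto
    also have "\<dots> = P * (J * M0 u)" unfolding Q\<Phi> by (rule assoc_mult_mat[OF A(2) J M0])
    also have "\<dots> = \<Phi> u * jmat c pv" unfolding JM0 \<Phi>_def by (rule assoc_mult_mat[symmetric, OF A(2) M0 C])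
    finally have A\<Phi>: "A * \<Phi> u = \<Phi> u * jmat c pv" .
    have "A *\<^sub>v y \<in> mat_range (\<Phi> u)" if y: "y \<in> mat_range (\<Phi> u)" for y
    proof -
      obtain v where v: "v \<in> carrier_vec d" "y = \<Phi> u *\<^sub>v v" using y \<Phi>c[of u] unfolding mat_range_def by auto
      have "A *\<^sub>v y = (A * \<Phi> u) *\<^sub>v v" unfolding v(2) by (rule assoc_mult_mat_vec[symmetric, OF A(1) \<Phi>c v(1)])
      also have "\<dots> = \<Phi> u *\<^sub>v (jmat c pv *\<^sub>v v)" unfolding A\<Phi> by (rule assoc_mult_mat_vec[OF \<Phi>c C v(1)])
      finally show ?thesis unfolding mat_range_def using C v(1) \<Phi>c[of u] by auto
    qed
    then show ?thesis unfolding fixed_grass_def Grass_eq using st by auto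
  qed
  have pol: "(\<lambda>u. \<Phi> u $$ (i,j)) \<in> parpoly e" if ij: "i < n" "j < d" for i j
  proof -
    have "(\<lambda>u. \<Phi> u $$ (i,j)) = (\<lambda>u. \<Sum>k<n. P $$ (i,k) * w (x u) (pv ! j) (ps ! k))"
      using ij A(2) by (auto simp: \<Phi>_def M0_def scalar_prod_def lessThan_atLeast0)
    also have "\<dots> \<in> parpoly e"
      by (intro parpoly_sum parpoly.mult parpoly.const w_parpoly xpol)
    finally show ?thesis .
  qed
  define top where "top b = (b, \<nu> b - 1)" for b
  define rs where "rs i j = (let r = pl ! i in if pv ! j = top (fst r) then snd r else pv ! j)" for i j
  define L0 where "L0 i = mat d n (\<lambda>(j,k). if ps ! k = rs i j then 1 else (0::'k))" for i
  have L0: "L0 i \<in> carrier_mat d n" for i unfolding L0_def by simp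
  have parD: "top b \<in> young dd" "Suc (\<nu> b - 1) = \<nu> b" "p \<in> young m" "p \<notin> young dd" if "(b,p) \<in> pars" for b p
  proof -
    obtain b' h' where p: "p = (b',h')" by fastforce
    have "b < dd h'" using that p by (simp add: pars_def)
    then have "\<nu> b > 0" using less_d_iff by (metis gr_implies_not0 neq0_conv)
    then show "top b \<in> young dd" "Suc (\<nu> b - 1) = \<nu> b" by (auto simp: top_def young_d_iff)
    show "p \<in> young m" "p \<notin> young dd" using that p by (auto simp: pars_def young_def)
  qed
  have LM: "L0 i * Q * \<Phi> u = mat d d (\<lambda>(j,k). w (x u) (pv ! k) (rs i j))" if i: "i < e" for i u
  proof -
    have "L0 i * Q * \<Phi> u = L0 i * M0 u" using assoc_mult_mat[OF L0 A(3) \<Phi>c] Q\<Phi> by simp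
    also have "\<dots> = mat d d (\<lambda>(j,k). w (x u) (pv ! k) (rs i j))"
    proof (rule eq_matI)
      fix j k assume "j < dim_row (mat d d (\<lambda>(j,k). w (x u) (pv ! k) (rs i j)))" "k < dim_col (mat d d (\<lambda>(j,k). w (x u) (pv ! k) (rs i j)))"
      then have jk: "j < d" "k < d" by auto
      have "pl ! i \<in> pars" using i pl(1) lpl nth_mem by metis
      then have "snd (pl ! i) \<in> young m" using parD(3) by (metis prod.collapse)
      moreover have "pv ! j \<in> young m" using jk pv(1) lpv nth_mem young_d_subset by (metis subsetD)
      ultimately have "rs i j \<in> set ps" unfolding rs_def Let_def ps(2) by simp
      then have "(\<Sum>q\<in>set ps. (if q = rs i j then 1 else 0) * w (x u) (pv ! k) q) = w (x u) (pv ! k) (rs i j)"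
        by (subst sum.cong[OF refl, of _ _ "\<lambda>q. if q = rs i j then w (x u) (pv ! k) q else 0"]) auto
      then show "(L0 i * M0 u) $$ (j,k) = mat d d (\<lambda>(j,k). w (x u) (pv ! k) (rs i j)) $$ (j,k)"
        using jk ps(3) sum_nth_distinct[OF ps(1), of "\<lambda>q. (if q = rs i j then 1 else 0) * w (x u) (pv ! k) q"]
        by (simp add: L0_def M0_def scalar_prod_def lessThan_atLeast0)
    qed (simp_all add: L0_def M0_def)
    finally show ?thesis .
  qed
  have Linj: "inj_mat (L0 i * Q * \<Phi> u) \<longleftrightarrow> u i \<noteq> 0" if i: "i < e" for i u
  proof -
    define b p where "b = fst (pl ! i)" and "p = snd (pl ! i)"
    have bp: "pl ! i = (b,p)" unfolding b_def p_def by simp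
    have par: "(b,p) \<in> pars" using i pl(1) lpl nth_mem bp by metis
    note pD = parD[OF par]
    have xu: "x u (b,p) = u i" unfolding x_def bp[symmetric] ix[OF i] ..
    let ?N = "mat d d (\<lambda>(j,k). w (x u) (pv ! k) (rs i j))"
    have N: "?N \<in> carrier_mat d d" by simp
    have Nv: "(?N *\<^sub>v v) $ j = (\<Sum>q\<in>young dd. v $ iv q * w (x u) q (rs i j))" if "j < d" "v \<in> carrier_vec d" for v j
      using that pvsum[of "x u" "rs i j" v] by (simp add: scalar_prod_def lessThan_atLeast0)
    have tdd: "top b \<in> set pv" using pD(1) pv(1) by simp
    then obtain t where t: "t < d" "pv ! t = top b" using lpv by (metis in_set_conv_nth)
    have wtop: "w (x u) (top b) q = 0" if "q \<in> young dd" "q \<noteq> top b" for q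
      using w_top_other[OF pD(2) that(1), of "x u"] that(2) unfolding top_def by blast
    have wpar: "w (x u) (top b) p = u i" using w_top_par[OF pD(2) par, of "x u"] xu unfolding top_def by simp
    have rst: "rs i j = (if pv ! j = top b then p else pv ! j)" for j unfolding rs_def Let_def bp by simp
    show ?thesis unfolding LM[OF i]
    proof
      assume inj: "inj_mat ?N"
      show "u i \<noteq> 0"
      proof
        assume u0: "u i = 0"
        have "?N *\<^sub>v unit_vec d t = 0\<^sub>v d"
          unfolding mat_unit_vec_col[OF N t(1)]
        proof (rule eq_vecI)
          fix j assume "j < dim_vec (0\<^sub>v d)"
          then have j: "j < d" by simp
          have "pv ! j \<in> young dd" using j lpv pv(1) nth_mem by metis
          then have "w (x u) (top b) (rs i j) = 0" using wtop wpar u0 rst by auto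
          then show "col ?N t $ j = 0\<^sub>v d $ j" using j t by simp
        qed simp
        then have "unit_vec d t = (0\<^sub>v d :: 'k vec)" using inj_matD[OF inj N unit_vec_carrier] by simp
        then have "unit_vec d t $ t = (0\<^sub>v d $ t :: 'k)" by simp
        then show False using t by simp
      qed
    next
      assume u0: "u i \<noteq> 0"
      show "inj_mat ?N"
      proof (rule inj_matI[OF N])
        fix v assume v: "v \<in> carrier_vec d" "?N *\<^sub>v v = 0\<^sub>v d"
        have row: "(\<Sum>q\<in>young dd. v $ iv q * w (x u) q (rs i j)) = 0" if "j < d" for j
          using Nv[OF that v(1)] v(2) that by simp
        have "(\<Sum>q\<in>young dd. v $ iv q * w (x u) q q') = 0" if q': "q' \<in> young dd - {top b}" for q'
        proof -
          obtain j where j: "j < d" "pv ! j = q'" using q' pv(1) lpv by (metis DiffD1 in_set_conv_nth)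
          then show ?thesis using row[OF j(1)] q' rst by simp
        qed
        \<comment> \<open>With the equation at \<open>top b\<close> missing, all other coefficients
          still vanish; the replaced row then reduces to the coefficient of \<open>top b\<close>
          times \<open>u i\<close>.\<close>
        then have vq: "v $ iv q = 0" if "q \<in> young dd - {top b}" for q
          using w_independent[of "{top b}" "\<lambda>q. v $ iv q" "x u" q] that pD(2) unfolding top_def by auto
        have "(\<Sum>q\<in>young dd. v $ iv q * w (x u) q p) = 0" using row[OF t(1)] rst t by simp
        moreover have "(\<Sum>q\<in>young dd - {top b}. v $ iv q * w (x u) q p) = 0" using vq by (intro sum.neutral) auto
        ultimately have "v $ iv (top b) * w (x u) (top b) p = 0"
          using sum.remove[OF finite_young_d pD(1), of "\<lambda>q. v $ iv q * w (x u) q p"] by simp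
        then have "v $ iv (top b) = 0" using wpar u0 by simp
        then show "v = 0\<^sub>v d" using vz[OF v(1)] vq by blast
      qed
    qed
  qed
  have "enat e \<le> krull_dim (grass_closed n d) (fixed_grass n d A)"
    by (rule krull_dim_lower_bound[OF inf st X pol, of "\<lambda>i. L0 i * Q"]) (use mult_carrier_mat[OF L0 A(3)] Linj in auto)
  then show ?thesis unfolding e_def .
qed

section \<open>Covering the invariant subspaces by polynomial families\<close>

lemma parpoly_cong:
  assumes "f \<in> parpoly e" "\<And>i. i < e \<Longrightarrow> u i = v i" shows "f u = f v"
  using assms by (induction rule: parpoly.induct) auto

section \<open>Echelon forms with respect to a fixed spanning family\<close>

context vector_space
begin

lemma span_Int_independent:
  assumes ind: "independent (B \<union> R)" and disj: "B \<inter> R = {}" and v: "v \<in> span B" "v \<in> span R"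
  shows "v = 0"
proof -
  have "representation (B \<union> R) v = representation B v" by (rule representation_extend[OF ind v(1)]) simp
  moreover have "representation (B \<union> R) v = representation R v" by (rule representation_extend[OF ind v(2)]) simp
  ultimately have "representation B v b = 0" for b
    using representation_ne_zero[of B v b] representation_ne_zero[of R v b] disj by (metis disjoint_iff)
  moreover have "independent B" using ind independent_mono by blast
  ultimately show ?thesis using sum_nonzero_representation_eq[of B v] v(1) by simp
qed

lemma spanning_family_basis:
  assumes "dim (span (X ` {..<x})) = (x::nat)"
  shows "independent (X ` {..<x}) \<and> card (X ` {..<x}) = x"
proof -
  obtain B where B: "B \<subseteq> X ` {..<x}" "independent B" "X ` {..<x} \<subseteq> span B"
    using maximal_independent_subset by blast
  have "span B = span (X ` {..<x})" using B(1,3) by (metis span_mono span_span subset_antisym span_minimal subspace_span)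
  then have "card B = x" using dim_eq_card[of B "span (X ` {..<x})"] B(2) assms by (simp add: span_span)
  moreover have "card (X ` {..<x}) \<le> x" using card_image_le[of "{..<x}" X] by simp
  ultimately have "B = X ` {..<x}" using B(1) by (metis card_seteq finite_imageI finite_lessThan)
  then show ?thesis using B(2) \<open>card B = x\<close> by simp
qed

text \<open>Members of \<open>Y\<close> span a complement of \<open>W\<close> in the span of
  \<open>Y\<close> (the set \<open>R\<close>, at most \<open>k - \<delta>\<close> vectors), and
  further members complete \<open>X\<close> and \<open>R\<close> to a basis (the set
  \<open>Pi\<close>, exactly \<open>\<delta>\<close> vectors). Projecting \<open>Pi\<close> to
  \<open>W\<close> along \<open>R\<close> yields the generators. The indices \<open>\<pi>\<close>
  and \<open>\<rho>\<close> take finitely many values, so the freedom lies in the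
  \<open>\<delta> * (k - \<delta>)\<close> entries of \<open>t\<close>.\<close>

lemma echelon_form:
  fixes x k \<delta> :: nat
  assumes W: "subspace W" and X: "X ` {..<x} \<subseteq> W" and indX: "independent (X ` {..<x})" "card (X ` {..<x}) = x"
    and Y: "W \<subseteq> span (Y ` {..<x + k})" and dimW: "dim W = x + \<delta>"
  shows "\<delta> \<le> k \<and> (\<exists>\<pi> \<rho> t. (\<forall>p<\<delta>. \<pi> p < x + k) \<and> (\<forall>q<k - \<delta>. \<rho> q < x + k) \<and>
    W = span (X ` {..<x} \<union> (\<lambda>p. Y (\<pi> p) - (\<Sum>q<k - \<delta>. scale (t p q) (Y (\<rho> q)))) ` {..<\<delta>}))"
proof -
  let ?X = "X ` {..<x}" and ?Y = "Y ` {..<x + k}"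
  have finY: "finite ?Y" by simp
  have cY: "card ?Y \<le> x + k" using card_image_le[of "{..<x + k}" Y] by simp
  obtain B where B: "?X \<subseteq> B" "B \<subseteq> W" "independent B" "W \<subseteq> span B"
    using maximal_independent_subset_extend[OF X indX(1)] by blast
  have finB: "finite B" using independent_span_bound[OF finY B(3)] B(2) Y by blast
  have cB: "card B = x + \<delta>" using basis_card_eq_dim[OF B(2,4,3)] dimW by simp
  have spB: "span B = W" using B(2,4) W by (metis span_minimal subset_antisym)
  obtain C where C: "B \<subseteq> C" "C \<subseteq> B \<union> ?Y" "independent C" "B \<union> ?Y \<subseteq> span C"
    using maximal_independent_subset_extend[of B "B \<union> ?Y"] B(3) by blast
  have BY: "B \<subseteq> span ?Y" using B(2) Y by blast
  have spC: "span C = span ?Y"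
  proof
    have "?Y \<subseteq> span ?Y" by (rule span_superset)
    then have "B \<union> ?Y \<subseteq> span ?Y" using BY by simp
    then have "C \<subseteq> span ?Y" using C(2) by (rule order_trans[rotated])
    then show "span C \<subseteq> span ?Y" by (simp add: span_minimal)
    show "span ?Y \<subseteq> span C" using C(4) by (simp add: span_minimal)
  qed
  have finC: "finite C" and cC: "card C \<le> x + k"
    using independent_span_bound[OF finY C(3)] spC span_superset[of C] cY by auto
  define R where "R = C - B"
  have CBR: "C = B \<union> R" "B \<inter> R = {}" using C(1) unfolding R_def by auto
  have RY: "R \<subseteq> ?Y" using C(2) unfolding R_def by blast
  have finR: "finite R" unfolding R_def using finC by simp
  have cCR: "card C = x + \<delta> + card R" using card_Un_disjoint[OF finB finR CBR(2)] CBR(1) cB by simp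
  have \<delta>k: "\<delta> \<le> k" and cR: "card R \<le> k - \<delta>" using cCR cC by auto
  have indXR: "independent (?X \<union> R)" using C(3) B(1) CBR(1) by (metis Un_mono independent_mono order_refl)
  obtain C2 where C2: "?X \<union> R \<subseteq> C2" "C2 \<subseteq> ?X \<union> R \<union> ?Y" "independent C2" "?X \<union> R \<union> ?Y \<subseteq> span C2"
    using maximal_independent_subset_extend[of "?X \<union> R" "?X \<union> R \<union> ?Y"] indXR by blast
  have XY: "?X \<subseteq> span ?Y" using X Y by blast
  have spC2: "span C2 = span ?Y"
  proof
    have "?Y \<subseteq> span ?Y" by (rule span_superset)
    then have "?X \<union> R \<union> ?Y \<subseteq> span ?Y" using XY RY by simp
    then have "C2 \<subseteq> span ?Y" using C2(2) by (rule order_trans[rotated])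
    then show "span C2 \<subseteq> span ?Y" by (simp add: span_minimal)
    show "span ?Y \<subseteq> span C2" using C2(4) by (simp add: span_minimal)
  qed
  have finC2: "finite C2" using independent_span_bound[OF finY C2(3)] spC2 span_superset[of C2] by auto
  have cC2: "card C2 = card C"
    using dim_eq_card[of C "span ?Y"] dim_eq_card[of C2 "span ?Y"] spC spC2 C(3) C2(3) by (simp add: span_span)
  define Pi where "Pi = C2 - (?X \<union> R)"
  have XR: "?X \<inter> R = {}" using B(1) CBR(2) by blast
  have PiY: "Pi \<subseteq> ?Y" using C2(2) unfolding Pi_def by blast
  have finPi: "finite Pi" unfolding Pi_def using finC2 by simp
  have "card C2 = card (?X \<union> R) + card Pi"
    unfolding Pi_def using C2(1) finC2 card_mono[OF finC2 C2(1)] card_Diff_subset[OF finite_subset[OF C2(1) finC2] C2(1)]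
    by simp
  also have "card (?X \<union> R) = x + card R" using card_Un_disjoint[of ?X R] finR XR indX(2) by simp
  finally have cPi: "card Pi = \<delta>" using cC2 cCR by simp
  obtain pl where pl: "set pl = Pi" "distinct pl" using finite_distinct_list[OF finPi] by blast
  have lpl: "length pl = \<delta>" using distinct_card[OF pl(2)] pl(1) cPi by simp
  obtain rl where rl: "set rl = R" "distinct rl" using finite_distinct_list[OF finR] by blast
  have lrl: "length rl = card R" using distinct_card[OF rl(2)] rl(1) by simp
  have "\<exists>i<x + k. Y i = pl ! p" if "p < \<delta>" for p
  proof -
    have "pl ! p \<in> ?Y" using that lpl pl(1) PiY nth_mem by blast
    then show ?thesis by auto
  qed
  then obtain \<pi> where \<pi>: "\<And>p. p < \<delta> \<Longrightarrow> \<pi> p < x + k \<and> Y (\<pi> p) = pl ! p" by metis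
  \<comment> \<open>\<open>R\<close> has fewer than \<open>k - \<delta>\<close> members when
    \<open>Y\<close> is dependent; the remaining indices are filled with 0 and get coefficient 0
    below.\<close>
  have "\<exists>i. q < k - \<delta> \<longrightarrow> i < x + k \<and> (q < card R \<longrightarrow> Y i = rl ! q)" for q
  proof (cases "q < card R")
    case True
    then have "rl ! q \<in> ?Y" using lrl rl(1) RY nth_mem by (metis subsetD)
    then show ?thesis by auto
  next
    case False
    then show ?thesis by (intro exI[of _ 0]) auto
  qed
  then obtain \<rho> where \<rho>: "\<And>q. q < k - \<delta> \<Longrightarrow> \<rho> q < x + k" "\<And>q. q < k - \<delta> \<Longrightarrow> q < card R \<Longrightarrow> Y (\<rho> q) = rl ! q" by metis
  have dec: "\<exists>t. y - (\<Sum>q<k - \<delta>. scale (t q) (Y (\<rho> q))) \<in> W \<and> (\<Sum>q<k - \<delta>. scale (t q) (Y (\<rho> q))) \<in> span R"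
    if y: "y \<in> Pi" for y
  proof -
    have "y \<in> span (B \<union> R)" using y PiY spC CBR(1) span_superset by blast
    then obtain a r where ar: "a \<in> span B" "r \<in> span R" "y = a + r" unfolding span_Un by blast
    obtain f where f: "r = (\<Sum>v\<in>R. scale (f v) v)" using ar(2) unfolding span_finite[OF finR] by blast
    define t where "t q = (if q < card R then f (rl ! q) else 0)" for q
    have "(\<Sum>q<k - \<delta>. scale (t q) (Y (\<rho> q))) = (\<Sum>q<card R. scale (t q) (Y (\<rho> q)))"
      using cR by (intro sum.mono_neutral_right) (auto simp: t_def)
    also have "\<dots> = (\<Sum>q<length rl. scale (f (rl ! q)) (rl ! q))"
      using cR \<rho>(2) lrl by (intro sum.cong) (auto simp: t_def)
    also have "\<dots> = r" using sum.reindex_bij_betw[OF bij_betw_nth[OF rl(2) refl refl], of "\<lambda>v. scale (f v) v"] rl(1) f by simp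
    finally have "(\<Sum>q<k - \<delta>. scale (t q) (Y (\<rho> q))) = r" .
    then show ?thesis using ar spB by (intro exI[of _ t]) auto
  qed
  have "\<exists>t. Y (\<pi> p) - (\<Sum>q<k - \<delta>. scale (t q) (Y (\<rho> q))) \<in> W \<and> (\<Sum>q<k - \<delta>. scale (t q) (Y (\<rho> q))) \<in> span R" if "p < \<delta>" for p
    using dec[of "Y (\<pi> p)"] \<pi>[OF that] lpl pl(1) that by auto
  then obtain t where t: "\<And>p. p < \<delta> \<Longrightarrow> Y (\<pi> p) - (\<Sum>q<k - \<delta>. scale (t p q) (Y (\<rho> q))) \<in> W"
    "\<And>p. p < \<delta> \<Longrightarrow> (\<Sum>q<k - \<delta>. scale (t p q) (Y (\<rho> q))) \<in> span R" by metis
  let ?wy = "\<lambda>p. Y (\<pi> p) - (\<Sum>q<k - \<delta>. scale (t p q) (Y (\<rho> q)))"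
  let ?E = "span (?X \<union> ?wy ` {..<\<delta>})"
  have "?E \<subseteq> W" using X t(1) W by (intro span_minimal) auto
  moreover have "W \<subseteq> ?E"
  proof
    fix v assume v: "v \<in> W"
    have "C2 \<subseteq> span ((?X \<union> ?wy ` {..<\<delta>}) \<union> R)"
    proof
      fix y assume "y \<in> C2"
      then consider "y \<in> ?X \<union> R" | "y \<in> Pi" unfolding Pi_def by blast
      then show "y \<in> span ((?X \<union> ?wy ` {..<\<delta>}) \<union> R)"
      proof cases
        case 1 then show ?thesis by (intro span_base) auto
      next
        case 2
        then obtain p where p: "p < \<delta>" "y = Y (\<pi> p)" using pl(1) lpl \<pi> by (metis in_set_conv_nth)
        have "?wy p \<in> span ((?X \<union> ?wy ` {..<\<delta>}) \<union> R)" using p by (intro span_base) auto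
        moreover have "(\<Sum>q<k - \<delta>. scale (t p q) (Y (\<rho> q))) \<in> span ((?X \<union> ?wy ` {..<\<delta>}) \<union> R)"
          using t(2)[OF p(1)] span_mono[of R "(?X \<union> ?wy ` {..<\<delta>}) \<union> R"] by auto
        ultimately have "?wy p + (\<Sum>q<k - \<delta>. scale (t p q) (Y (\<rho> q))) \<in> span ((?X \<union> ?wy ` {..<\<delta>}) \<union> R)" by (rule span_add)
        then show ?thesis using p(2) by simp
      qed
    qed
    then have "span C2 \<subseteq> span ((?X \<union> ?wy ` {..<\<delta>}) \<union> R)" by (simp add: span_minimal)
    then have "v \<in> span ((?X \<union> ?wy ` {..<\<delta>}) \<union> R)" using v Y spC2 by blast
    then obtain a r where ar: "a \<in> ?E" "r \<in> span R" "v = a + r" unfolding span_Un[of _ R] by blast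
    have "r = v - a" using ar(3) by simp
    then have "r \<in> W" using v ar(1) \<open>?E \<subseteq> W\<close> W subspace_diff by blast
    then have "r = 0" using span_Int_independent[of B R r] C(3) CBR spB ar(2) by simp
    then show "v \<in> ?E" using ar by simp
  qed
  ultimately have "W = ?E" by blast
  then show ?thesis using \<delta>k \<pi> \<rho>(1) by blast
qed

end

context vector_space
begin

lemma span_family_iff:
  "v \<in> span (G ` {..<d::nat}) \<longleftrightarrow> (\<exists>a. v = (\<Sum>j<d. scale (a j) (G j)))"
proof
  assume "\<exists>a. v = (\<Sum>j<d. scale (a j) (G j))"
  then obtain a where a: "v = (\<Sum>j<d. scale (a j) (G j))" by blast
  show "v \<in> span (G ` {..<d})" unfolding a by (intro span_sum span_scale span_base) auto
next
  let ?S = "{v. \<exists>a. v = (\<Sum>j<d. scale (a j) (G j))}"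
  have "subspace ?S"
  proof (rule subspaceI)
    have eq: "0 = (\<Sum>j<d. scale 0 (G j))" by simp
    show "0 \<in> ?S" by (rule CollectI, rule exI[of _ "\<lambda>j. 0"], rule eq)
    show "x + y \<in> ?S" if xy: "x \<in> ?S" "y \<in> ?S" for x y
    proof -
      obtain a b where "x = (\<Sum>j<d. scale (a j) (G j))" "y = (\<Sum>j<d. scale (b j) (G j))" using xy by blast
      then have eq: "x + y = (\<Sum>j<d. scale (a j + b j) (G j))" by (simp add: scale_left_distrib sum.distrib)
      show ?thesis by (rule CollectI, rule exI[of _ "\<lambda>j. a j + b j"], rule eq)
    qed
    show "scale r x \<in> ?S" if x: "x \<in> ?S" for r x
    proof -
      obtain a where "x = (\<Sum>j<d. scale (a j) (G j))" using x by blast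
      then have eq: "scale r x = (\<Sum>j<d. scale (r * a j) (G j))" by (simp add: scale_sum_right)
      show ?thesis by (rule CollectI, rule exI[of _ "\<lambda>j. r * a j"], rule eq)
    qed
  qed
  moreover have "G ` {..<d} \<subseteq> ?S"
  proof
    fix y assume "y \<in> G ` {..<d}"
    then obtain i where i: "i < d" "y = G i" by auto
    have "(\<Sum>j<d. scale (if j = i then 1 else 0) (G j)) = (\<Sum>j<d. if j = i then G j else 0)"
      by (intro sum.cong) auto
    then have eq: "y = (\<Sum>j<d. scale (if j = i then 1 else 0) (G j))" using i by simp
    show "y \<in> ?S" by (rule CollectI, rule exI[of _ "\<lambda>j. if j = i then 1 else 0"], rule eq)
  qed
  ultimately have "span (G ` {..<d}) \<subseteq> ?S" by (rule span_minimal[rotated])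
  then show "v \<in> span (G ` {..<d}) \<Longrightarrow> \<exists>a. v = (\<Sum>j<d. scale (a j) (G j))" by blast
qed

lemma dim_independent_family:
  assumes "\<And>a. (\<Sum>j<d::nat. scale (a j) (G j)) = 0 \<Longrightarrow> (\<And>j. j < d \<Longrightarrow> a j = 0)"
  shows "dim (span (G ` {..<d})) = d"
proof -
  have inj: "inj_on G {..<d}"
  proof (rule inj_onI, rule ccontr)
    fix i j assume ij: "i \<in> {..<d}" "j \<in> {..<d}" "G i = G j" "i \<noteq> j"
    define a :: "nat \<Rightarrow> 'a" where "a l = (if l = i then 1 else if l = j then -1 else 0)" for l
    have "(\<Sum>l<d. scale (a l) (G l)) = (\<Sum>l\<in>{i,j}. scale (a l) (G l))"
      by (rule sum.mono_neutral_right) (use ij in \<open>auto simp: a_def\<close>)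
    also have "\<dots> = 0" using ij by (simp add: a_def)
    finally have "a i = 0" using assms[of a i] ij by simp
    then show False by (simp add: a_def)
  qed
  have "independent (G ` {..<d})"
  proof
    assume "dependent (G ` {..<d})"
    then obtain u where u: "\<exists>v\<in>G ` {..<d}. u v \<noteq> 0" "(\<Sum>v\<in>G ` {..<d}. scale (u v) v) = 0"
      using dependent_finite[of "G ` {..<d}"] by auto
    have "(\<Sum>j<d. scale (u (G j)) (G j)) = 0" using u(2) by (simp add: sum.reindex[OF inj])
    then show False using assms[of "\<lambda>j. u (G j)"] u(1) by auto
  qed
  then show ?thesis using dim_eq_card[of "G ` {..<d}" "span (G ` {..<d})"] card_image[OF inj] by (simp add: span_span)
qed

lemma dim_mono_finite:
  assumes "finite S" "W \<subseteq> span S" "W' \<subseteq> W" shows "dim W' \<le> dim W"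
proof -
  obtain B where B: "B \<subseteq> W" "independent B" "W \<subseteq> span B" "card B = dim W" using basis_exists by blast
  obtain B' where B': "B' \<subseteq> W'" "independent B'" "W' \<subseteq> span B'" "card B' = dim W'" using basis_exists by blast
  have "finite B" using independent_span_bound[OF assms(1) B(2)] B(1) assms(2) by blast
  then have "card B' \<le> card B" using independent_span_bound[OF _ B'(2), of B] B'(1) assms(3) B(3) by blast
  then show ?thesis using B B' by simp
qed

end

declare fscale_apply [simp del]

section \<open>The filtration of invariant subspaces by the operators \<open>T h\<close>\<close>

lemma jshift_linear: "Vector_Spaces.linear fscale fscale (jshift c i)"
  unfolding Vector_Spaces.linear_iff using fv.vector_space_axioms
  by (auto simp: jshift_def fun_eq_iff fscale_apply algebra_simps)

lemma jshift_commute: "jshift c i (jshift c j f) = jshift c j (jshift c i f)"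
  by (auto simp: jshift_def fun_eq_iff algebra_simps)

locale jspace =
  fixes m :: "nat \<Rightarrow> nat" and c :: "nat \<Rightarrow> 'k::field" and K :: nat
  assumes m_anti: "antimono m" and m_zero: "h \<ge> K \<Longrightarrow> m h = 0"
begin

abbreviation V :: "(nat \<times> nat \<Rightarrow> 'k) set" where "V \<equiv> supp_in (young m)"

fun T :: "nat \<Rightarrow> (nat \<times> nat \<Rightarrow> 'k) \<Rightarrow> nat \<times> nat \<Rightarrow> 'k" where
  "T 0 f = f"
| "T (Suc h) f = jshift c h (T h f)"

lemma T_commute: "T h (jshift c i f) = jshift c i (T h f)"
  by (induction h) (simp_all add: jshift_commute[of c i])

lemma T_linear: "Vector_Spaces.linear fscale fscale (T h)"
proof (induction h)
  case 0
  show ?case unfolding Vector_Spaces.linear_iff using fv.vector_space_axioms by simp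
next
  case (Suc h)
  have "T (Suc h) = jshift c h \<circ> T h" by auto
  then show ?case using Vector_Spaces.linear_compose[OF Suc jshift_linear] by (simp only:)
qed

lemma V_subspace: "fv.subspace V"
  by (rule fv.subspaceI) (auto simp: supp_in_def fscale_apply)

lemma V_jshift: "f \<in> V \<Longrightarrow> jshift c i f \<in> V"
  by (rule jshift_supp[OF m_anti])

lemma T_V: "f \<in> V \<Longrightarrow> T h f \<in> V"
  by (induction h) (auto intro: V_jshift)

text \<open>Commuting the last factor inward gives
  \<open>(c i - c h) * f (b,i) + f (b,Suc i) = 0\<close> for \<open>i \<ge> h\<close>. For
  \<open>i = h\<close> the first term drops out, and afterwards each equation passes the zero on to
  the next layer.\<close>

lemma T_kernel: "T h f = 0 \<Longrightarrow> i \<ge> h \<Longrightarrow> f (b,i) = 0"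
proof (induction h arbitrary: f i)
  case 0 then show ?case by simp
next
  case (Suc h)
  have "T h (jshift c h f) = 0" using Suc.prems(1) by (simp only: T.simps T_commute)
  then have z: "(c i - c h) * f (b,i) + f (b,Suc i) = 0" if "i \<ge> h" for i
    using Suc.IH[of "jshift c h f" i] that by (simp add: jshift_def)
  from Suc.prems(2) show ?case
  proof (induction i rule: dec_induct)
    case base show ?case using z[of h] by simp
  next
    case (step i) then show ?case using z[of i] by simp
  qed
qed

lemma T_kill: "(\<And>b i. i \<ge> h \<Longrightarrow> f (b,i) = 0) \<Longrightarrow> T h f = 0"
proof (induction h arbitrary: f)
  case 0
  then show ?case by (simp add: fun_eq_iff)
next
  case (Suc h)
  have "jshift c h f (b,i) = 0" if "i \<ge> h" for b i
    using Suc.prems[of i b] Suc.prems[of "Suc i" b] that by (cases "i = h") (auto simp: jshift_def)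
  then have "T h (jshift c h f) = 0" by (rule Suc.IH)
  then show ?case by (simp only: T.simps T_commute)
qed

definition \<delta> :: "nat \<times> nat \<Rightarrow> nat \<times> nat \<Rightarrow> 'k" where "\<delta> p = (\<lambda>q. if q = p then 1 else 0)"

definition kgen :: "nat \<Rightarrow> nat \<Rightarrow> nat \<times> nat \<Rightarrow> 'k" where "kgen h b = T h (\<delta> (b,h))"

text \<open>If \<open>T (Suc h) f = 0\<close>, then \<open>f\<close> lives on the layers up to
  \<open>h\<close>; those below \<open>h\<close> are killed by \<open>T h\<close>, so
  \<open>T h f\<close> depends only on the \<open>m h\<close> values in layer
  \<open>h\<close>.\<close>

lemma kernel_generated:
  assumes f: "f \<in> V" and z: "jshift c h (T h f) = 0"
  shows "T h f \<in> fv.span (kgen h ` {..<m h})"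
proof -
  have "T (Suc h) f = 0" using z by (simp only: T.simps)
  then have hi: "f (b,i) = 0" if "i \<ge> Suc h" for b i using T_kernel[of "Suc h" f i b] that by blast
  define g where "g = (\<Sum>b<m h. fscale (f (b,h)) (\<delta> (b,h)))"
  have g: "g (b,i) = (if i = h then f (b,h) else 0)" for b i
  proof -
    have "g (b,i) = (\<Sum>b'<m h. if b' = b then (if i = h then f (b,h) else 0) else 0)"
      unfolding g_def fun_sum_apply by (intro sum.cong) (auto simp: \<delta>_def fscale_apply)
    then show ?thesis using f by (auto simp: supp_in_def young_def)
  qed
  have "T h (f - g) = 0"
  proof (rule T_kill)
    fix b i assume "i \<ge> h"
    then show "(f - g) (b,i) = 0" using hi[of i b] g[of b i] by (cases "i = h") auto
  qed
  then have "T h f = T h g" using fvp.linear_diff[OF T_linear[of h], of f g] by simp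
  also have "\<dots> = (\<Sum>b<m h. fscale (f (b,h)) (kgen h b))"
    unfolding g_def kgen_def fvp.linear_sum[OF T_linear] fvp.linear_scale[OF T_linear] ..
  finally have eq: "T h f = (\<Sum>b<m h. fscale (f (b,h)) (kgen h b))" .
  show ?thesis unfolding fv.span_family_iff by (rule exI[of _ "\<lambda>b. f (b,h)"], rule eq)
qed

text \<open>For a subspace, stability under one \<open>jshift c i\<close>, under all of them and
  under \<open>jop c\<close> amount to the same; the form with all \<open>i\<close> lets
  \<open>T h\<close> act.\<close>

definition inv_sub :: "(nat \<times> nat \<Rightarrow> 'k) set \<Rightarrow> bool" where
  "inv_sub W \<longleftrightarrow> fv.subspace W \<and> W \<subseteq> V \<and> (\<forall>f\<in>W. \<forall>i. jshift c i f \<in> W)"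

lemma T_Suc_image: "T (Suc h) ` W = jshift c h ` T h ` W"
  by (auto simp: image_image)

lemma T_image_decreasing: "inv_sub W \<Longrightarrow> T (Suc h) ` W \<subseteq> T h ` W"
  by (auto simp: inv_sub_def T_commute[symmetric])

lemma T_image_subspace: "inv_sub W \<Longrightarrow> fv.subspace (T h ` W)"
  unfolding inv_sub_def by (intro fvp.linear_subspace_image[OF T_linear]) simp

lemma T_image_top: "inv_sub W \<Longrightarrow> T K ` W = {0}"
proof -
  assume W: "inv_sub W"
  have "T K f = 0" if "f \<in> W" for f
    by (rule T_kill) (use W that m_zero in \<open>auto simp: inv_sub_def supp_in_def young_def\<close>)
  moreover have "W \<noteq> {}" using W fv.subspace_0 unfolding inv_sub_def by blast
  ultimately show ?thesis by (simp add: image_constant_conv cong: image_cong)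
qed

text \<open>A linear section of \<open>jshift c h\<close>, chosen once and for all: lifts then
  depend linearly on the vector, which keeps families polynomial in their parameters.\<close>

definition sec :: "nat \<Rightarrow> (nat \<times> nat \<Rightarrow> 'k) \<Rightarrow> nat \<times> nat \<Rightarrow> 'k" where
  "sec h = (SOME g. g ` UNIV \<subseteq> T h ` V \<and> Vector_Spaces.linear fscale fscale g \<and>
     (\<forall>v\<in>jshift c h ` T h ` V. jshift c h (g v) = v))"

lemma sec: "sec h v \<in> T h ` V" "Vector_Spaces.linear fscale fscale (sec h)"
  "v \<in> jshift c h ` T h ` V \<Longrightarrow> jshift c h (sec h v) = v"
proof -
  have "fv.subspace (T h ` V)" by (rule fvp.linear_subspace_image[OF T_linear V_subspace])
  from someI_ex[OF fvp.linear_exists_right_inverse_on[OF jshift_linear this, of c h], folded sec_def]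
  show "sec h v \<in> T h ` V" "Vector_Spaces.linear fscale fscale (sec h)"
    "v \<in> jshift c h ` T h ` V \<Longrightarrow> jshift c h (sec h v) = v" by blast+
qed

text \<open>A spanning list for the preimage, in the image of \<open>T h\<close>, of the span of
  \<open>X\<close>: lifts first, then the kernel. Its length \<open>x + m h\<close> means
  \<open>k = m h\<close> in \<open>echelon_form\<close>.\<close>

definition Yv :: "nat \<Rightarrow> nat \<Rightarrow> (nat \<Rightarrow> nat \<times> nat \<Rightarrow> 'k) \<Rightarrow> nat \<Rightarrow> nat \<times> nat \<Rightarrow> 'k" where
  "Yv h x X k = (if k < x then sec h (X k) else kgen h (k - x))"

lemma preimage_spanned:
  assumes W: "inv_sub W" and X: "fv.span (X ` {..<x}) = T (Suc h) ` W"
  shows "T h ` W \<subseteq> fv.span (Yv h x X ` {..<x + m h})"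
proof
  let ?Y = "Yv h x X ` {..<x + m h}"
  fix y assume "y \<in> T h ` W"
  then obtain f where f: "f \<in> W" "y = T h f" by blast
  have "jshift c h y \<in> fv.span (X ` {..<x})" unfolding X T_Suc_image using f by blast
  then obtain a where a: "jshift c h y = (\<Sum>j<x. fscale (a j) (X j))" unfolding fv.span_family_iff by blast
  define z where "z = (\<Sum>j<x. fscale (a j) (sec h (X j)))"
  have fV: "f \<in> V" using f W unfolding inv_sub_def by blast
  have zT: "z = sec h (jshift c h y)" unfolding a z_def fvp.linear_sum[OF sec(2)] fvp.linear_scale[OF sec(2)] ..
  have "jshift c h z = jshift c h y" unfolding zT f(2) using fV by (intro sec(3)) blast
  moreover obtain g where g: "g \<in> V" "z = T h g" using sec(1)[of h "jshift c h y"] zT by auto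
  ultimately have "jshift c h (T h (f - g)) = 0"
    using f(2) fvp.linear_diff[OF T_linear[of h], of f g] fvp.linear_diff[OF jshift_linear[of c h], of y z] by simp
  then have "T h (f - g) \<in> fv.span (kgen h ` {..<m h})"
    by (intro kernel_generated) (use fV g(1) fv.subspace_diff[OF V_subspace] in auto)
  moreover have "kgen h ` {..<m h} \<subseteq> ?Y"
  proof
    fix v assume "v \<in> kgen h ` {..<m h}"
    then obtain b where b: "b < m h" "v = kgen h b" by auto
    then have "v = Yv h x X (x + b)" by (simp add: Yv_def)
    then show "v \<in> ?Y" using b(1) by auto
  qed
  ultimately have 1: "T h (f - g) \<in> fv.span ?Y" using fv.span_mono by blast
  have "sec h (X j) \<in> ?Y" if "j < x" for j
  proof -
    have "sec h (X j) = Yv h x X j" using that by (simp add: Yv_def)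
    then show ?thesis using that by auto
  qed
  then have 2: "z \<in> fv.span ?Y" unfolding z_def by (intro fv.span_sum fv.span_scale fv.span_base) auto
  have "y = T h (f - g) + z" using f(2) g(2) fvp.linear_diff[OF T_linear[of h], of f g] by simp
  then show "y \<in> fv.span ?Y" using fv.span_add[OF 1 2] by simp
qed

lemma finite_young_m: "finite (young m)"
  using card_young(2)[of K m] m_zero by blast

lemma V_spanned: "V \<subseteq> fv.span (\<delta> ` young m)"
proof
  fix f :: "nat \<times> nat \<Rightarrow> 'k" assume f: "f \<in> V"
  have "f = (\<Sum>p\<in>young m. fscale (f p) (\<delta> p))"
  proof
    fix q
    have "(\<Sum>p\<in>young m. f p * \<delta> p q) = (\<Sum>p\<in>young m. if p = q then f p else 0)"
      by (intro sum.cong) (auto simp: \<delta>_def)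
    then show "f q = (\<Sum>p\<in>young m. fscale (f p) (\<delta> p)) q"
      using f finite_young_m by (cases q) (auto simp: fun_sum_apply supp_in_def fscale_apply)
  qed
  also have "\<dots> \<in> fv.span (\<delta> ` young m)" by (intro fv.span_sum fv.span_scale fv.span_base) auto
  finally show "f \<in> fv.span (\<delta> ` young m)" .
qed

text \<open>The basis \<open>X\<close> plays two roles. By invariance the image of \<open>W\<close>
  under \<open>T (Suc h)\<close> lies in that under \<open>T h\<close>, so \<open>X\<close> starts a
  basis of the larger image; and lifts of \<open>X\<close> span that image up to the kernel.\<close>

lemma T_image_echelon:
  assumes W: "inv_sub W" and X: "fv.span (X ` {..<x}) = T (Suc h) ` W"
    and dimX: "fv.dim (T (Suc h) ` W) = x" and dimW: "fv.dim (T h ` W) = x + e"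
  shows "e \<le> m h \<and> (\<exists>\<pi> \<rho> t. (\<forall>p<e. \<pi> p < x + m h) \<and> (\<forall>q<m h - e. \<rho> q < x + m h) \<and>
    T h ` W = fv.span (X ` {..<x} \<union> (\<lambda>p. Yv h x X (\<pi> p) - (\<Sum>q<m h - e. fscale (t p q) (Yv h x X (\<rho> q)))) ` {..<e}))"
proof (rule fv.echelon_form)
  show "fv.subspace (T h ` W)" by (rule T_image_subspace[OF W])
  have "X ` {..<x} \<subseteq> T (Suc h) ` W" unfolding X[symmetric] by (rule fv.span_superset)
  then show "X ` {..<x} \<subseteq> T h ` W" using T_image_decreasing[OF W, of h] by blast
  have "fv.dim (fv.span (X ` {..<x})) = x" using X dimX by simp
  then show "fv.independent (X ` {..<x})" "card (X ` {..<x}) = x" using fv.spanning_family_basis[of X x] by auto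
  show "T h ` W \<subseteq> fv.span (Yv h x X ` {..<x + m h})" by (rule preimage_spanned[OF W X])
qed (rule dimW)

text \<open>The bound \<open>dd h \<le> m h\<close> is the inequality part of the echelon form,
  taken with an arbitrary basis of the next image.\<close>

lemma T_image_dims:
  assumes W: "inv_sub W"
  shows "\<exists>dd. (\<forall>h. dd h \<le> m h) \<and> (\<forall>h\<le>K. fv.dim (T h ` W) = (\<Sum>i=h..<K. dd i))"
proof -
  have TV: "T h ` W \<subseteq> fv.span (\<delta> ` young m)" for h
    using W T_V V_spanned unfolding inv_sub_def by blast
  define dd where "dd h = (if h < K then fv.dim (T h ` W) - fv.dim (T (Suc h) ` W) else 0)" for h
  have dec: "fv.dim (T (Suc h) ` W) \<le> fv.dim (T h ` W)" for h
    by (rule fv.dim_mono_finite[OF _ TV T_image_decreasing[OF W]]) (simp add: finite_young_m)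
  have "dd h \<le> m h" for h
  proof (cases "h < K")
    case True
    obtain B where B: "B \<subseteq> T (Suc h) ` W" "fv.independent B" "T (Suc h) ` W \<subseteq> fv.span B" "card B = fv.dim (T (Suc h) ` W)"
      using fv.basis_exists by blast
    have finB: "finite B" using fv.independent_span_bound[OF _ B(2), of "\<delta> ` young m"] B(1) TV[of "Suc h"] finite_young_m by blast
    obtain xs where xs: "set xs = B" "distinct xs" using finite_distinct_list[OF finB] by blast
    have len: "length xs = fv.dim (T (Suc h) ` W)" using distinct_card[OF xs(2)] xs(1) B(4) by simp
    have "(!) xs ` {..<length xs} = B" using xs(1) by (auto simp: set_conv_nth)
    moreover have "fv.span B = T (Suc h) ` W" using B(1,3) T_image_subspace[OF W, of "Suc h"] by (metis fv.span_minimal subset_antisym)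
    ultimately have sp: "fv.span ((!) xs ` {..<length xs}) = T (Suc h) ` W" by simp
    from T_image_echelon[OF W sp len[symmetric], of "dd h"] show ?thesis
      using dec[of h] len True by (simp add: dd_def)
  qed (simp add: dd_def)
  moreover have "fv.dim (T h ` W) = (\<Sum>i=h..<K. dd i)" if "h \<le> K" for h
    using that
  proof (induction h rule: inc_induct)
    case base
    have "fv.span {} = fv.span ({0} :: (nat \<times> nat \<Rightarrow> 'k) set)" by simp
    from fv.dim_eq_card[OF this] have "fv.dim (T K ` W) = 0"
      unfolding T_image_top[OF W] using fv.independent_empty by simp
    then show ?case by simp
  next
    case (step h)
    then show ?case using dec[of h] by (simp add: sum.atLeast_Suc_lessThan dd_def)
  qed
  ultimately show ?thesis by blast
qed

text \<open>Expresses the section through the constants \<open>sec h (\<delta> p) q\<close>, so that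
  it preserves polynomial dependence on parameters.\<close>

lemma sec_apply_sum:
  assumes f: "f \<in> V"
  shows "sec h f q = (\<Sum>p\<in>young m. f p * sec h (\<delta> p) q)"
proof -
  have "f = (\<Sum>p\<in>young m. fscale (f p) (\<delta> p))"
  proof
    fix q
    have "(\<Sum>p\<in>young m. f p * \<delta> p q) = (\<Sum>p\<in>young m. if p = q then f p else 0)"
      by (intro sum.cong) (auto simp: \<delta>_def)
    then show "f q = (\<Sum>p\<in>young m. fscale (f p) (\<delta> p)) q"
      using f finite_young_m by (cases q) (auto simp: fun_sum_apply supp_in_def fscale_apply)
  qed
  then have "sec h f = sec h (\<Sum>p\<in>young m. fscale (f p) (\<delta> p))" by (rule arg_cong)
  also have "\<dots> = (\<Sum>p\<in>young m. fscale (f p) (sec h (\<delta> p)))"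
    unfolding fvp.linear_sum[OF sec(2)] fvp.linear_scale[OF sec(2)] ..
  finally show ?thesis by (simp add: fun_sum_apply fscale_apply)
qed

end

context jspace
begin

text \<open>For an invariant subspace in the stratum \<open>dd\<close>, this is the dimension of its
  image under \<open>T h\<close>; \<open>params_from dd h\<close> is the number of parameters spent
  on the layers from \<open>h\<close> on.\<close>

definition size_from :: "(nat \<Rightarrow> nat) \<Rightarrow> nat \<Rightarrow> nat" where
  "size_from dd h = (\<Sum>i=h..<K. dd i)"

definition params_from :: "(nat \<Rightarrow> nat) \<Rightarrow> nat \<Rightarrow> nat" where
  "params_from dd h = (\<Sum>i=h..<K. dd i * (m i - dd i))"

lemma from_Suc:
  "h < K \<Longrightarrow> size_from dd h = size_from dd (Suc h) + dd h"
  "h < K \<Longrightarrow> params_from dd h = params_from dd (Suc h) + dd h * (m h - dd h)"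
  by (simp_all add: size_from_def params_from_def sum.atLeast_Suc_lessThan)

definition family :: "nat \<Rightarrow> nat \<Rightarrow> ((nat \<Rightarrow> 'k) \<Rightarrow> nat \<Rightarrow> nat \<times> nat \<Rightarrow> 'k) \<Rightarrow> bool" where
  "family e d \<phi> \<longleftrightarrow> (\<forall>j<d. (\<forall>p. (\<lambda>u. \<phi> u j p) \<in> parpoly e) \<and> (\<forall>u. \<phi> u j \<in> V))"

text \<open>The first \<open>e\<close> parameters belong to the family being extended; parameter
  \<open>e + p * r + q\<close> is the coefficient \<open>t p q\<close> of the echelon form.\<close>

definition extend_family ::
  "nat \<Rightarrow> nat \<Rightarrow> nat \<Rightarrow> nat \<Rightarrow> ((nat \<Rightarrow> 'k) \<Rightarrow> nat \<Rightarrow> nat \<times> nat \<Rightarrow> 'k) \<Rightarrow> (nat \<Rightarrow> nat) \<Rightarrow> (nat \<Rightarrow> nat)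
    \<Rightarrow> (nat \<Rightarrow> 'k) \<Rightarrow> nat \<Rightarrow> nat \<times> nat \<Rightarrow> 'k" where
  "extend_family h x e r \<phi> \<pi> \<rho> u j = (if j < x then \<phi> u j
     else Yv h x (\<phi> u) (\<pi> (j - x)) - (\<Sum>q<r. fscale (u (e + (j - x) * r + q)) (Yv h x (\<phi> u) (\<rho> q))))"

lemma kgen_V: "b < m h \<Longrightarrow> kgen h b \<in> V"
  unfolding kgen_def by (rule T_V) (auto simp: supp_in_def young_def \<delta>_def)

lemma Yv_family:
  assumes "family e x \<phi>" "k < x + m h"
  shows "(\<lambda>u. Yv h x (\<phi> u) k p) \<in> parpoly e" "Yv h x (\<phi> u) k \<in> V"
proof -
  show "(\<lambda>u. Yv h x (\<phi> u) k p) \<in> parpoly e"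
  proof (cases "k < x")
    case True
    then have \<phi>: "\<phi> u k \<in> V" "(\<lambda>u. \<phi> u k p) \<in> parpoly e" for u p using assms(1) unfolding family_def by blast+
    have "(\<lambda>u. Yv h x (\<phi> u) k p) = (\<lambda>u. \<Sum>q\<in>young m. \<phi> u k q * sec h (\<delta> q) p)"
      using True sec_apply_sum[OF \<phi>(1)] by (simp add: Yv_def)
    also have "\<dots> \<in> parpoly e" using \<phi>(2) by (intro parpoly_sum parpoly.mult parpoly.const) auto
    finally show ?thesis .
  next
    case False
    then show ?thesis by (simp add: Yv_def parpoly.const)
  qed
  show "Yv h x (\<phi> u) k \<in> V"
  proof (cases "k < x")
    case True
    obtain f where "f \<in> V" "sec h (\<phi> u k) = T h f" using sec(1)[of h "\<phi> u k"] by blast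
    then have "sec h (\<phi> u k) \<in> V" using T_V[of f h] by simp
    then show ?thesis using True by (simp add: Yv_def)
  next
    case False
    then have "k - x < m h" using assms(2) by auto
    then show ?thesis using False kgen_V by (simp add: Yv_def)
  qed
qed

lemma extend_family:
  assumes \<phi>: "family e x \<phi>" and \<pi>: "\<And>p. p < t \<Longrightarrow> \<pi> p < x + m h" and \<rho>: "\<And>q. q < r \<Longrightarrow> \<rho> q < x + m h"
  shows "family (e + t * r) (x + t) (extend_family h x e r \<phi> \<pi> \<rho>)"
  unfolding family_def
proof (intro allI impI conjI)
  fix j assume j: "j < x + t"
  have jt: "j - x < t" if "\<not> j < x" using j that by simp
  show "(\<lambda>u. extend_family h x e r \<phi> \<pi> \<rho> u j p) \<in> parpoly (e + t * r)" for p
  proof (cases "j < x")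
    case True
    then have "(\<lambda>u. \<phi> u j p) \<in> parpoly e" using \<phi> unfolding family_def by blast
    then show ?thesis using True parpoly_mono[of _ e "e + t * r"] by (simp add: extend_family_def)
  next
    case False
    have idx: "e + (j - x) * r + q < e + t * r" if "q < r" for q
    proof -
      have "(j - x) * r + q < (j - x) * r + r" using that by simp
      also have "\<dots> = Suc (j - x) * r" by simp
      also have "\<dots> \<le> t * r" using jt[OF False] by (intro mult_le_mono1) simp
      finally show ?thesis by simp
    qed
    have Yp: "(\<lambda>u. Yv h x (\<phi> u) k p) \<in> parpoly (e + t * r)" if "k < x + m h" for k
      using Yv_family(1)[OF \<phi> that, of p] parpoly_mono by (metis le_add1)
    have "(\<lambda>u. Yv h x (\<phi> u) (\<pi> (j - x)) p - (\<Sum>q<r. u (e + (j - x) * r + q) * Yv h x (\<phi> u) (\<rho> q) p)) \<in> parpoly (e + t * r)"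
      using \<pi> \<rho> jt[OF False] idx by (intro parpoly_diff parpoly_sum parpoly.mult parpoly.coord Yp) auto
    moreover have "(\<lambda>u. extend_family h x e r \<phi> \<pi> \<rho> u j p)
       = (\<lambda>u. Yv h x (\<phi> u) (\<pi> (j - x)) p - (\<Sum>q<r. u (e + (j - x) * r + q) * Yv h x (\<phi> u) (\<rho> q) p))"
      using False by (simp add: extend_family_def fun_sum_apply fscale_apply)
    ultimately show ?thesis by simp
  qed
  show "extend_family h x e r \<phi> \<pi> \<rho> u j \<in> V" for u
  proof (cases "j < x")
    case True
    then show ?thesis using \<phi> unfolding family_def by (auto simp: extend_family_def)
  next
    case False
    have "Yv h x (\<phi> u) (\<pi> (j - x)) - (\<Sum>q<r. fscale (u (e + (j - x) * r + q)) (Yv h x (\<phi> u) (\<rho> q))) \<in> V"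
      using \<pi> \<rho> jt[OF False]
      by (intro fv.subspace_diff[OF V_subspace] fv.subspace_sum[OF V_subspace] fv.subspace_scale[OF V_subspace] Yv_family(2)[OF \<phi>]) auto
    then show ?thesis using False by (simp add: extend_family_def)
  qed
qed

lemma Yv_cong: "(\<And>j. j < x \<Longrightarrow> X j = X' j) \<Longrightarrow> Yv h x X k = Yv h x X' k"
  by (simp add: Yv_def)

definition covers :: "(nat \<Rightarrow> nat) \<Rightarrow> nat \<Rightarrow> ((nat \<Rightarrow> 'k) \<Rightarrow> nat \<Rightarrow> nat \<times> nat \<Rightarrow> 'k) set \<Rightarrow> bool" where
  "covers dd h \<Psi> \<longleftrightarrow> (\<forall>W. inv_sub W \<longrightarrow> (\<forall>i. h \<le> i \<longrightarrow> i \<le> K \<longrightarrow> fv.dim (T i ` W) = size_from dd i) \<longrightarrow>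
     (\<exists>\<phi>\<in>\<Psi>. \<exists>u. fv.span (\<phi> u ` {..<size_from dd h}) = T h ` W))"

text \<open>Descending induction from \<open>K\<close>, where the image of \<open>T K\<close> is 0.
  The number of families stays finite because the index choices of an echelon form range over a
  finite set, its coefficients being the parameters.\<close>

lemma covering_families:
  assumes "h \<le> K"
  shows "\<exists>\<Psi>. finite \<Psi> \<and> (\<forall>\<phi>\<in>\<Psi>. family (params_from dd h) (size_from dd h) \<phi>) \<and> covers dd h \<Psi>"
  using assms
proof (induction h rule: inc_induct)
  case base
  have "covers dd K {\<lambda>u j. 0}" unfolding covers_def size_from_def using T_image_top by simp
  moreover have "family (params_from dd K) (size_from dd K) (\<lambda>u j. 0)" by (simp add: family_def size_from_def)
  ultimately show ?case by blast
next
  case (step h)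
  let ?x = "size_from dd (Suc h)" and ?e = "params_from dd (Suc h)" and ?r = "m h - dd h"
  from step.IH obtain \<Psi> where \<Psi>: "finite \<Psi>" "\<And>\<phi>. \<phi> \<in> \<Psi> \<Longrightarrow> family ?e ?x \<phi>" "covers dd (Suc h) \<Psi>" by blast
  define \<Psi>' where "\<Psi>' = (\<lambda>(\<phi>,\<pi>,\<rho>). extend_family h ?x ?e ?r \<phi> \<pi> \<rho>) `
     (\<Psi> \<times> PiE {..<dd h} (\<lambda>_. {..<?x + m h}) \<times> PiE {..<?r} (\<lambda>_. {..<?x + m h}))"
  have fin: "finite \<Psi>'" unfolding \<Psi>'_def using \<Psi>(1)
    by (intro finite_imageI finite_cartesian_product finite_PiE) auto
  have fam: "family (params_from dd h) (size_from dd h) \<phi>" if \<phi>: "\<phi> \<in> \<Psi>'" for \<phi>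
  proof -
    obtain \<phi>0 \<pi> \<rho> where f: "\<phi>0 \<in> \<Psi>" "\<pi> \<in> PiE {..<dd h} (\<lambda>_. {..<?x + m h})" "\<rho> \<in> PiE {..<?r} (\<lambda>_. {..<?x + m h})"
      "\<phi> = extend_family h ?x ?e ?r \<phi>0 \<pi> \<rho>" using \<phi> unfolding \<Psi>'_def by auto
    show ?thesis unfolding from_Suc[OF step.hyps(2)] f(4)
      by (rule extend_family[OF \<Psi>(2)[OF f(1)]]) (use f(2,3) in auto)
  qed
  have "covers dd h \<Psi>'" unfolding covers_def
  proof (intro allI impI)
    fix W assume W: "inv_sub W" and dims: "\<forall>i. h \<le> i \<longrightarrow> i \<le> K \<longrightarrow> fv.dim (T i ` W) = size_from dd i"
    obtain \<phi> u where \<phi>: "\<phi> \<in> \<Psi>" "fv.span (\<phi> u ` {..<?x}) = T (Suc h) ` W"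
      using \<Psi>(3) W dims unfolding covers_def by (meson Suc_leD)
    have d1: "fv.dim (T (Suc h) ` W) = ?x" using dims[rule_format, of "Suc h"] step.hyps(2) by (simp del: T.simps)
    have d2: "fv.dim (T h ` W) = ?x + dd h"
      using dims[rule_format, of h] step.hyps(2) from_Suc(1)[OF step.hyps(2), of dd] by simp
    from T_image_echelon[OF W \<phi>(2) d1 d2] obtain \<pi> \<rho> t where
      \<pi>: "\<forall>p<dd h. \<pi> p < ?x + m h" and \<rho>: "\<forall>q<?r. \<rho> q < ?x + m h" and
      eq: "T h ` W = fv.span (\<phi> u ` {..<?x} \<union> (\<lambda>p. Yv h ?x (\<phi> u) (\<pi> p) - (\<Sum>q<?r. fscale (t p q) (Yv h ?x (\<phi> u) (\<rho> q)))) ` {..<dd h})"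
      by blast
    define \<pi>' where "\<pi>' = restrict \<pi> {..<dd h}"
    define \<rho>' where "\<rho>' = restrict \<rho> {..<?r}"
    \<comment> \<open>The new coefficients are stored row by row behind the first \<open>?e\<close>
      parameters; the old family keeps its value because it depends on those \<open>?e\<close>
      alone.\<close>
    define u' where "u' i = (if i < ?e then u i else t ((i - ?e) div ?r) ((i - ?e) mod ?r))" for i
    have \<phi>eq: "\<phi> u' j = \<phi> u j" if "j < ?x" for j
    proof
      fix p
      have "(\<lambda>u. \<phi> u j p) \<in> parpoly ?e" using \<Psi>(2)[OF \<phi>(1)] that unfolding family_def by blast
      then show "\<phi> u' j p = \<phi> u j p" by (rule parpoly_cong) (simp add: u'_def)
    qed
    have u't: "u' (?e + p * ?r + q) = t p q" if "q < ?r" for p q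
      using that by (simp add: u'_def)
    let ?\<phi> = "extend_family h ?x ?e ?r \<phi> \<pi>' \<rho>'"
    have mem: "?\<phi> \<in> \<Psi>'"
    proof -
      have "\<pi>' \<in> PiE {..<dd h} (\<lambda>_. {..<?x + m h})" "\<rho>' \<in> PiE {..<?r} (\<lambda>_. {..<?x + m h})"
        using \<pi> \<rho> unfolding \<pi>'_def \<rho>'_def by auto
      then show ?thesis unfolding \<Psi>'_def using \<phi>(1) by (intro image_eqI[of _ _ "(\<phi>,\<pi>',\<rho>')"]) auto
    qed
    have lo: "?\<phi> u' j = \<phi> u j" if "j < ?x" for j using that \<phi>eq by (simp add: extend_family_def)
    have hi: "?\<phi> u' (?x + p) = Yv h ?x (\<phi> u) (\<pi> p) - (\<Sum>q<?r. fscale (t p q) (Yv h ?x (\<phi> u) (\<rho> q)))" if p: "p < dd h" for p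
    proof -
      have "?\<phi> u' (?x + p) = Yv h ?x (\<phi> u') (\<pi>' p) - (\<Sum>q<?r. fscale (u' (?e + p * ?r + q)) (Yv h ?x (\<phi> u') (\<rho>' q)))"
        by (simp add: extend_family_def)
      also have "\<dots> = Yv h ?x (\<phi> u) (\<pi> p) - (\<Sum>q<?r. fscale (t p q) (Yv h ?x (\<phi> u) (\<rho> q)))"
        using p u't Yv_cong[of ?x "\<phi> u'" "\<phi> u"] \<phi>eq by (simp add: \<pi>'_def \<rho>'_def)
      finally show ?thesis .
    qed
    have split: "{..<?x + dd h} = {..<?x} \<union> (\<lambda>p. ?x + p) ` {..<dd h}"
    proof (intro equalityI subsetI)
      fix i assume i: "i \<in> {..<?x + dd h}"
      show "i \<in> {..<?x} \<union> (\<lambda>p. ?x + p) ` {..<dd h}"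
      proof (cases "i < ?x")
        case False
        then have "i = ?x + (i - ?x)" "i - ?x < dd h" using i by auto
        then show ?thesis by blast
      qed simp
    qed auto
    have "?\<phi> u' ` {..<size_from dd h} = ?\<phi> u' ` {..<?x} \<union> (\<lambda>p. ?\<phi> u' (?x + p)) ` {..<dd h}"
      unfolding from_Suc(1)[OF step.hyps(2)] split image_Un image_image ..
    also have "?\<phi> u' ` {..<?x} = \<phi> u ` {..<?x}" using lo by (intro image_cong) auto
    also have "(\<lambda>p. ?\<phi> u' (?x + p)) ` {..<dd h} = (\<lambda>p. Yv h ?x (\<phi> u) (\<pi> p) - (\<Sum>q<?r. fscale (t p q) (Yv h ?x (\<phi> u) (\<rho> q)))) ` {..<dd h}"
      using hi by (intro image_cong) auto
    finally have "fv.span (?\<phi> u' ` {..<size_from dd h}) = T h ` W" unfolding eq by (rule arg_cong)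
    then show "\<exists>\<phi>\<in>\<Psi>'. \<exists>u. fv.span (\<phi> u ` {..<size_from dd h}) = T h ` W"
      by (intro bexI[OF _ mem] exI[of _ u'])
  qed
  then show ?case using fin fam by blast
qed

lemma covering_families_dim:
  assumes bound: "\<And>dd. (\<And>h. dd h \<le> m h) \<Longrightarrow> (\<Sum>h<K. dd h) = d \<Longrightarrow> (\<Sum>h<K. dd h * (m h - dd h)) \<le> E"
  shows "\<exists>\<Psi>. finite \<Psi> \<and> (\<forall>\<phi>\<in>\<Psi>. family E d \<phi>) \<and>
    (\<forall>W. inv_sub W \<longrightarrow> fv.dim W = d \<longrightarrow> (\<exists>\<phi>\<in>\<Psi>. \<exists>u. fv.span (\<phi> u ` {..<d}) = W))"
proof -
  define DD where "DD = {dd \<in> PiE {..<K} (\<lambda>h. {..m h}). (\<Sum>h<K. dd h) = d}"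
  have "finite (PiE {..<K} (\<lambda>h. {..m h}))" by (intro finite_PiE) auto
  then have finDD: "finite DD" unfolding DD_def by simp
  obtain \<Psi> where \<Psi>: "\<And>dd. finite (\<Psi> dd)" "\<And>dd \<phi>. \<phi> \<in> \<Psi> dd \<Longrightarrow> family (params_from dd 0) (size_from dd 0) \<phi>"
    "\<And>dd. covers dd 0 (\<Psi> dd)" using covering_families[of 0] by (metis le0)
  have sz: "size_from dd 0 = (\<Sum>h<K. dd h)" "params_from dd 0 = (\<Sum>h<K. dd h * (m h - dd h))" for dd
    unfolding size_from_def params_from_def by (simp_all add: lessThan_atLeast0)
  have "family E d \<phi>" if dd: "dd \<in> DD" and \<phi>: "\<phi> \<in> \<Psi> dd" for dd \<phi>
  proof -
    \<comment> \<open>Outside \<open>{..<K}\<close> a member of \<open>DD\<close> is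
      \<open>undefined\<close>, so it is cut off to 0 before \<open>bound\<close> applies.\<close>
    define dd' where "dd' h = (if h < K then dd h else 0)" for h
    have "dd' h \<le> m h" for h using dd unfolding dd'_def DD_def by (auto simp: PiE_iff)
    moreover have "(\<Sum>h<K. dd' h) = d" using dd unfolding dd'_def DD_def by simp
    ultimately have "(\<Sum>h<K. dd' h * (m h - dd' h)) \<le> E" by (rule bound)
    then have "params_from dd 0 \<le> E" unfolding sz by (simp add: dd'_def)
    moreover have "size_from dd 0 = d" unfolding sz using dd by (simp add: DD_def)
    ultimately show ?thesis using \<Psi>(2)[OF \<phi>] parpoly_mono unfolding family_def by blast
  qed
  moreover have "\<exists>\<phi>\<in>\<Union>(\<Psi> ` DD). \<exists>u. fv.span (\<phi> u ` {..<d}) = W" if W: "inv_sub W" "fv.dim W = d" for W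
  proof -
    obtain dd where dd: "\<And>h. dd h \<le> m h" "\<And>h. h \<le> K \<Longrightarrow> fv.dim (T h ` W) = (\<Sum>i=h..<K. dd i)"
      using T_image_dims[OF W(1)] by blast
    define dd' where "dd' = restrict dd {..<K}"
    have eqs: "(\<Sum>i=h..<K. dd' i) = (\<Sum>i=h..<K. dd i)" for h unfolding dd'_def by (intro sum.cong) auto
    have T0: "T 0 ` W = W" by simp
    have "(\<Sum>h<K. dd' h) = d" using eqs[of 0] dd(2)[of 0] W(2) T0 by (simp add: lessThan_atLeast0)
    then have mem: "dd' \<in> DD" unfolding DD_def dd'_def using dd(1) by auto
    have "\<exists>\<phi>\<in>\<Psi> dd'. \<exists>u. fv.span (\<phi> u ` {..<size_from dd' 0}) = T 0 ` W"
      using \<Psi>(3)[of dd'] W(1) dd(2) eqs unfolding covers_def size_from_def by simp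
    moreover have "size_from dd' 0 = d" unfolding sz using mem by (simp add: DD_def)
    ultimately show ?thesis using mem T0 by auto
  qed
  moreover have "finite (\<Union>(\<Psi> ` DD))" using finDD \<Psi>(1) by simp
  ultimately show ?thesis by (intro exI[of _ "\<Union>(\<Psi> ` DD)"]) blast
qed

end

lemma mat_range_span:
  assumes "distinct ps" "length ps = n"
  shows "mat_range (mat n d (\<lambda>(i,j). G j (ps ! i))) = (\<lambda>f. vec n (\<lambda>i. f (ps ! i))) ` fv.span (G ` {..<d})"
proof (intro equalityI subsetI)
  let ?M = "mat n d (\<lambda>(i,j). G j (ps ! i))"
  have Mv: "?M *\<^sub>v v = vec n (\<lambda>i. (\<Sum>j<d. fscale (v $ j) (G j)) (ps ! i))" if "v \<in> carrier_vec d" for v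
    using that by (intro eq_vecI) (auto simp: scalar_prod_def lessThan_atLeast0 fun_sum_apply fscale_apply mult.commute intro!: sum.cong)
  {
    fix y assume "y \<in> mat_range ?M"
    then obtain v where v: "v \<in> carrier_vec d" "y = ?M *\<^sub>v v" unfolding mat_range_def by auto
    have "(\<Sum>j<d. fscale (v $ j) (G j)) \<in> fv.span (G ` {..<d})"
      by (intro fv.span_sum fv.span_scale fv.span_base) auto
    then show "y \<in> (\<lambda>f. vec n (\<lambda>i. f (ps ! i))) ` fv.span (G ` {..<d})" using Mv[OF v(1)] v(2) by blast
  }
  fix y assume "y \<in> (\<lambda>f. vec n (\<lambda>i. f (ps ! i))) ` fv.span (G ` {..<d})"
  then obtain f where f: "f \<in> fv.span (G ` {..<d})" "y = vec n (\<lambda>i. f (ps ! i))" by blast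
  obtain a where a: "f = (\<Sum>j<d. fscale (a j) (G j))" using f(1) unfolding fv.span_family_iff by blast
  have "(\<Sum>j<d. fscale (vec d a $ j) (G j)) = f" unfolding a by (intro sum.cong) auto
  then have "?M *\<^sub>v vec d a = y" using Mv[of "vec d a"] f(2) by simp
  then show "y \<in> mat_range ?M" unfolding mat_range_def by force
qed

lemma mat_range_mult:
  assumes "P \<in> carrier_mat n n" "N \<in> carrier_mat n d"
  shows "mat_range (P * N) = (\<lambda>v. P *\<^sub>v v) ` mat_range N"
  unfolding mat_range_def using assms by (auto simp: assoc_mult_mat_vec image_image)

text \<open>An invariant subspace with basis matrix \<open>M\<close> is moved to the diagram by
  \<open>Q\<close>: the columns of \<open>Q * M\<close>, read as functions on the boxes, span an
  \<open>inv_sub\<close> of dimension \<open>d\<close>, and one of the covering families reaches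
  it.\<close>

theorem fixed_grass_dim_upper:
  fixes A :: "'k::field mat"
  assumes sim: "similar_mat A (jmat c ps)"
    and ps: "distinct ps" "set ps = young m" "length ps = n"
    and m: "antimono m" "\<And>h. h \<ge> K \<Longrightarrow> m h = 0"
    and bound: "\<And>dd. (\<And>h. dd h \<le> m h) \<Longrightarrow> (\<Sum>h<K. dd h) = d \<Longrightarrow> (\<Sum>h<K. dd h * (m h - dd h)) \<le> E"
  shows "krull_dim (grass_closed n d) (fixed_grass n d A) \<le> enat E"
proof -
  interpret jspace m c K using m by unfold_locales auto
  define J where "J = jmat c ps"
  have J: "J \<in> carrier_mat n n" unfolding J_def using ps(3) jmat_carrier[of c ps] by simp
  from similar_matE[OF sim[folded J_def] J] obtain P Q where
    A: "A \<in> carrier_mat n n" "P \<in> carrier_mat n n" "Q \<in> carrier_mat n n" "P * Q = 1\<^sub>m n" "Q * P = 1\<^sub>m n" "A = P * J * Q" .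
  from covering_families_dim[OF bound] obtain \<Psi> where "finite \<Psi> \<and> (\<forall>\<phi>\<in>\<Psi>. family E d \<phi>) \<and>
    (\<forall>W. inv_sub W \<longrightarrow> fv.dim W = d \<longrightarrow> (\<exists>\<phi>\<in>\<Psi>. \<exists>u. fv.span (\<phi> u ` {..<d}) = W))" by (rule exE)
  then have \<Psi>: "finite \<Psi>" "\<And>\<phi>. \<phi> \<in> \<Psi> \<Longrightarrow> family E d \<phi>"
    "\<And>W. inv_sub W \<Longrightarrow> fv.dim W = d \<Longrightarrow> \<exists>\<phi>\<in>\<Psi>. \<exists>u. fv.span (\<phi> u ` {..<d}) = W"
    by simp_all
  define mt where "mt \<phi> u = P * mat n d (\<lambda>(i,j). \<phi> u j (ps ! i))" for \<phi> :: "(nat \<Rightarrow> 'k) \<Rightarrow> nat \<Rightarrow> nat \<times> nat \<Rightarrow> 'k" and u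
  show ?thesis
  proof (rule krull_dim_upper_bound[of _ _ _ "mt ` \<Psi>"])
    show "fixed_grass n d A \<subseteq> Grass n d" unfolding fixed_grass_def by blast
    show "finite (mt ` \<Psi>)" using \<Psi>(1) by simp
    show "\<phi> u \<in> carrier_mat n d" if "\<phi> \<in> mt ` \<Psi>" for \<phi> u using that A(2) unfolding mt_def by auto
    show "(\<lambda>u. \<phi> u $$ (i,j)) \<in> parpoly E" if \<phi>: "\<phi> \<in> mt ` \<Psi>" and ij: "i < n" "j < d" for \<phi> i j
    proof -
      obtain \<phi>0 where f: "\<phi>0 \<in> \<Psi>" "\<phi> = mt \<phi>0" using \<phi> by blast
      have "(\<lambda>u. \<phi> u $$ (i,j)) = (\<lambda>u. \<Sum>k<n. P $$ (i,k) * \<phi>0 u j (ps ! k))"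
        unfolding f(2) mt_def using ij A(2) by (auto simp: scalar_prod_def lessThan_atLeast0)
      also have "\<dots> \<in> parpoly E"
        using \<Psi>(2)[OF f(1)] ij(2) unfolding family_def by (intro parpoly_sum parpoly.mult parpoly.const) blast
      finally show ?thesis .
    qed
    fix W assume W: "W \<in> fixed_grass n d A"
    then obtain M where M: "M \<in> stiefel n d" "W = mat_range M" unfolding fixed_grass_def Grass_eq by blast
    have Mc: "M \<in> carrier_mat n d" "inj_mat M" using M(1) by (auto simp: stiefel_eq)
    have AW: "A *\<^sub>v y \<in> mat_range M" if "y \<in> mat_range M" for y using W M(2) that unfolding fixed_grass_def by blast
    define N where "N = Q * M"
    have N: "N \<in> carrier_mat n d" unfolding N_def using A(3) Mc(1) by simp
    have PN: "P * N = M" unfolding N_def using assoc_mult_mat[OF A(2,3) Mc(1)] A(4) Mc(1) by simp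
    have "\<exists>v \<in> carrier_vec d. A *\<^sub>v col M j = M *\<^sub>v v" if j: "j < d" for j
    proof -
      have "col M j \<in> mat_range M" unfolding mat_unit_vec_col[OF Mc(1) j, symmetric] mat_range_def using Mc(1) by auto
      from AW[OF this] show ?thesis unfolding mat_range_def using Mc(1) by auto
    qed
    then obtain cv where cv: "\<And>j. j < d \<Longrightarrow> cv j \<in> carrier_vec d" "\<And>j. j < d \<Longrightarrow> A *\<^sub>v col M j = M *\<^sub>v cv j" by metis
    define ip where "ip = the_inv_into {..<n} (nth ps)"
    have ip: "ip (ps ! i) = i" if "i < n" for i
      unfolding ip_def using bij_betw_nth[OF ps(1) refl refl] ps(3) that
      by (intro the_inv_into_f_f) (auto simp: bij_betw_def)
    define g where "g j p = (if p \<in> young m then N $$ (ip p, j) else 0)" for j p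
    have gV: "g j \<in> V" for j unfolding g_def supp_in_def by simp
    have gp: "g j (ps ! i) = N $$ (i,j)" if "i < n" for i j
      using that ip ps(2,3) nth_mem[of i ps] by (simp add: g_def)
    have Ng: "N = mat n d (\<lambda>(i,j). g j (ps ! i))" using N gp by (intro eq_matI) auto
    have colg: "col N j = vec (length ps) (\<lambda>i. g j (ps ! i))" if "j < d" for j
      using N that gp ps(3) by (intro eq_vecI) auto
    have QA: "Q * A = J * Q"
    proof -
      have "Q * A = Q * (P * (J * Q))" unfolding A(6) using assoc_mult_mat[OF A(2) J A(3)] by simp
      also have "\<dots> = (Q * P) * (J * Q)" using A(2,3) J by (intro assoc_mult_mat[symmetric]) auto
      finally show ?thesis using A(3,5) J by simp
    qed
    have jopg: "jop c (g j) = (\<Sum>k<d. fscale (cv j $ k) (g k))" if j: "j < d" for j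
    proof
      fix p
      show "jop c (g j) p = (\<Sum>k<d. fscale (cv j $ k) (g k)) p"
      proof (cases "p \<in> young m")
        case True
        then obtain i where i: "i < n" "p = ps ! i" using ps(2,3) by (metis in_set_conv_nth)
        have "jop c (g j) p = (J *\<^sub>v col N j) $ i"
          unfolding colg[OF j] J_def jmat_mult_vec[OF ps(1,2) gV] using i ps(3) by simp
        also have "J *\<^sub>v col N j = J *\<^sub>v (Q *\<^sub>v col M j)" unfolding N_def using col_mult2[OF A(3) Mc(1) j] by simp
        also have "\<dots> = (J * Q) *\<^sub>v col M j" using J A(3) Mc(1) by (intro assoc_mult_mat_vec[symmetric]) auto
        also have "\<dots> = Q *\<^sub>v (A *\<^sub>v col M j)" unfolding QA[symmetric] using A(1,3) Mc(1) by (intro assoc_mult_mat_vec) auto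
        also have "\<dots> = N *\<^sub>v cv j" unfolding cv(2)[OF j] N_def using A(3) Mc(1) cv(1)[OF j] by (intro assoc_mult_mat_vec[symmetric]) auto
        also have "(N *\<^sub>v cv j) $ i = (\<Sum>k<d. N $$ (i,k) * cv j $ k)"
          using i(1) N cv(1)[OF j] by (simp add: scalar_prod_def lessThan_atLeast0)
        also have "\<dots> = (\<Sum>k<d. fscale (cv j $ k) (g k)) p"
          unfolding i(2) fun_sum_apply using i(1) by (simp add: gp fscale_apply mult.commute)
        finally show ?thesis .
      next
        case False
        have "jop c (g j) p = 0"
          using False jop_jshift[of c "g j" p 0] V_jshift[OF gV[of j], of 0] gV[of j] by (cases p) (auto simp: supp_in_def)
        moreover have "(\<Sum>k<d. fscale (cv j $ k) (g k)) p = 0"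
          unfolding fun_sum_apply using False by (simp add: fscale_apply g_def)
        ultimately show ?thesis by simp
      qed
    qed
    let ?W = "fv.span (g ` {..<d})"
    have inv: "jshift c i f \<in> ?W" if f: "f \<in> ?W" for i f
    proof -
      have "jshift c i ` g ` {..<d} \<subseteq> ?W"
        unfolding image_image
      proof (rule image_subsetI)
        fix j assume j: "j \<in> {..<d}"
        have "jshift c i (g j) = (\<Sum>k<d. fscale (cv j $ k) (g k)) - fscale (c i) (g j)"
        proof
          fix p
          have "jop c (g j) p = (\<Sum>k<d. fscale (cv j $ k) (g k)) p" using jopg[of j] j by simp
          then show "jshift c i (g j) p = ((\<Sum>k<d. fscale (cv j $ k) (g k)) - fscale (c i) (g j)) p"
            using jop_jshift[of c "g j" p i] by (simp add: fscale_apply eq_diff_eq add.commute)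
        qed
        also have "\<dots> \<in> ?W" using j by (intro fv.span_diff fv.span_sum fv.span_scale fv.span_base) auto
        finally show "jshift c i (g j) \<in> ?W" .
      qed
      then have "fv.span (jshift c i ` g ` {..<d}) \<subseteq> ?W" by (rule fv.span_minimal) (rule fv.subspace_span)
      moreover have "jshift c i f \<in> fv.span (jshift c i ` g ` {..<d})"
        using f fvp.linear_span_image[OF jshift_linear[of c i], of "g ` {..<d}"] by blast
      ultimately show ?thesis by blast
    qed
    have "?W \<subseteq> V" by (rule fv.span_minimal[OF _ V_subspace]) (use gV in auto)
    then have isub: "inv_sub ?W" unfolding inv_sub_def using inv fv.subspace_span by blast
    have "fv.dim ?W = d"
    proof (rule fv.dim_independent_family)
      fix a j assume z: "(\<Sum>j<d. fscale (a j) (g j)) = 0" and j: "j < d"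
      have "N *\<^sub>v vec d a = 0\<^sub>v n"
      proof (rule eq_vecI)
        fix i assume "i < dim_vec (0\<^sub>v n)"
        then have i: "i < n" by simp
        have "(N *\<^sub>v vec d a) $ i = (\<Sum>k<d. a k * g k (ps ! i))"
          using i N gp by (simp add: scalar_prod_def lessThan_atLeast0 mult.commute)
        also have "\<dots> = (\<Sum>j<d. fscale (a j) (g j)) (ps ! i)" by (simp add: fun_sum_apply fscale_apply)
        also have "\<dots> = 0" unfolding z by simp
        finally show "(N *\<^sub>v vec d a) $ i = 0\<^sub>v n $ i" using i by simp
      qed (use N in simp)
      then have "P *\<^sub>v (N *\<^sub>v vec d a) = 0\<^sub>v n" using A(2) by auto
      moreover have "P *\<^sub>v (N *\<^sub>v vec d a) = M *\<^sub>v vec d a"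
        unfolding PN[symmetric] using A(2) N by (intro assoc_mult_mat_vec[symmetric]) auto
      ultimately have "vec d a = 0\<^sub>v d" using inj_matD[OF Mc(2,1)] by simp
      then have "vec d a $ j = 0" using j by simp
      then show "a j = 0" using j by simp
    qed
    from \<Psi>(3)[OF isub this] obtain \<phi> u where \<phi>: "\<phi> \<in> \<Psi>" "fv.span (\<phi> u ` {..<d}) = ?W" by blast
    have "mat_range (mat n d (\<lambda>(i,j). \<phi> u j (ps ! i))) = mat_range N"
      unfolding mat_range_span[OF ps(1,3)] \<phi>(2) by (subst Ng) (simp only: mat_range_span[OF ps(1,3)])
    then have "mat_range (mt \<phi> u) = mat_range (P * N)"
      unfolding mt_def using mat_range_mult[OF A(2) N] mat_range_mult[OF A(2), of "mat n d (\<lambda>(i,j). \<phi> u j (ps ! i))" d] by simp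
    then have "mat_range (mt \<phi> u) = W" unfolding PN M(2) .
    then show "\<exists>\<phi>\<in>mt ` \<Psi>. \<exists>u. mat_range (\<phi> u) = W" using \<phi>(1) by blast
  qed
qed

section \<open>The dimension of the space of invariant subspaces\<close>

definition dim_seqs :: "(nat \<Rightarrow> nat) \<Rightarrow> nat \<Rightarrow> nat \<Rightarrow> (nat \<Rightarrow> nat) set" where
  "dim_seqs m K d = {dd. (\<forall>h. dd h \<le> m h) \<and> (\<Sum>h<K. dd h) = d}"

text \<open>The dimension of the product over \<open>h < K\<close> of the Grassmannians of
  \<open>dd h\<close>-dimensional subspaces of an \<open>m h\<close>-dimensional space.\<close>

definition grass_dim :: "(nat \<Rightarrow> nat) \<Rightarrow> nat \<Rightarrow> (nat \<Rightarrow> nat) \<Rightarrow> nat" where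
  "grass_dim m K dd = (\<Sum>h<K. dd h * (m h - dd h))"

lemma dim_seqs_finite:
  assumes "\<And>h. h \<ge> K \<Longrightarrow> m h = 0" shows "finite (dim_seqs m K d)"
proof -
  have "inj_on (\<lambda>dd. restrict dd {..<K}) (dim_seqs m K d)"
  proof (rule inj_onI, rule ext)
    fix x y h assume xy: "x \<in> dim_seqs m K d" "y \<in> dim_seqs m K d" "restrict x {..<K} = restrict y {..<K}"
    show "x h = y h"
    proof (cases "h < K")
      case True
      then show ?thesis using xy(3) by (metis lessThan_iff restrict_apply')
    next
      case False
      then have "m h = 0" using assms by simp
      moreover have "x h \<le> m h" "y h \<le> m h" using xy(1,2) by (auto simp: dim_seqs_def)
      ultimately show ?thesis by simp
    qed
  qed
  moreover have "(\<lambda>dd. restrict dd {..<K}) ` dim_seqs m K d \<subseteq> PiE {..<K} (\<lambda>h. {..m h})"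
  proof (rule image_subsetI)
    fix dd assume "dd \<in> dim_seqs m K d"
    then show "restrict dd {..<K} \<in> PiE {..<K} (\<lambda>h. {..m h})" by (simp add: dim_seqs_def)
  qed
  moreover have "finite (PiE {..<K} (\<lambda>h. {..m h}))" by (intro finite_PiE) auto
  ultimately show ?thesis by (meson finite_imageD finite_subset)
qed

lemma dim_seqs_nonempty:
  assumes "d \<le> (\<Sum>h<K. m h)" shows "dim_seqs m K d \<noteq> {}"
proof -
  have "\<exists>dd. (\<forall>h. dd h \<le> m h) \<and> (\<Sum>h<K. dd h) = d"
    using assms
  proof (induction K arbitrary: d)
    case 0
    then show ?case by (intro exI[of _ "\<lambda>_. 0"]) simp
  next
    case (Suc K)
    define x where "x = min d (m K)"
    have "d - x \<le> (\<Sum>h<K. m h)" using Suc.prems unfolding x_def by auto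
    from Suc.IH[OF this] obtain dd where dd: "\<forall>h. dd h \<le> m h" "(\<Sum>h<K. dd h) = d - x" by blast
    have "(\<Sum>h<K. (dd(K := x)) h) = (\<Sum>h<K. dd h)" by (intro sum.cong) auto
    then have "(\<Sum>h<Suc K. (dd(K := x)) h) = d" using dd(2) unfolding x_def by simp
    moreover have "\<forall>h. (dd(K := x)) h \<le> m h" using dd(1) unfolding x_def by simp
    ultimately show ?case by blast
  qed
  then show ?thesis unfolding dim_seqs_def by blast
qed

text \<open>Swapping an ascent of \<open>dd\<close> does not decrease the dimension, since \<open>m\<close> is decreasing;
  hence a maximiser that also minimises \<open>\<Sum>h. h * dd h\<close> is decreasing.\<close>
lemma antimono_maximizer:
  assumes m: "antimono m" "\<And>h. h \<ge> K \<Longrightarrow> m h = 0" and ne: "d \<le> (\<Sum>h<K. m h)"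
  shows "\<exists>dd\<in>dim_seqs m K d. antimono dd \<and> (\<forall>x\<in>dim_seqs m K d. grass_dim m K x \<le> grass_dim m K dd)"
proof -
  let ?D = "dim_seqs m K d"
  have fin: "finite ?D" by (rule dim_seqs_finite[OF m(2)])
  have ne: "?D \<noteq> {}" by (rule dim_seqs_nonempty[OF ne])
  define E where "E = Max (grass_dim m K ` ?D)"
  have Emax: "grass_dim m K x \<le> E" if "x \<in> ?D" for x unfolding E_def using fin that by simp
  have "E \<in> grass_dim m K ` ?D" unfolding E_def using fin ne by (intro Max_in) auto
  then obtain d0 where d0: "d0 \<in> ?D" "grass_dim m K d0 = E" by auto
  define wt where "wt dd = (\<Sum>h<K. h * dd h)" for dd :: "nat \<Rightarrow> nat"
  obtain dd where dd: "dd \<in> ?D" "grass_dim m K dd = E"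
    and least: "\<And>x. x \<in> ?D \<Longrightarrow> grass_dim m K x = E \<Longrightarrow> wt dd \<le> wt x"
    using ex_has_least_nat[of "\<lambda>x. x \<in> ?D \<and> grass_dim m K x = E" d0 wt] d0 by blast
  have ddm: "dd h \<le> m h" for h using dd(1) by (simp add: dim_seqs_def)
  have "dd (Suc h) \<le> dd h" for h
  proof (rule ccontr)
    assume "\<not> dd (Suc h) \<le> dd h"
    then have asc: "dd h < dd (Suc h)" by simp
    have hK: "Suc h < K"
    proof (rule ccontr)
      assume "\<not> Suc h < K"
      then have "m (Suc h) = 0" using m(2) by simp
      then show False using asc ddm[of "Suc h"] by simp
    qed
    have mm: "m (Suc h) \<le> m h" using m(1) by (simp add: antimonoD)
    define x where "x = dd(h := dd (Suc h), Suc h := dd h)"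
    have split: "(\<Sum>i<K. f i) = f h + f (Suc h) + (\<Sum>i\<in>{..<K} - {h, Suc h}. f i)" for f :: "nat \<Rightarrow> nat"
    proof -
      have "{..<K} = {h, Suc h} \<union> ({..<K} - {h, Suc h})" using hK by auto
      then have "(\<Sum>i<K. f i) = (\<Sum>i\<in>{h, Suc h}. f i) + (\<Sum>i\<in>{..<K} - {h, Suc h}. f i)"
        by (metis Diff_disjoint finite.emptyI finite.insertI finite_Diff finite_lessThan sum.union_disjoint)
      then show ?thesis by simp
    qed
    have rest: "(\<Sum>i\<in>{..<K} - {h, Suc h}. f i (x i)) = (\<Sum>i\<in>{..<K} - {h, Suc h}. f i (dd i))" for f :: "nat \<Rightarrow> nat \<Rightarrow> nat"
      by (intro sum.cong) (auto simp: x_def)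
    have xh: "x h = dd (Suc h)" "x (Suc h) = dd h" by (auto simp: x_def)
    have xm: "x i \<le> m i" for i
    proof -
      have "dd (Suc h) \<le> m h" "dd h \<le> m (Suc h)" using ddm[of "Suc h"] mm asc by auto
      then show ?thesis using ddm[of i] by (auto simp: x_def)
    qed
    have "(\<Sum>i<K. x i) = (\<Sum>i<K. dd i)" using rest[of "\<lambda>i y. y"] split[of x] split[of dd] xh by simp
    then have xD: "x \<in> ?D" using xm dd(1) by (simp add: dim_seqs_def)
    have ge: "dd h * (m h - dd h) + dd (Suc h) * (m (Suc h) - dd (Suc h))
        \<le> dd (Suc h) * (m h - dd (Suc h)) + dd h * (m (Suc h) - dd h)"
    proof -
      define a where "a = dd (Suc h) - dd h"
      define b where "b = m (Suc h) - dd (Suc h)"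
      define k where "k = m h - m (Suc h)"
      have eqs: "dd (Suc h) = dd h + a" "m (Suc h) = dd h + a + b" "m h = dd h + a + b + k"
        using asc ddm[of "Suc h"] mm unfolding a_def b_def k_def by auto
      \<comment> \<open>The right side exceeds the left by \<open>a * k\<close>, the ascent of
        \<open>dd\<close> times the descent of \<open>m\<close>.\<close>
      show ?thesis unfolding eqs by (simp add: algebra_simps)
    qed
    have "grass_dim m K x \<ge> grass_dim m K dd"
      unfolding grass_dim_def split[of "\<lambda>i. x i * (m i - x i)"] split[of "\<lambda>i. dd i * (m i - dd i)"]
        rest[of "\<lambda>i y. y * (m i - y)"] xh using ge by simp
    then have "grass_dim m K x = E" using Emax[OF xD] dd(2) by simp
    then have "wt dd \<le> wt x" by (rule least[OF xD])
    then have "h * dd h + Suc h * dd (Suc h) \<le> h * dd (Suc h) + Suc h * dd h"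
      unfolding wt_def split[of "\<lambda>i. i * x i"] split[of "\<lambda>i. i * dd i"] rest[of "\<lambda>i y. i * y"] xh by simp
    then show False using asc by simp
  qed
  then have "antimono dd" by (rule decseq_SucI)
  then show ?thesis using dd Emax by blast
qed

text \<open>Upper and lower bound are the same number, computed from \<open>m\<close> and
  \<open>d\<close>; neither \<open>c\<close> nor \<open>c'\<close> enters it.\<close>

theorem fixed_grass_dim_eq:
  fixes A B :: "'k::field mat"
  assumes inf: "infinite (UNIV :: 'k set)"
    and simA: "similar_mat A (jmat c ps)" and simB: "similar_mat B (jmat c' ps)"
    and ps: "distinct ps" "set ps = young m" "length ps = n"
    and m: "antimono m" "\<And>h. h \<ge> K \<Longrightarrow> m h = 0" and d: "d \<le> n"
  shows "krull_dim (grass_closed n d) (fixed_grass n d A) = krull_dim (grass_closed n d) (fixed_grass n d B)"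
proof -
  have "n = (\<Sum>h<K. m h)" using card_young(1)[of K m] m(2) distinct_card[OF ps(1)] ps(2,3) by simp
  with d have "d \<le> (\<Sum>h<K. m h)" by simp
  from antimono_maximizer[OF m this] obtain dd where dd: "dd \<in> dim_seqs m K d" "antimono dd"
    "\<And>x. x \<in> dim_seqs m K d \<Longrightarrow> grass_dim m K x \<le> grass_dim m K dd" by blast
  have ddm: "dd h \<le> m h" "(\<Sum>h<K. dd h) = d" for h using dd(1) by (auto simp: dim_seqs_def)
  have bound: "(\<Sum>h<K. x h * (m h - x h)) \<le> grass_dim m K dd" if "\<And>h. x h \<le> m h" "(\<Sum>h<K. x h) = d" for x
    using dd(3)[of x] that by (simp add: dim_seqs_def grass_dim_def)
  have eq: "krull_dim (grass_closed n d) (fixed_grass n d C) = enat (grass_dim m K dd)"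
    if "similar_mat C (jmat c'' ps)" for C :: "'k mat" and c''
  proof (rule antisym)
    show "krull_dim (grass_closed n d) (fixed_grass n d C) \<le> enat (grass_dim m K dd)"
      by (rule fixed_grass_dim_upper[OF that ps m bound])
    show "enat (grass_dim m K dd) \<le> krull_dim (grass_closed n d) (fixed_grass n d C)"
      unfolding grass_dim_def by (rule fixed_grass_dim_lower[OF inf that ps m dd(2) ddm])
  qed
  show ?thesis using eq[OF simA] eq[OF simB] by simp
qed

section \<open>Jordan normal forms\<close>

lemma complete_to_invertible:
  fixes v :: "'k::field vec"
  assumes v: "v \<in> carrier_vec n" "v \<noteq> 0\<^sub>v n"
  shows "\<exists>P Q. P \<in> carrier_mat n n \<and> Q \<in> carrier_mat n n \<and> P * Q = 1\<^sub>m n \<and> Q * P = 1\<^sub>m n \<and> col P 0 = v"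
proof -
  have "\<exists>i<n. v $ i \<noteq> 0"
  proof (rule ccontr)
    assume "\<not> (\<exists>i<n. v $ i \<noteq> 0)"
    then have "v = 0\<^sub>v n" using v(1) by (intro eq_vecI) auto
    then show False using v(2) by simp
  qed
  then obtain i where i: "i < n" "v $ i \<noteq> 0" by blast
  \<comment> \<open>The columns after the first are the unit vectors other than the
    \<open>i\<close>-th, which \<open>v\<close> replaces because \<open>v $ i\<close> is nonzero;
    for \<open>k \<ge> 1\<close>, \<open>\<sigma>\<close> enumerates their indices.\<close>
  define \<sigma> where "\<sigma> k = (if k \<le> i then k - 1 else k)" for k :: nat
  define P where "P = mat n n (\<lambda>(r,k). if k = 0 then v $ r else if r = \<sigma> k then 1 else 0)"
  have P: "P \<in> carrier_mat n n" unfolding P_def by simp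
  have "inj_mat P"
  proof (rule inj_matI[OF P])
    fix x assume x: "x \<in> carrier_vec n" "P *\<^sub>v x = 0\<^sub>v n"
    have row: "v $ r * x $ 0 + (\<Sum>k\<in>{1..<n}. if r = \<sigma> k then x $ k else 0) = 0" if r: "r < n" for r
    proof -
      have "(P *\<^sub>v x) $ r = (\<Sum>k\<in>{0..<n}. (if k = 0 then v $ r else if r = \<sigma> k then 1 else 0) * x $ k)"
        using r x(1) by (simp add: P_def scalar_prod_def)
      also have "\<dots> = v $ r * x $ 0 + (\<Sum>k\<in>{1..<n}. (if k = 0 then v $ r else if r = \<sigma> k then 1 else 0) * x $ k)"
        using i(1) by (subst sum.atLeast_Suc_lessThan) auto
      also have "(\<Sum>k\<in>{1..<n}. (if k = 0 then v $ r else if r = \<sigma> k then 1 else 0) * x $ k)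
          = (\<Sum>k\<in>{1..<n}. if r = \<sigma> k then x $ k else 0)"
        by (intro sum.cong) auto
      finally show ?thesis using x(2) r by simp
    qed
    have "(\<Sum>k\<in>{1..<n}. if i = \<sigma> k then x $ k else 0) = 0"
      by (intro sum.neutral) (auto simp: \<sigma>_def split: if_splits)
    then have x0: "x $ 0 = 0" using row[OF i(1)] i(2) by simp
    have "x $ k = 0" if k: "k < n" for k
    proof (cases "k = 0")
      case False
      have "(\<Sum>k'\<in>{1..<n}. if \<sigma> k = \<sigma> k' then x $ k' else 0) = (\<Sum>k'\<in>{1..<n}. if k' = k then x $ k' else 0)"
        using False i(1) k by (intro sum.cong refl) (auto simp: \<sigma>_def split: if_splits)
      also have "\<dots> = x $ k" using False k by simp
      finally show ?thesis using row[of "\<sigma> k"] x0 k i(1) by (auto simp: \<sigma>_def split: if_splits)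
    qed (simp add: x0)
    then show "x = 0\<^sub>v n" using x(1) by (intro eq_vecI) auto
  qed
  then obtain Q where Q: "Q \<in> carrier_mat n n" "Q * P = 1\<^sub>m n" using inj_mat_left_inverse[OF P] by blast
  have "P * Q = 1\<^sub>m n" by (rule mat_mult_left_right_inverse[OF Q(1) P Q(2)])
  moreover have "col P 0 = v" using v(1) i(1) by (intro eq_vecI) (auto simp: P_def)
  ultimately show ?thesis using P Q by blast
qed

text \<open>Deflation: an eigenvector as first basis vector leaves a block of size \<open>n\<close>,
  to which the induction applies. The row to its right may change, which does not affect
  triangularity.\<close>

lemma triangularizable:
  fixes A :: "'k::field mat"
  assumes alg: "alg_closed_field TYPE('k)" and "A \<in> carrier_mat n n"
  shows "\<exists>U \<in> carrier_mat n n. upper_triangular U \<and> similar_mat A U"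
  using assms(2)
proof (induction n arbitrary: A)
  case 0
  then have "upper_triangular A" "similar_mat A A" by (auto intro: similar_mat_refl)
  then show ?case using 0 by blast
next
  case (Suc n)
  note A = Suc.prems
  have "degree (char_poly A) \<noteq> 0" using degree_monic_char_poly[OF A] by simp
  then obtain a where "poly (char_poly A) a = 0" using alg unfolding alg_closed_field_def by blast
  then have "eigenvalue A a" using eigenvalue_root_char_poly[OF A] by simp
  then obtain v where v: "v \<in> carrier_vec (Suc n)" "v \<noteq> 0\<^sub>v (Suc n)" "A *\<^sub>v v = a \<cdot>\<^sub>v v"
    using A unfolding eigenvalue_def eigenvector_def by auto
  from complete_to_invertible[OF v(1,2)] obtain P Q where
    P: "P \<in> carrier_mat (Suc n) (Suc n)" and Q: "Q \<in> carrier_mat (Suc n) (Suc n)"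
    and PQ: "P * Q = 1\<^sub>m (Suc n)" "Q * P = 1\<^sub>m (Suc n)" and col: "col P 0 = v" by blast
  define B where "B = Q * A * P"
  have B: "B \<in> carrier_mat (Suc n) (Suc n)" unfolding B_def using A P Q by simp
  have simAB: "similar_mat A B"
  proof -
    have QA: "Q * A \<in> carrier_mat (Suc n) (Suc n)" using Q A by simp
    have "P * B * Q = P * (B * Q)" by (rule assoc_mult_mat[OF P B Q])
    also have "B * Q = Q * A * (P * Q)" unfolding B_def by (rule assoc_mult_mat[OF QA P Q])
    also have "\<dots> = Q * A" unfolding PQ(1) by (rule right_mult_one_mat[OF QA])
    also have "P * (Q * A) = A" using assoc_mult_mat[OF P Q A] PQ(1) A by simp
    finally show ?thesis using A B P Q PQ by (intro similar_matI[of A B P Q "Suc n"]) auto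
  qed
  have colB: "col B 0 = a \<cdot>\<^sub>v unit_vec (Suc n) 0"
  proof -
    have QA: "Q * A \<in> carrier_mat (Suc n) (Suc n)" using Q A by simp
    have "col B 0 = (Q * A) *\<^sub>v v" unfolding B_def using col_mult2[OF QA P, of 0] col by simp
    also have "\<dots> = Q *\<^sub>v (a \<cdot>\<^sub>v v)" unfolding v(3)[symmetric] by (rule assoc_mult_mat_vec[OF Q A v(1)])
    also have "\<dots> = a \<cdot>\<^sub>v (Q *\<^sub>v v)" by (rule mult_mat_vec[OF Q v(1)])
    also have "Q *\<^sub>v v = col (Q * P) 0" unfolding col[symmetric] using col_mult2[OF Q P, of 0] by simp
    finally show ?thesis unfolding PQ(2) by simp
  qed
  obtain B1 B2 B3 B4 where spl: "split_block B 1 1 = (B1,B2,B3,B4)" by (metis prod_cases4)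
  from split_block[OF spl, of n n] B have Bs: "B1 \<in> carrier_mat 1 1" "B2 \<in> carrier_mat 1 n"
    "B3 \<in> carrier_mat n 1" "B4 \<in> carrier_mat n n" "B = four_block_mat B1 B2 B3 B4" by auto
  have "B3 = 0\<^sub>m n 1"
  proof (rule eq_matI)
    fix i j assume "i < dim_row (0\<^sub>m n 1 :: 'k mat)" "j < dim_col (0\<^sub>m n 1 :: 'k mat)"
    then have ij: "i < n" "j = 0" by auto
    have "B $$ (Suc i, 0) = B3 $$ (i,0)" unfolding Bs(5) using Bs(1-4) ij by simp
    moreover have "B $$ (Suc i, 0) = col B 0 $ Suc i" using B ij by simp
    ultimately show "B3 $$ (i,j) = 0\<^sub>m n 1 $$ (i,j)" using colB ij by simp
  qed (use Bs in auto)
  with Bs have Beq: "B = four_block_mat B1 B2 (0\<^sub>m n 1) B4" by simp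
  from Suc.IH[OF Bs(4)] obtain U where U: "U \<in> carrier_mat n n" "upper_triangular U" "similar_mat B4 U" by blast
  from similar_mat_four_block_0_ex[OF similar_mat_refl[OF Bs(1)] U(3) Bs(2,1,4)] obtain B0 where
    B0: "B0 \<in> carrier_mat 1 n" "similar_mat B (four_block_mat B1 B0 (0\<^sub>m n 1) U)" unfolding Beq by blast
  have "upper_triangular (four_block_mat B1 B0 (0\<^sub>m n 1) U)"
  proof (rule upper_triangularI)
    fix i j assume ji: "j < i" and i: "i < dim_row (four_block_mat B1 B0 (0\<^sub>m n 1) U)"
    then obtain i' where i': "i = Suc i'" "i' < n" using Bs(1) U(1) by (cases i) auto
    show "four_block_mat B1 B0 (0\<^sub>m n 1) U $$ (i,j) = 0"
      using Bs(1) U(1) B0(1) i' ji upper_triangularD[OF U(2), of "j - 1" i'] by (cases j) auto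
  qed
  moreover have "four_block_mat B1 B0 (0\<^sub>m n 1) U \<in> carrier_mat (Suc n) (Suc n)"
    using Bs(1) U(1) four_block_carrier_mat[of B1 1 1 U n n B0 "0\<^sub>m n 1"] by simp
  ultimately show ?case using similar_mat_trans[OF simAB B0(2)] by blast
qed

lemma jordan_nf_exists_alg_closed:
  fixes A :: "'k::field mat"
  assumes "alg_closed_field TYPE('k)" and A: "A \<in> carrier_mat n n"
  shows "\<exists>n_as. jordan_nf A n_as"
proof -
  obtain U where U: "U \<in> carrier_mat n n" "upper_triangular U" "similar_mat A U" using triangularizable[OF assms] by blast
  have "jordan_nf U (triangular_to_jnf_vector U)" by (rule triangular_to_jnf_vector[OF U(1,2)])
  then show ?thesis using similar_mat_trans[OF U(3)] unfolding jordan_nf_def by blast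
qed

section \<open>Jordan forms up to the order of blocks\<close>

lemma jordan_nf_similar: "similar_mat A B \<Longrightarrow> jordan_nf B n_as \<Longrightarrow> jordan_nf A n_as"
  unfolding jordan_nf_def using similar_mat_trans by blast

lemma similar_swap_blocks:
  fixes A B :: "'k::field mat"
  assumes A: "A \<in> carrier_mat n n" and B: "B \<in> carrier_mat k k"
  shows "similar_mat (four_block_mat A (0\<^sub>m n k) (0\<^sub>m k n) B) (four_block_mat B (0\<^sub>m k n) (0\<^sub>m n k) A)"
proof -
  let ?P = "four_block_mat (0\<^sub>m n k) (1\<^sub>m n) (1\<^sub>m k) (0\<^sub>m k n) :: 'k mat"
  let ?Q = "four_block_mat (0\<^sub>m k n) (1\<^sub>m k) (1\<^sub>m n) (0\<^sub>m n k) :: 'k mat"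
  let ?M = "four_block_mat A (0\<^sub>m n k) (0\<^sub>m k n) B" and ?N = "four_block_mat B (0\<^sub>m k n) (0\<^sub>m n k) A"
  have P: "?P \<in> carrier_mat (n + k) (n + k)" and Q: "?Q \<in> carrier_mat (n + k) (n + k)"
    and M: "?M \<in> carrier_mat (n + k) (n + k)" and N: "?N \<in> carrier_mat (n + k) (n + k)"
    using A B by (auto simp: add.commute)
  have "?P * ?Q = four_block_mat (1\<^sub>m n) (0\<^sub>m n k) (0\<^sub>m k n) (1\<^sub>m k)"
    by (subst mult_four_block_mat[where ?n1.0=k and ?n2.0=n]) auto
  also have "\<dots> = 1\<^sub>m (n + k)" by (intro eq_matI) auto
  finally have PQ: "?P * ?Q = 1\<^sub>m (n + k)" .
  have QP: "?Q * ?P = 1\<^sub>m (n + k)" by (rule mat_mult_left_right_inverse[OF P Q PQ])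
  have PN: "?P * ?N = four_block_mat (0\<^sub>m n k) A B (0\<^sub>m k n)"
    using A B by (subst mult_four_block_mat[where ?n1.0=k and ?n2.0=n]) auto
  have "?P * ?N * ?Q = ?M" unfolding PN using A B
    by (subst mult_four_block_mat[where ?n1.0=k and ?n2.0=n]) auto
  then show ?thesis using P Q M N PQ QP by (intro similar_matI[of ?M ?N ?P ?Q "n + k"]) auto
qed

lemma jordan_matrix_append:
  "jordan_matrix (xs @ ys) = four_block_mat (jordan_matrix xs) (0\<^sub>m (sum_list (map fst xs)) (sum_list (map fst ys)))
     (0\<^sub>m (sum_list (map fst ys)) (sum_list (map fst xs))) (jordan_matrix ys)"
proof -
  have "jordan_matrix (xs @ ys) = (let A = jordan_matrix xs; B = jordan_matrix ys
    in four_block_mat A (0\<^sub>m (dim_row A) (dim_col B)) (0\<^sub>m (dim_row B) (dim_col A)) B)"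
    unfolding jordan_matrix_def map_append diag_block_mat_append ..
  then show ?thesis by (simp add: Let_def)
qed

lemma jordan_matrix_perm_similar:
  fixes xs ys :: "(nat \<times> 'k::field) list"
  assumes "mset xs = mset ys" shows "similar_mat (jordan_matrix xs) (jordan_matrix ys)"
  using assms
proof (induction xs arbitrary: ys)
  case Nil
  then show ?case by (auto intro!: similar_mat_refl[OF jordan_matrix_carrier])
next
  case (Cons x xs)
  then have "x \<in> set ys" by (metis list.set_intros(1) mset_eq_setD)
  then obtain us vs where ys: "ys = us @ x # vs" by (meson split_list)
  have swap: "similar_mat (jordan_matrix (as @ bs)) (jordan_matrix (bs @ as))" for as bs :: "(nat \<times> 'k) list"
    unfolding jordan_matrix_append by (rule similar_swap_blocks) (rule jordan_matrix_carrier)+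
  have "mset xs = mset (vs @ us)" using Cons.prems ys by simp
  then have "similar_mat (jordan_matrix xs) (jordan_matrix (vs @ us))" by (rule Cons.IH)
  moreover have "sum_list (map fst xs) = sum_list (map fst (vs @ us))"
    using \<open>mset xs = mset (vs @ us)\<close> by (metis mset_map sum_mset_sum_list)
  ultimately have "similar_mat (jordan_matrix ([x] @ xs)) (jordan_matrix ([x] @ (vs @ us)))"
    unfolding jordan_matrix_append[of "[x]"]
    using similar_mat_four_block_0_0[OF similar_mat_refl[OF jordan_matrix_carrier] _ jordan_matrix_carrier jordan_matrix_carrier, of xs "jordan_matrix (vs @ us)" "[x]"]
    by simp
  moreover have "similar_mat (jordan_matrix (([x] @ vs) @ us)) (jordan_matrix (us @ ([x] @ vs)))" by (rule swap)
  ultimately show ?case unfolding ys using similar_mat_trans by fastforce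
qed

lemma jordan_nf_perm:
  fixes A :: "'k::field mat"
  assumes "jordan_nf A xs" "mset xs = mset ys" shows "jordan_nf A ys"
  using assms jordan_matrix_perm_similar[OF assms(2)] similar_mat_trans mset_eq_setD[OF assms(2)]
  unfolding jordan_nf_def by metis

lemma jordan_nf_mset_unique:
  fixes A :: "'k::field mat"
  assumes "jordan_nf A xs" "jordan_nf A ys" shows "mset xs = mset ys"
proof (rule multiset_eqI)
  fix p :: "nat \<times> 'k"
  obtain k a where p: "p = (k,a)" by fastforce
  have cnt: "count (mset zs) p = length (filter ((=) p) zs)" for zs by (induction zs) auto
  show "count (mset xs) p = count (mset ys) p"
  proof (cases "k = 0")
    case True
    have "p \<notin> set xs" "p \<notin> set ys" using assms True p unfolding jordan_nf_def by (auto simp: image_iff)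
    then have "filter ((=) p) xs = []" "filter ((=) p) ys = []" by (auto simp: filter_empty_conv)
    then show ?thesis unfolding cnt by simp
  next
    case False
    show ?thesis unfolding cnt
      using compute_nr_of_jordan_blocks[OF assms(1) False, of a] compute_nr_of_jordan_blocks[OF assms(2) False, of a] p
      by simp
  qed
qed

text \<open>By \<open>z\<close> a kernel vector is determined by its first coordinate, so the kernel
  is at most a line.\<close>

lemma kernel_dim_le_1:
  fixes B :: "'k::field mat"
  assumes B: "B \<in> carrier_mat n n" and n: "n > 0"
    and z: "\<And>x. x \<in> carrier_vec n \<Longrightarrow> B *\<^sub>v x = 0\<^sub>v n \<Longrightarrow> x $ 0 = 0 \<Longrightarrow> x = 0\<^sub>v n"
  shows "kernel_dim B \<le> 1"
proof -
  interpret kernel n n B by unfold_locales (rule B)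
  have K: "x \<in> mat_kernel B \<longleftrightarrow> x \<in> carrier_vec n \<and> B *\<^sub>v x = 0\<^sub>v n" for x
    using mat_kernel[OF B] by auto
  have "\<exists>v\<in>mat_kernel B. \<forall>y\<in>mat_kernel B. \<exists>a. y = a \<cdot>\<^sub>v v"
  proof (cases "\<exists>v\<in>mat_kernel B. v \<noteq> 0\<^sub>v n")
    case True
    then obtain v where v: "v \<in> carrier_vec n" "B *\<^sub>v v = 0\<^sub>v n" "v \<noteq> 0\<^sub>v n" using K by blast
    have v0: "v $ 0 \<noteq> 0" using z[OF v(1,2)] v(3) by blast
    have "y = (y $ 0 / v $ 0) \<cdot>\<^sub>v v" if y: "y \<in> mat_kernel B" for y
    proof -
      have yc: "y \<in> carrier_vec n" "B *\<^sub>v y = 0\<^sub>v n" using y K by auto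
      let ?w = "y - (y $ 0 / v $ 0) \<cdot>\<^sub>v v"
      have w: "?w \<in> carrier_vec n" using yc v by simp
      have "B *\<^sub>v ?w = B *\<^sub>v y - B *\<^sub>v ((y $ 0 / v $ 0) \<cdot>\<^sub>v v)"
        using B yc v by (intro mult_minus_distrib_mat_vec) auto
      also have "B *\<^sub>v ((y $ 0 / v $ 0) \<cdot>\<^sub>v v) = (y $ 0 / v $ 0) \<cdot>\<^sub>v (B *\<^sub>v v)" by (rule mult_mat_vec[OF B v(1)])
      finally have "B *\<^sub>v ?w = 0\<^sub>v n" unfolding yc(2) v(2) by auto
      moreover have "?w $ 0 = 0" using yc v n v0 by simp
      ultimately have w0: "?w = 0\<^sub>v n" using z[OF w] by blast
      show ?thesis
      proof (rule eq_vecI)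
        fix i assume "i < dim_vec ((y $ 0 / v $ 0) \<cdot>\<^sub>v v)"
        then have i: "i < n" using v by simp
        then have "?w $ i = 0" using w0 by simp
        then show "y $ i = ((y $ 0 / v $ 0) \<cdot>\<^sub>v v) $ i" using i yc v by simp
      qed (use yc v in simp)
    qed
    then show ?thesis using v K by blast
  next
    case False
    have "0\<^sub>v n \<in> mat_kernel B" unfolding K using B by auto
    moreover have "\<forall>y\<in>mat_kernel B. y = 1 \<cdot>\<^sub>v 0\<^sub>v n" using False by simp
    ultimately show ?thesis by blast
  qed
  then obtain v where v: "v \<in> mat_kernel B" "\<And>y. y \<in> mat_kernel B \<Longrightarrow> \<exists>a. y = a \<cdot>\<^sub>v v" by blast
  have vc: "v \<in> carrier_vec n" using v(1) K by blast
  have "mat_kernel B \<subseteq> span {v}"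
  proof
    fix y assume "y \<in> mat_kernel B"
    then obtain a where y: "y = a \<cdot>\<^sub>v v" using v(2) by blast
    have "v \<in> NC.span {v}" using vc by (intro NC.span_mem) auto
    then have "y \<in> NC.span {v}" unfolding y using vc by (intro NC.smult_in_span) auto
    then show "y \<in> span {v}" using span_same[of "{v}"] v(1) by simp
  qed
  moreover have "span {v} \<subseteq> mat_kernel B" using v(1) by (intro Ker.span_is_subset2) auto
  ultimately have "gen_set {v}" by auto
  then have "dim \<le> 1" using v(1) by (intro Ker.dim_le1I) auto
  then show ?thesis by simp
qed

section \<open>The Jordan form of \<open>jmat\<close>\<close>

lemma jmat_block_index:
  assumes "i < k" "j < k"
  shows "jmat c (map (Pair b) [0..<k]) $$ (i,j) = (if i = j then c i else if Suc i = j then 1 else 0)"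
  using assms by (simp add: jmat_def jent_def)

lemma jmat_block_carrier: "jmat c (map (Pair b) [0..<k]) \<in> carrier_mat k k"
  using jmat_carrier[of c "map (Pair b) [0..<k]"] by simp

text \<open>Equation \<open>i\<close> has coefficient 1 at \<open>x $ Suc i\<close>, so the first
  coordinate determines the rest. Hence one row of the diagram has at most one Jordan block for each
  eigenvalue.\<close>

lemma jmat_block_kernel:
  fixes c :: "nat \<Rightarrow> 'k::field"
  assumes k: "k > 0"
  shows "kernel_dim (char_matrix (jmat c (map (Pair b) [0..<k])) a) \<le> 1"
proof -
  let ?B = "jmat c (map (Pair b) [0..<k])"
  let ?C = "char_matrix ?B a"
  have B: "?B \<in> carrier_mat k k" by (rule jmat_block_carrier)
  have C: "?C \<in> carrier_mat k k" using B by simp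
  have Ci: "?C $$ (i,j) = (if i = j then c i - a else if Suc i = j then 1 else 0)" if "i < k" "j < k" for i j
    using that B jmat_block_index[OF that, of c b] by (auto simp: char_matrix_def)
  show ?thesis
  proof (rule kernel_dim_le_1[OF C k])
    fix x assume x: "x \<in> carrier_vec k" "?C *\<^sub>v x = 0\<^sub>v k" "x $ 0 = 0"
    have "x $ i = 0" if "i < k" for i
      using that
    proof (induction i)
      case 0 then show ?case using x(3) by simp
    next
      case (Suc i)
      have "(?C *\<^sub>v x) $ i = (\<Sum>j\<in>{0..<k}. ?C $$ (i,j) * x $ j)"
        using Suc.prems C x(1) by (simp add: scalar_prod_def)
      also have "\<dots> = (\<Sum>j\<in>{0..<k}. (if j = i then (c i - a) * x $ j else 0) + (if j = Suc i then x $ j else 0))"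
        using Suc.prems by (intro sum.cong refl) (auto simp: Ci)
      also have "\<dots> = (c i - a) * x $ i + x $ Suc i" using Suc.prems by (simp add: sum.distrib)
      finally show ?case using x(2) Suc by simp
    qed
    then show "x = 0\<^sub>v k" using x(1) by (intro eq_vecI) auto
  qed
qed

text \<open>One block for each distinct value among \<open>c 0\<close>, ...,
  \<open>c (k - 1)\<close>, of size its multiplicity; the filter keeps first occurrences.\<close>

definition jblocks :: "(nat \<Rightarrow> 'k) \<Rightarrow> nat \<Rightarrow> (nat \<times> 'k) list" where
  "jblocks c k = map (\<lambda>h. (card {i. i < k \<and> c i = c h}, c h)) (filter (\<lambda>h. \<forall>i<h. c i \<noteq> c h) [0..<k])"

lemma set_jblocks: "(s,a) \<in> set (jblocks c k) \<longleftrightarrow> s = card {i. i < k \<and> c i = a} \<and> s > 0"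
proof
  assume "(s,a) \<in> set (jblocks c k)"
  then obtain h where "h < k" "a = c h" "s = card {i. i < k \<and> c i = c h}" by (auto simp: jblocks_def)
  then show "s = card {i. i < k \<and> c i = a} \<and> s > 0" by (auto simp: card_gt_0_iff)
next
  assume s: "s = card {i. i < k \<and> c i = a} \<and> s > 0"
  then have "{i. i < k \<and> c i = a} \<noteq> {}" by (metis card.empty less_numeral_extra(3))
  then obtain i where i: "i < k \<and> c i = a" by blast
  define h where "h = (LEAST i. i < k \<and> c i = a)"
  have h: "h < k \<and> c h = a" unfolding h_def by (rule LeastI[of _ i]) (rule i)
  have "c j \<noteq> c h" if "j < h" for j
    using not_less_Least[of j "\<lambda>i. i < k \<and> c i = a"] that h unfolding h_def[symmetric] by auto
  then show "(s,a) \<in> set (jblocks c k)" using h s by (auto simp: jblocks_def intro!: image_eqI[of _ _ h])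
qed

lemma distinct_jblocks: "distinct (jblocks c k)"
proof -
  have "inj_on (\<lambda>h. (card {i. i < k \<and> c i = c h}, c h)) (set (filter (\<lambda>h. \<forall>i<h. c i \<noteq> c h) [0..<k]))"
  proof (rule inj_onI)
    fix x y assume xy: "x \<in> set (filter (\<lambda>h. \<forall>i<h. c i \<noteq> c h) [0..<k])" "y \<in> set (filter (\<lambda>h. \<forall>i<h. c i \<noteq> c h) [0..<k])"
      "(card {i. i < k \<and> c i = c x}, c x) = (card {i. i < k \<and> c i = c y}, c y)"
    then have "\<forall>i<x. c i \<noteq> c x" "\<forall>i<y. c i \<noteq> c y" "c x = c y" by auto
    then show "x = y" by (metis linorder_neqE_nat)
  qed
  then show ?thesis unfolding jblocks_def by (simp add: distinct_map)
qed

lemma count_jblocks: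
  "count (mset (jblocks c k)) (s,a) = (if s = card {i. i < k \<and> c i = a} \<and> s > 0 then 1 else 0)"
  using distinct_count_atmost_1[of "jblocks c k"] distinct_jblocks[of c k] set_jblocks[of s a c k] by simp

text \<open>For each \<open>a\<close> the block sizes of an upper triangular matrix sum to the
  multiplicity of \<open>a\<close> on the diagonal, and the number of blocks is the dimension of an
  eigenspace, here at most 1. So there is one block, of full size.\<close>

lemma jmat_block_jordan_nf:
  fixes c :: "nat \<Rightarrow> 'k::field"
  shows "jordan_nf (jmat c (map (Pair b) [0..<k])) (jblocks c k)"
proof (cases "k = 0")
  case True
  have "jmat c (map (Pair b) [0..<k]) = jordan_matrix (jblocks c k)"
    using True by (intro eq_matI) (auto simp: jmat_def jblocks_def)
  then show ?thesis unfolding jordan_nf_def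
    using True jmat_block_carrier[of c b k] by (auto simp: jblocks_def intro: similar_mat_refl)
next
  case False
  let ?B = "jmat c (map (Pair b) [0..<k])"
  have B: "?B \<in> carrier_mat k k" by (rule jmat_block_carrier)
  have ut: "upper_triangular ?B"
  proof (rule upper_triangularI)
    fix i j assume "j < i" "i < dim_row ?B"
    then show "?B $$ (i,j) = 0" using B jmat_block_index[of i k j c b] by auto
  qed
  define ns where "ns = triangular_to_jnf_vector ?B"
  have jnf: "jordan_nf ?B ns" unfolding ns_def by (rule triangular_to_jnf_vector[OF B ut])
  have pos: "s > 0" if "(s,a) \<in> set ns" for s a using jnf that unfolding jordan_nf_def by force
  have "mset ns = mset (jblocks c k)"
  proof (rule multiset_eqI)
    fix p :: "nat \<times> 'k"
    obtain s a where p: "p = (s,a)" by fastforce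
    let ?L = "filter (\<lambda>na. snd na = a) ns"
    have "Polynomial.order a (char_poly ?B) = card {i. i < k \<and> c i = a}"
    proof -
      have "diag_mat ?B = map c [0..<k]" using B jmat_block_index[of _ k _ c b] by (auto simp: diag_mat_def)
      then have cp: "char_poly ?B = (\<Prod>a\<leftarrow>map c [0..<k]. [:- a, 1:])"
        using char_poly_upper_triangular[OF B ut] by simp
      have ord: "Polynomial.order a (\<Prod>a\<leftarrow>xs. [:- a, 1:]) = length (filter ((=) a) xs)" for xs :: "'k list"
      proof (induction xs)
        case (Cons y xs)
        have "Polynomial.order a (\<Prod>a\<leftarrow>y # xs. [:- a, 1:]) = Polynomial.order a [:- y, 1:] + Polynomial.order a (\<Prod>a\<leftarrow>xs. [:- a, 1:])"
        proof -
          have "(\<Prod>a\<leftarrow>xs. [:- a, 1:]) \<noteq> 0" by (auto simp: prod_list_zero_iff)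
          then have "[:- y, 1:] * (\<Prod>a\<leftarrow>xs. [:- a, 1:]) \<noteq> 0" by (simp only: mult_eq_0_iff) simp
          from order_mult[OF this] show ?thesis by simp
        qed
        moreover have "Polynomial.order a [:- y, 1:] = (if a = y then 1 else 0)"
          using order_linear_power[of a "- y" 1] by (simp only: power_one_right) simp
        ultimately show ?case using Cons.IH by simp
      qed simp
      have "Polynomial.order a (char_poly ?B) = length (filter ((=) a) (map c [0..<k]))" unfolding cp by (rule ord)
      also have "\<dots> = card {i. i < k \<and> c i = a}"
        unfolding filter_map length_map length_filter_conv_card
        by (intro arg_cong[of _ _ card] Collect_cong conj_cong) auto
      finally show ?thesis .
    qed
    then have sum: "sum_list (map fst ?L) = card {i. i < k \<and> c i = a}" using jordan_nf_order[OF jnf, of a] by simp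
    have "(\<Sum>n\<leftarrow>map fst [(n,e)\<leftarrow>xs. e = a]. min 1 n) = length (filter (\<lambda>na. snd na = a) xs)"
      if "\<And>s a. (s,a) \<in> set xs \<Longrightarrow> s > 0" for xs
      using that
    proof (induction xs)
      case (Cons x xs)
      obtain s e where x: "x = (s,e)" by fastforce
      have "s > 0" using Cons.prems[of s e] x by simp
      moreover have "(\<Sum>n\<leftarrow>map fst [(n,e)\<leftarrow>xs. e = a]. min 1 n) = length (filter (\<lambda>na. snd na = a) xs)"
        by (rule Cons.IH) (use Cons.prems in auto)
      ultimately show ?case by (simp add: x)
    qed simp
    then have "length ?L = dim_gen_eigenspace ?B a 1" using dim_gen_eigenspace[OF jnf, of a 1] pos by simp
    also have "\<dots> = kernel_dim (char_matrix ?B a)"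
      unfolding dim_gen_eigenspace_def using B by (simp add: left_mult_one_mat[of _ k k])
    also have "\<dots> \<le> 1" using jmat_block_kernel False by blast
    finally have len: "length ?L \<le> 1" .
    have cnt: "count (mset zs) p = count (mset (filter (\<lambda>na. snd na = a) zs)) p" for zs
      by (simp add: p)
    have "count (mset ns) p = (if s = card {i. i < k \<and> c i = a} \<and> s > 0 then 1 else 0)"
    proof (cases ?L)
      case Nil
      then have c0: "card {i. i < k \<and> c i = a} = 0" using sum by simp
      have "count (mset ns) p = 0" unfolding cnt[of ns] Nil by simp
      then show ?thesis unfolding c0 by (cases "s = 0") simp_all
    next
      case (Cons x xs)
      then have L: "?L = [x]" using len by simp
      then have "x \<in> set ns" "snd x = a" by (auto simp: filter_eq_Cons_iff)
      then have x: "x = (card {i. i < k \<and> c i = a}, a)" using L sum by (auto simp: prod_eq_iff)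
      have "fst x > 0" using \<open>x \<in> set ns\<close> pos[of "fst x" "snd x"] by simp
      then have N0: "card {i. i < k \<and> c i = a} > 0" using x by simp
      have "count (mset ns) p = (if x = p then 1 else 0)" unfolding cnt[of ns] L by simp
      moreover define Na where "Na = card {i. i < k \<and> c i = a}"
      ultimately show ?thesis using N0 unfolding x p Na_def[symmetric] by auto
    qed
    then show "count (mset ns) p = count (mset (jblocks c k)) p" unfolding p count_jblocks .
  qed
  then show ?thesis using jordan_nf_perm[OF jnf] by blast
qed

lemma jblocks_comp:
  assumes "inj_on f (c ` {..<k})"
  shows "jblocks (f \<circ> c) k = map (\<lambda>(s,a). (s, f a)) (jblocks c k)"
proof -
  have eq: "f (c i) = f (c j) \<longleftrightarrow> c i = c j" if "i < k" "j < k" for i j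
    using assms that by (auto simp: inj_on_def)
  have "filter (\<lambda>h. \<forall>i<h. (f \<circ> c) i \<noteq> (f \<circ> c) h) [0..<k] = filter (\<lambda>h. \<forall>i<h. c i \<noteq> c h) [0..<k]"
    by (rule filter_cong) (auto simp: eq)
  moreover have "card {i. i < k \<and> (f \<circ> c) i = (f \<circ> c) h} = card {i. i < k \<and> c i = c h}" if "h < k" for h
    using that eq by (intro arg_cong[of _ _ card]) auto
  ultimately show ?thesis by (auto simp: jblocks_def)
qed

definition shape :: "(nat \<Rightarrow> nat) \<Rightarrow> bool" where
  "shape m \<longleftrightarrow> antimono m \<and> (\<exists>K. \<forall>h\<ge>K. m h = 0)"

lemma shape_le: "shape m \<Longrightarrow> i \<le> j \<Longrightarrow> m j \<le> m i"
  unfolding shape_def by (elim conjE) (rule antimonoD)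

definition row_len :: "(nat \<Rightarrow> nat) \<Rightarrow> nat \<Rightarrow> nat" where
  "row_len m b = (LEAST h. m h \<le> b)"

lemma less_row_len:
  assumes m: "shape m"
  shows "h < row_len m b \<longleftrightarrow> b < m h"
proof
  assume "h < row_len m b"
  then show "b < m h" unfolding row_len_def using not_less_Least by (metis not_le)
next
  assume b: "b < m h"
  show "h < row_len m b"
  proof (rule ccontr)
    assume "\<not> h < row_len m b"
    then have "m h \<le> m (row_len m b)" using shape_le[OF m] by simp
    moreover obtain K where "m K = 0" using m unfolding shape_def by blast
    then have "m (row_len m b) \<le> b" unfolding row_len_def by (intro LeastI[of "\<lambda>h. m h \<le> b" K]) simp
    ultimately show False using b by simp
  qed
qed

text \<open>Boxes are listed row by row, so that \<open>jmat\<close> becomes block diagonal with one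
  bidiagonal block per row.\<close>

definition young_list :: "(nat \<Rightarrow> nat) \<Rightarrow> (nat \<times> nat) list" where
  "young_list m = concat (map (\<lambda>b. map (Pair b) [0..<row_len m b]) [0..<m 0])"

lemma young_list:
  assumes m: "shape m"
  shows "distinct (young_list m)" "set (young_list m) = young m"
proof -
  have "distinct (concat (map (\<lambda>b. map (Pair b) [0..<r b]) bs))" if "distinct bs" for r :: "nat \<Rightarrow> nat" and bs :: "nat list"
    using that by (induction bs) (auto simp: distinct_map inj_on_def)
  then show "distinct (young_list m)" unfolding young_list_def by simp
  have "b < m 0" if "b < m h" for b h using that shape_le[OF m, of 0 h] by simp
  then show "set (young_list m) = young m"
    using less_row_len[OF m] by (auto simp: young_list_def young_def image_iff)
qed

lemma jmat_append:
  assumes disj: "fst ` set ps \<inter> fst ` set qs = {}"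
  shows "jmat c (ps @ qs) = four_block_mat (jmat c ps) (0\<^sub>m (length ps) (length qs)) (0\<^sub>m (length qs) (length ps)) (jmat c qs)"
proof (rule eq_matI)
  let ?F = "four_block_mat (jmat c ps) (0\<^sub>m (length ps) (length qs)) (0\<^sub>m (length qs) (length ps)) (jmat c qs)"
  fix i j assume "i < dim_row ?F" "j < dim_col ?F"
  then have ij: "i < length ps + length qs" "j < length ps + length qs" by (auto simp: jmat_def)
  have z: "jent c p q = 0" "jent c q p = 0" if "p \<in> set ps" "q \<in> set qs" for p q
  proof -
    have "fst p \<noteq> fst q" using disj that by (metis disjoint_iff imageI)
    then show "jent c p q = 0" "jent c q p = 0" by (auto simp: jent_def)
  qed
  show "jmat c (ps @ qs) $$ (i,j) = ?F $$ (i,j)"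
    using ij z[of "ps ! i" "qs ! (j - length ps)"] z[of "ps ! j" "qs ! (i - length ps)"]
    by (auto simp: jmat_def nth_append)
qed (auto simp: jmat_def)

lemma jmat_concat:
  assumes "distinct bs"
  shows "jmat c (concat (map (\<lambda>b. map (Pair b) [0..<r b]) bs)) = diag_block_mat (map (\<lambda>b. jmat c (map (Pair b) [0..<r b])) bs)"
  using assms
proof (induction bs)
  case Nil
  show ?case by (intro eq_matI) (auto simp: jmat_def)
next
  case (Cons b bs)
  have "fst ` set (map (Pair b) [0..<r b]) \<inter> fst ` set (concat (map (\<lambda>b. map (Pair b) [0..<r b]) bs)) = {}"
    using Cons.prems by auto
  from jmat_append[OF this, of c] have "jmat c (concat (map (\<lambda>b. map (Pair b) [0..<r b]) (b # bs))) =
     four_block_mat (jmat c (map (Pair b) [0..<r b])) (0\<^sub>m (r b) (length (concat (map (\<lambda>b. map (Pair b) [0..<r b]) bs))))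
       (0\<^sub>m (length (concat (map (\<lambda>b. map (Pair b) [0..<r b]) bs))) (r b)) (jmat c (concat (map (\<lambda>b. map (Pair b) [0..<r b]) bs)))"
    by simp
  moreover have "dim_row (jmat c ps) = length ps" "dim_col (jmat c ps) = length ps" for ps by (auto simp: jmat_def)
  moreover have "jmat c (concat (map (\<lambda>b. map (Pair b) [0..<r b]) bs)) = diag_block_mat (map (\<lambda>b. jmat c (map (Pair b) [0..<r b])) bs)"
    using Cons by simp
  ultimately show ?case by (metis (no_types, lifting) diag_block_mat.simps(2) diff_zero length_map length_upt list.simps(9))
qed

definition jall :: "(nat \<Rightarrow> 'k) \<Rightarrow> (nat \<Rightarrow> nat) \<Rightarrow> (nat \<times> 'k) list" where
  "jall c m = concat (map (\<lambda>b. jblocks c (row_len m b)) [0..<m 0])"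

lemma jordan_nf_jmat: "jordan_nf (jmat c (young_list m)) (jall c m)"
proof -
  let ?Ms = "map (\<lambda>b. (jmat c (map (Pair b) [0..<row_len m b]), jblocks c (row_len m b))) [0..<m 0]"
  have "jordan_nf (diag_block_mat (map fst ?Ms)) (concat (map snd ?Ms))"
    by (rule jordan_nf_diag_block_mat) (auto simp: jmat_block_jordan_nf)
  then show ?thesis unfolding young_list_def jall_def by (subst jmat_concat) (simp_all add: o_def)
qed

text \<open>Row 0 is the longest row, so every eigenvalue already occurs in it.\<close>

lemma snd_jall:
  assumes m: "shape m"
  shows "snd ` set (jall c m) = c ` {..<row_len m 0}"
proof (intro equalityI subsetI)
  fix a assume "a \<in> snd ` set (jall c m)"
  then obtain b s where bs: "b < m 0" "(s,a) \<in> set (jblocks c (row_len m b))" by (auto simp: jall_def)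
  then have "card {i. i < row_len m b \<and> c i = a} > 0" unfolding set_jblocks by simp
  then obtain i where i: "i < row_len m b" "c i = a" by (auto simp: card_gt_0_iff)
  then have "i < row_len m 0" unfolding less_row_len[OF m] by simp
  then show "a \<in> c ` {..<row_len m 0}" using i by auto
next
  fix a assume "a \<in> c ` {..<row_len m 0}"
  then obtain i where i: "i < row_len m 0" "c i = a" by auto
  then have "card {i. i < row_len m 0 \<and> c i = a} > 0" by (auto simp: card_gt_0_iff)
  then have "(card {i. i < row_len m 0 \<and> c i = a}, a) \<in> set (jblocks c (row_len m 0))" unfolding set_jblocks by simp
  moreover have "0 < m 0" using i(1) less_row_len[OF m, of i 0] shape_le[OF m, of 0 i] by simp
  ultimately show "a \<in> snd ` set (jall c m)" unfolding jall_def by force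
qed

text \<open>An injective change of eigenvalues keeps the coincidences among the \<open>c h\<close>,
  hence the blocks. This turns the bijection of eigenvalues in \<open>Dset\<close> into a change of
  \<open>c\<close> on a fixed diagram.\<close>

lemma jall_comp:
  assumes m: "shape m" and inj: "inj_on f (c ` {..<row_len m 0})"
  shows "jall (f \<circ> c) m = map (\<lambda>(s,a). (s, f a)) (jall c m)"
proof -
  have "jblocks (f \<circ> c) (row_len m b) = map (\<lambda>(s,a). (s, f a)) (jblocks c (row_len m b))" for b
  proof (rule jblocks_comp, rule inj_on_subset[OF inj])
    have "h < row_len m 0" if "h < row_len m b" for h using that unfolding less_row_len[OF m] by simp
    then have "{..<row_len m b} \<subseteq> {..<row_len m 0}" by (intro subsetI) simp
    then show "c ` {..<row_len m b} \<subseteq> c ` {..<row_len m 0}" by (rule image_mono)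
  qed
  then show ?thesis by (simp add: jall_def map_concat o_def)
qed

lemma count_jall:
  "count (mset (jall c m)) (s,a) = card {b. b < m 0 \<and> s = card {i. i < row_len m b \<and> c i = a} \<and> s > 0}"
proof -
  define R where "R b \<longleftrightarrow> s = card {i. i < row_len m b \<and> c i = a} \<and> s > 0" for b
  have R: "count (mset (jblocks c (row_len m b))) (s,a) = (if R b then 1 else 0)" for b
    unfolding R_def by (rule count_jblocks)
  have cnt: "count (mset (concat (map (\<lambda>b. jblocks c (row_len m b)) bs))) (s,a) = length (filter R bs)" for bs
  proof (induction bs)
    case (Cons b bs)
    have "count (mset (concat (map (\<lambda>b. jblocks c (row_len m b)) (b # bs)))) (s,a)
       = count (mset (jblocks c (row_len m b))) (s,a) + count (mset (concat (map (\<lambda>b. jblocks c (row_len m b)) bs))) (s,a)"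
      by (simp del: count_mset)
    then show ?case unfolding R Cons.IH by simp
  qed simp
  have "count (mset (jall c m)) (s,a) = card {i. i < length [0..<m 0] \<and> R ([0..<m 0] ! i)}"
    unfolding jall_def cnt length_filter_conv_card ..
  also have "{i. i < length [0..<m 0] \<and> R ([0..<m 0] ! i)} = {b. b < m 0 \<and> R b}"
    by (rule Collect_cong) (rule conj_cong, simp_all)
  finally show ?thesis unfolding R_def .
qed

text \<open>For each \<open>a\<close> the numbers \<open>mult (a,j)\<close> are the columns of the
  Young diagram of the blocks of \<open>a\<close>; the columns of all eigenvalues are merged into
  one diagram, and \<open>c h\<close> remembers whose column \<open>h\<close> is. Row
  \<open>b\<close> meets the columns of \<open>a\<close> higher than \<open>b\<close>, whose number
  is the size of the \<open>b\<close>-th largest block of \<open>a\<close>, counted from 0.\<close>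

lemma jordan_shape_exists:
  fixes ns :: "(nat \<times> 'k) list"
  assumes pos: "0 \<notin> fst ` set ns"
  shows "\<exists>m c. shape m \<and> mset (jall c m) = mset ns"
proof -
  define mult where "mult = (\<lambda>(a,j). length (filter (\<lambda>(k,e). e = a \<and> j < k) ns))"
  define X where "X = {p. mult p > 0}"
  have "X \<subseteq> (\<Union>(k,e)\<in>set ns. {e} \<times> {..<k})"
  proof
    fix p assume "p \<in> X"
    then obtain a j where p: "p = (a,j)" "length (filter (\<lambda>(k,e). e = a \<and> j < k) ns) > 0"
      unfolding X_def mult_def by (cases p) auto
    then obtain k e where "(k,e) \<in> set ns" "e = a" "j < k" by (auto simp: filter_empty_conv)
    then show "p \<in> (\<Union>(k,e)\<in>set ns. {e} \<times> {..<k})" using p by auto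
  qed
  then have finX: "finite X" by (rule finite_subset) auto
  obtain L where L: "set L = X" "distinct L" using finite_distinct_list[OF finX] by blast
  define xs where "xs = rev (sort_key mult L)"
  have xs: "set xs = X" "distinct xs" unfolding xs_def using L by auto
  define K where "K = length xs"
  define m where "m h = (if h < K then mult (xs ! h) else 0)" for h
  define c where "c h = fst (xs ! h)" for h
  have anti: "antimono m"
  proof (rule antimonoI)
    fix i j :: nat assume ij: "i \<le> j"
    have "sorted (rev (map mult xs))" unfolding xs_def by (simp add: rev_map[symmetric])
    then have "j < K \<Longrightarrow> map mult xs ! j \<le> map mult xs ! i" using sorted_rev_nth_mono[of "map mult xs" i j] ij K_def by simp
    then show "m j \<le> m i" using ij by (auto simp: m_def K_def)
  qed
  have zero: "m h = 0" if "h \<ge> K" for h using that by (simp add: m_def)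
  have shm: "shape m" using anti zero unfolding shape_def by blast
  have "mset (jall c m) = mset ns"
  proof (rule multiset_eqI)
    fix p :: "nat \<times> 'k"
    obtain s a where p: "p = (s,a)" by fastforce
    define M where "M j = mult (a,j)" for j
    have Mfilter: "M j = length (filter (\<lambda>(k,e). e = a \<and> j < k) ns)" for j by (simp add: M_def mult_def)
    have Manti: "antimono M"
    proof (rule antimonoI)
      fix i j :: nat assume ij: "i \<le> j"
      have "length (filter (\<lambda>(k,e). e = a \<and> j < k) zs) \<le> length (filter (\<lambda>(k,e). e = a \<and> i < k) zs)" for zs :: "(nat \<times> 'k) list"
        using ij by (induction zs) auto
      then show "M j \<le> M i" unfolding Mfilter .
    qed
    define K' where "K' = Suc (Max (insert 0 (fst ` set ns)))"
    have Mzero: "M j = 0" if "j \<ge> K'" for j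
    proof -
      have "\<not> j < k" if "(k,e) \<in> set ns" for k e
      proof -
        have "k \<le> Max (insert 0 (fst ` set ns))" using that by (intro Max_ge) force+
        then show ?thesis using \<open>j \<ge> K'\<close> unfolding K'_def by simp
      qed
      then show ?thesis unfolding Mfilter by (auto simp: filter_empty_conv)
    qed
    have shM: "shape M" using Manti Mzero unfolding shape_def by blast
    note lrM = less_row_len[OF shM]
    note lrm = less_row_len[OF shm]
    have card_eq: "card {i. i < row_len m b \<and> c i = a} = row_len M b" for b
    proof -
      let ?I = "{i. i < row_len m b \<and> c i = a}"
      have I: "?I = {i. i < K \<and> b < mult (xs ! i) \<and> fst (xs ! i) = a}"
        unfolding lrm by (auto simp: m_def c_def split: if_splits)
      have inj: "inj_on (\<lambda>i. snd (xs ! i)) ?I"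
      proof (rule inj_onI)
        fix i j assume "i \<in> ?I" "j \<in> ?I" "snd (xs ! i) = snd (xs ! j)"
        then have "xs ! i = xs ! j" "i < length xs" "j < length xs" unfolding I K_def by (auto simp: prod_eq_iff)
        then show "i = j" using xs(2) nth_eq_iff_index_eq by blast
      qed
      have "(\<lambda>i. snd (xs ! i)) ` ?I = {j. b < M j}"
      proof (intro equalityI subsetI)
        fix j assume "j \<in> (\<lambda>i. snd (xs ! i)) ` ?I"
        then obtain i where i: "b < mult (xs ! i)" "fst (xs ! i) = a" "j = snd (xs ! i)" unfolding I by auto
        then have "xs ! i = (a,j)" by (auto simp: prod_eq_iff)
        then show "j \<in> {j. b < M j}" using i(1) by (simp add: M_def)
      next
        fix j assume "j \<in> {j. b < M j}"
        then have j: "b < mult (a,j)" by (simp add: M_def)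
        then have "(a,j) \<in> set xs" unfolding xs(1) X_def by simp
        then obtain i where i: "i < length xs" "xs ! i = (a,j)" by (metis in_set_conv_nth)
        then have "i \<in> ?I" unfolding I K_def using j by simp
        then show "j \<in> (\<lambda>i. snd (xs ! i)) ` ?I" using i(2) by (intro image_eqI[of _ _ i]) auto
      qed
      also have "{j. b < M j} = {..<row_len M b}" using lrM by auto
      finally show ?thesis using card_image[OF inj] by simp
    qed
    show "count (mset (jall c m)) p = count (mset ns) p"
    proof (cases "s = 0")
      case True
      have "p \<notin> set ns" using pos True p by (auto simp: image_iff)
      then have "count (mset ns) p = 0" by (simp add: count_eq_zero_iff)
      then show ?thesis unfolding p count_jall using True by simp
    next
      case False
      have M0: "M 0 \<le> m 0"
      proof (cases "M 0 > 0")
        case True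
        then have "(a,0) \<in> set xs" unfolding xs(1) X_def M_def by simp
        then obtain i where i: "i < length xs" "xs ! i = (a,0)" by (metis in_set_conv_nth)
        then have "M 0 = m i" by (simp add: m_def M_def K_def)
        then show ?thesis using antimonoD[OF anti, of 0 i] by simp
      qed simp
      \<comment> \<open>The rows with exactly \<open>s\<close> columns of \<open>a\<close> are
        counted by column \<open>s - 1\<close> of \<open>a\<close> but not by column
        \<open>s\<close>; and \<open>M (s - 1) - M s\<close> is also the number of blocks of
        \<open>a\<close> of size \<open>s\<close>.\<close>
      have "{b. b < m 0 \<and> s = row_len M b \<and> s > 0} = {M s..<M (s - 1)}"
      proof (intro equalityI subsetI)
        fix b assume "b \<in> {b. b < m 0 \<and> s = row_len M b \<and> s > 0}"
        then have "s - 1 < row_len M b" "\<not> s < row_len M b" by auto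
        then show "b \<in> {M s..<M (s - 1)}" unfolding lrM by auto
      next
        fix b assume b: "b \<in> {M s..<M (s - 1)}"
        then have "s - 1 < row_len M b" "\<not> s < row_len M b" unfolding lrM by auto
        then have "s = row_len M b" by simp
        moreover have "b < m 0" using b M0 antimonoD[OF Manti, of 0 "s - 1"] by simp
        ultimately show "b \<in> {b. b < m 0 \<and> s = row_len M b \<and> s > 0}" using False by simp
      qed
      then have "count (mset (jall c m)) p = M (s - 1) - M s" unfolding p count_jall card_eq by simp
      moreover have "length (filter (\<lambda>(k,e). e = a \<and> s - 1 < k) zs)
          = length (filter (\<lambda>(k,e). e = a \<and> s < k) zs) + count (mset zs) (s,a)" for zs :: "(nat \<times> 'k) list"
        using False by (induction zs) auto
      then have "M (s - 1) = M s + count (mset ns) p" unfolding Mfilter p .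
      ultimately show ?thesis by simp
    qed
  qed
  then show ?thesis using shm by blast
qed

text \<open>The Jordan form is unique up to the order of blocks, so the list in the definition of
  \<open>Dset\<close> may be taken to be \<open>jall c m\<close>, on which a change of eigenvalues
  is composition of \<open>f\<close> with \<open>c\<close>.\<close>

lemma Dset_iff:
  fixes A :: "'k::field mat"
  assumes m: "shape m" and sim: "similar_mat A (jmat c (young_list m))"
  shows "B \<in> Dset n A \<longleftrightarrow> B \<in> carrier_mat n n \<and>
    (\<exists>f. inj_on f (c ` {..<row_len m 0}) \<and> similar_mat B (jmat (f \<circ> c) (young_list m)))"
proof -
  have jA: "jordan_nf A (jall c m)" by (rule jordan_nf_similar[OF sim jordan_nf_jmat])
  show ?thesis
  proof
    assume "B \<in> Dset n A"
    then obtain ns f where B: "B \<in> carrier_mat n n" and ns: "jordan_nf A ns" "inj_on f (snd ` set ns)"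
      "jordan_nf B (map (\<lambda>(k,a). (k, f a)) ns)" unfolding Dset_def by blast
    have ms: "mset ns = mset (jall c m)" by (rule jordan_nf_mset_unique[OF ns(1) jA])
    have inj: "inj_on f (c ` {..<row_len m 0})" using ns(2) mset_eq_setD[OF ms] snd_jall[OF m, of c] by simp
    have "mset (map (\<lambda>(k,a). (k, f a)) ns) = mset (jall (f \<circ> c) m)"
      unfolding jall_comp[OF m inj] using ms by simp
    from jordan_nf_perm[OF ns(3) this] have "similar_mat B (jordan_matrix (jall (f \<circ> c) m))" unfolding jordan_nf_def by blast
    moreover have "similar_mat (jmat (f \<circ> c) (young_list m)) (jordan_matrix (jall (f \<circ> c) m))"
      using jordan_nf_jmat unfolding jordan_nf_def by blast
    ultimately have "similar_mat B (jmat (f \<circ> c) (young_list m))" using similar_mat_trans similar_mat_sym by blast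
    then show "B \<in> carrier_mat n n \<and> (\<exists>f. inj_on f (c ` {..<row_len m 0}) \<and> similar_mat B (jmat (f \<circ> c) (young_list m)))"
      using B inj by blast
  next
    assume "B \<in> carrier_mat n n \<and> (\<exists>f. inj_on f (c ` {..<row_len m 0}) \<and> similar_mat B (jmat (f \<circ> c) (young_list m)))"
    then obtain f where f: "B \<in> carrier_mat n n" "inj_on f (c ` {..<row_len m 0})" "similar_mat B (jmat (f \<circ> c) (young_list m))" by blast
    have "jordan_nf B (map (\<lambda>(k,a). (k, f a)) (jall c m))"
      using jordan_nf_similar[OF f(3) jordan_nf_jmat] unfolding jall_comp[OF m f(2)] .
    then show "B \<in> Dset n A" unfolding Dset_def mem_Collect_eq
      using f(1,2) jA snd_jall[OF m, of c] by (intro conjI exI[of _ "jall c m"] exI[of _ f]) simp_all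
  qed
qed

section \<open>Centralizers\<close>

definition mat_sub :: "nat \<Rightarrow> 'k::field mat set \<Rightarrow> bool" where
  "mat_sub n U \<longleftrightarrow> U \<subseteq> carrier_mat n n \<and> 0\<^sub>m n n \<in> U \<and> (\<forall>X\<in>U. \<forall>Y\<in>U. X + Y \<in> U) \<and> (\<forall>X\<in>U. \<forall>a. a \<cdot>\<^sub>m X \<in> U)"

abbreviation mat_sub_module :: "nat \<Rightarrow> 'k::field mat set \<Rightarrow> ('k, 'k mat) module" where
  "mat_sub_module n U \<equiv> (module_mat TYPE('k) n n)\<lparr>carrier := U\<rparr>"

lemma mat_sub_vectorspace:
  fixes U :: "'k::field mat set"
  assumes U: "mat_sub n U"
  shows "vectorspace class_ring (mat_sub_module n U)"
proof -
  interpret vectorspace "class_ring :: 'k ring" "module_mat TYPE('k) n n" by (rule matrix_vs)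
  have "submodule class_ring U (module_mat TYPE('k) n n)"
    using U module_axioms unfolding mat_sub_def submodule_def by (auto simp: module_mat_simps class_ring_simps)
  then have "subspace class_ring U (module_mat TYPE('k) n n)" unfolding subspace_def using vectorspace_axioms by blast
  then show ?thesis by (rule subspace_is_vs)
qed

lemma mat_sub_generators_image:
  fixes U U' :: "'k::field mat set"
  assumes U: "mat_sub n U" and U': "mat_sub n U'" and bij: "bij_betw F U U'"
    and add: "\<And>X Y. X \<in> U \<Longrightarrow> Y \<in> U \<Longrightarrow> F (X + Y) = F X + F Y"
    and smult: "\<And>a X. X \<in> U \<Longrightarrow> F (a \<cdot>\<^sub>m X) = a \<cdot>\<^sub>m F X"
    and S: "finite S" "S \<subseteq> U" "LinearCombinations.module.gen_set class_ring (mat_sub_module n U) S"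
  shows "finite (F ` S)" "card (F ` S) = card S" "F ` S \<subseteq> U'"
    "LinearCombinations.module.gen_set class_ring (mat_sub_module n U') (F ` S)"
proof -
  interpret V: vectorspace "class_ring :: 'k ring" "mat_sub_module n U" by (rule mat_sub_vectorspace[OF U])
  interpret W: vectorspace "class_ring :: 'k ring" "mat_sub_module n U'" by (rule mat_sub_vectorspace[OF U'])
  have FU: "F ` U = U'" and inj: "inj_on F U" using bij unfolding bij_betw_def by auto
  interpret linear_map "class_ring :: 'k ring" "mat_sub_module n U" "mat_sub_module n U'" F
    by unfold_locales (use FU add smult in \<open>auto simp: module_hom_def module_mat_simps class_ring_simps\<close>)
  show "finite (F ` S)" using S(1) by simp
  show "card (F ` S) = card S" using inj S(2) by (intro card_image) (rule inj_on_subset)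
  show FS: "F ` S \<subseteq> U'" using S(2) FU by blast
  show "W.gen_set (F ` S)"
  proof
    show "W.span (F ` S) \<subseteq> carrier (mat_sub_module n U')" using FS by (intro W.span_is_subset2) simp
    show "carrier (mat_sub_module n U') \<subseteq> W.span (F ` S)"
    proof
      fix w assume "w \<in> carrier (mat_sub_module n U')"
      then obtain v where v: "v \<in> U" "w = F v" using FU by auto
      then have "v \<in> V.span S" using S(3) by simp
      then obtain a where a: "a \<in> S \<rightarrow> carrier class_ring" "v = V.lincomb a S"
        using V.finite_span[OF S(1)] S(2) by auto
      let ?b = "\<lambda>y. a (the_inv_into U F y)"
      have ab: "(?b \<circ> F) x = a x" if "x \<in> S" for x using that S(2) the_inv_into_f_f[OF inj] by auto
      have "W.lincomb ?b (F ` S) = F (V.lincomb (?b \<circ> F) S)"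
        using inj S by (intro lincomb_linear_image) (auto simp: class_ring_simps)
      also have "V.lincomb (?b \<circ> F) S = V.lincomb a S"
        using ab S(2) by (intro V.lincomb_cong) (auto simp: class_ring_simps)
      finally have "w = W.lincomb ?b (F ` S)" using v a by simp
      then show "w \<in> W.span (F ` S)" unfolding W.span_def using S(1)
        by (auto simp: class_ring_simps)
    qed
  qed
qed

text \<open>\<open>dim\<close> is the least size of a finite generating set, and both
  \<open>F\<close> and its inverse carry such sets to generating sets of equal size.\<close>

lemma mat_sub_dim_eq:
  fixes U U' :: "'k::field mat set"
  assumes U: "mat_sub n U" and U': "mat_sub n U'" and bij: "bij_betw F U U'"
    and add: "\<And>X Y. X \<in> U \<Longrightarrow> Y \<in> U \<Longrightarrow> F (X + Y) = F X + F Y"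
    and smult: "\<And>a X. X \<in> U \<Longrightarrow> F (a \<cdot>\<^sub>m X) = a \<cdot>\<^sub>m F X"
  shows "vectorspace.dim class_ring (mat_sub_module n U) = vectorspace.dim class_ring (mat_sub_module n U')"
proof -
  interpret V: vectorspace "class_ring :: 'k ring" "mat_sub_module n U" by (rule mat_sub_vectorspace[OF U])
  interpret W: vectorspace "class_ring :: 'k ring" "mat_sub_module n U'" by (rule mat_sub_vectorspace[OF U'])
  let ?G = "the_inv_into U F"
  have FU: "F ` U = U'" and inj: "inj_on F U" using bij unfolding bij_betw_def by auto
  have G: "bij_betw ?G U' U" by (rule bij_betw_the_inv_into[OF bij])
  have GF: "?G (F X) = X" if "X \<in> U" for X using that inj by (rule the_inv_into_f_f[rotated])
  have FG: "F (?G Y) = Y" "?G Y \<in> U" if "Y \<in> U'" for Y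
    using that FU f_the_inv_into_f[OF inj] G unfolding bij_betw_def by auto
  have Gadd: "?G (X + Y) = ?G X + ?G Y" if "X \<in> U'" "Y \<in> U'" for X Y
  proof -
    have "F (?G X + ?G Y) = X + Y" using add FG that by simp
    moreover have "?G X + ?G Y \<in> U" using FG(2) that U unfolding mat_sub_def by blast
    ultimately show ?thesis using GF by metis
  qed
  have Gsmult: "?G (a \<cdot>\<^sub>m X) = a \<cdot>\<^sub>m ?G X" if "X \<in> U'" for a X
  proof -
    have "F (a \<cdot>\<^sub>m ?G X) = a \<cdot>\<^sub>m X" using smult FG that by simp
    moreover have "a \<cdot>\<^sub>m ?G X \<in> U" using FG(2) that U unfolding mat_sub_def by blast
    ultimately show ?thesis using GF by metis
  qed
  have "(\<exists>S. finite S \<and> card S = k \<and> S \<subseteq> carrier (mat_sub_module n U) \<and> V.gen_set S) \<longleftrightarrow>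
      (\<exists>S. finite S \<and> card S = k \<and> S \<subseteq> carrier (mat_sub_module n U') \<and> W.gen_set S)" for k
  proof
    assume "\<exists>S. finite S \<and> card S = k \<and> S \<subseteq> carrier (mat_sub_module n U) \<and> V.gen_set S"
    then obtain S where S: "finite S" "card S = k" "S \<subseteq> U" "V.gen_set S" by auto
    from mat_sub_generators_image[OF U U' bij add smult S(1,3,4)] S(2)
    show "\<exists>S. finite S \<and> card S = k \<and> S \<subseteq> carrier (mat_sub_module n U') \<and> W.gen_set S" by (intro exI[of _ "F ` S"]) simp
  next
    assume "\<exists>S. finite S \<and> card S = k \<and> S \<subseteq> carrier (mat_sub_module n U') \<and> W.gen_set S"
    then obtain S where S: "finite S" "card S = k" "S \<subseteq> U'" "W.gen_set S" by auto
    from mat_sub_generators_image[OF U' U G Gadd Gsmult S(1,3,4)] S(2)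
    show "\<exists>S. finite S \<and> card S = k \<and> S \<subseteq> carrier (mat_sub_module n U) \<and> V.gen_set S" by (intro exI[of _ "?G ` S"]) simp
  qed
  then show ?thesis unfolding V.dim_def W.dim_def by simp
qed

lemma centralizer_mat_sub:
  assumes A: "A \<in> carrier_mat n n" shows "mat_sub n (centralizer n A)"
  unfolding mat_sub_def
proof (intro conjI ballI allI)
  show "centralizer n A \<subseteq> carrier_mat n n" unfolding centralizer_def by blast
  show "0\<^sub>m n n \<in> centralizer n A" unfolding centralizer_def using A by simp
  fix X assume "X \<in> centralizer n A"
  then have X: "X \<in> carrier_mat n n" "A * X = X * A" by (auto simp: centralizer_def)
  show "a \<cdot>\<^sub>m X \<in> centralizer n A" for a
    unfolding centralizer_def using X mult_smult_distrib[OF A X(1), of a] mult_smult_assoc_mat[OF X(1) A, of a] by simp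
  fix Y assume "Y \<in> centralizer n A"
  then have Y: "Y \<in> carrier_mat n n" "A * Y = Y * A" by (auto simp: centralizer_def)
  show "X + Y \<in> centralizer n A"
    unfolding centralizer_def using X Y mult_add_distrib_mat[OF A X(1) Y(1)] add_mult_distrib_mat[OF X(1) Y(1) A] by simp
qed

lemma centralizer_dim_similar:
  fixes A B :: "'k::field mat"
  assumes sim: "similar_mat A B" and B: "B \<in> carrier_mat n n"
  shows "centralizer_dim n A = centralizer_dim n B"
proof -
  from similar_matE[OF sim B] obtain P Q where
    A: "A \<in> carrier_mat n n" "P \<in> carrier_mat n n" "Q \<in> carrier_mat n n" "P * Q = 1\<^sub>m n" "Q * P = 1\<^sub>m n" "A = P * B * Q" .
  have conj: "P' * (Q' * X * P') * Q' = X"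
    if "P' \<in> carrier_mat n n" "Q' \<in> carrier_mat n n" "P' * Q' = 1\<^sub>m n" "X \<in> carrier_mat n n" for P' Q' X :: "'k mat"
  proof -
    have "P' * (Q' * X * P') * Q' = P' * (Q' * X * P' * Q')" using that by (intro assoc_mult_mat) auto
    also have "Q' * X * P' * Q' = Q' * X * (P' * Q')" using that by (intro assoc_mult_mat) auto
    also have "\<dots> = Q' * X" unfolding that(3) using that by (intro right_mult_one_mat) auto
    also have "P' * (Q' * X) = (P' * Q') * X" using that by (intro assoc_mult_mat[symmetric]) auto
    finally show ?thesis unfolding that(3) using that(4) by simp
  qed
  have mult: "(Q' * X * P') * (Q' * Y * P') = Q' * (X * Y) * P'"
    if "P' \<in> carrier_mat n n" "Q' \<in> carrier_mat n n" "P' * Q' = 1\<^sub>m n" "X \<in> carrier_mat n n" "Y \<in> carrier_mat n n" for P' Q' X Y :: "'k mat"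
  proof -
    have "(Q' * X * P') * (Q' * Y * P') = Q' * X * (P' * (Q' * Y * P'))" using that by (intro assoc_mult_mat) auto
    also have "P' * (Q' * Y * P') = P' * (Q' * (Y * P'))" using that assoc_mult_mat[of Q' n n Y n P' n] by simp
    also have "\<dots> = (P' * Q') * (Y * P')" using that by (intro assoc_mult_mat[symmetric]) auto
    also have "\<dots> = Y * P'" unfolding that(3) using that by simp
    also have "Q' * X * (Y * P') = Q' * (X * (Y * P'))" using that by (intro assoc_mult_mat) auto
    also have "X * (Y * P') = X * Y * P'" using that by (intro assoc_mult_mat[symmetric]) auto
    also have "Q' * (X * Y * P') = Q' * (X * Y) * P'" using that by (intro assoc_mult_mat[symmetric]) auto
    finally show ?thesis .
  qed
  have BA: "B = Q * A * P" unfolding A(6) by (rule conj[OF A(3,2,5) B, symmetric])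
  have toB: "Q * X * P \<in> centralizer n B" if "X \<in> centralizer n A" for X
  proof -
    have X: "X \<in> carrier_mat n n" "A * X = X * A" using that by (auto simp: centralizer_def)
    have "B * (Q * X * P) = (Q * X * P) * B"
      unfolding BA mult[OF A(2,3,4,1) X(1)] mult[OF A(2,3,4) X(1) A(1)] X(2) ..
    then show ?thesis unfolding centralizer_def using A(2,3) X(1) by auto
  qed
  have toA: "P * Y * Q \<in> centralizer n A" if "Y \<in> centralizer n B" for Y
  proof -
    have Y: "Y \<in> carrier_mat n n" "B * Y = Y * B" using that by (auto simp: centralizer_def)
    have "A * (P * Y * Q) = (P * Y * Q) * A"
      unfolding A(6) mult[OF A(3,2,5) B Y(1)] mult[OF A(3,2,5) Y(1) B] Y(2) ..
    then show ?thesis unfolding centralizer_def using A(2,3) Y(1) by auto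
  qed
  have bij: "bij_betw (\<lambda>X. Q * X * P) (centralizer n A) (centralizer n B)"
  proof (rule bij_betwI[where g = "\<lambda>Y. P * Y * Q"])
    show "(\<lambda>X. Q * X * P) \<in> centralizer n A \<rightarrow> centralizer n B" using toB by blast
    show "(\<lambda>Y. P * Y * Q) \<in> centralizer n B \<rightarrow> centralizer n A" using toA by blast
    show "P * (Q * X * P) * Q = X" if "X \<in> centralizer n A" for X
      using that conj[OF A(2,3,4)] by (auto simp: centralizer_def)
    show "Q * (P * Y * Q) * P = Y" if "Y \<in> centralizer n B" for Y
      using that conj[OF A(3,2,5)] by (auto simp: centralizer_def)
  qed
  show ?thesis unfolding centralizer_dim_def
  proof (rule mat_sub_dim_eq[OF centralizer_mat_sub[OF A(1)] centralizer_mat_sub[OF B] bij])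
    fix X Y assume "X \<in> centralizer n A" "Y \<in> centralizer n A"
    then have XY: "X \<in> carrier_mat n n" "Y \<in> carrier_mat n n" by (auto simp: centralizer_def)
    have "Q * (X + Y) = Q * X + Q * Y" by (rule mult_add_distrib_mat[OF A(3) XY])
    then show "Q * (X + Y) * P = Q * X * P + Q * Y * P"
      using A(2,3) XY by (simp add: add_mult_distrib_mat[of _ n n _ P n])
  next
    fix a X assume "X \<in> centralizer n A"
    then have X: "X \<in> carrier_mat n n" by (auto simp: centralizer_def)
    have "Q * (a \<cdot>\<^sub>m X) = a \<cdot>\<^sub>m (Q * X)" by (rule mult_smult_distrib[OF A(3) X])
    then show "Q * (a \<cdot>\<^sub>m X) * P = a \<cdot>\<^sub>m (Q * X * P)"
      using A(2,3) X by (simp add: mult_smult_assoc_mat[of _ n n P n])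
  qed
qed

locale jcentralizer =
  fixes m :: "nat \<Rightarrow> nat" and ps :: "(nat \<times> nat) list" and n :: nat
  assumes m: "shape m" and ps: "distinct ps" "set ps = young m" "length ps = n"
begin

definition ix :: "nat \<times> nat \<Rightarrow> nat" where "ix = the_inv_into {..<n} (nth ps)"

lemma ix: "i < n \<Longrightarrow> ix (ps ! i) = i"
  unfolding ix_def using bij_betw_nth[OF ps(1) refl refl] ps(3)
  by (intro the_inv_into_f_f) (auto simp: bij_betw_def)

lemma ix_less: "p \<in> young m \<Longrightarrow> ix p < n \<and> ps ! ix p = p"
  using ps(2,3) ix by (metis in_set_conv_nth)

lemma ps_young: "i < n \<Longrightarrow> ps ! i \<in> young m"
  using ps(2,3) nth_mem by metis

lemma young_iff: "(b,h) \<in> young m \<longleftrightarrow> h < row_len m b"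
  using less_row_len[OF m] by (simp add: young_def)

definition xcol :: "'k::field mat \<Rightarrow> nat \<times> nat \<Rightarrow> nat \<times> nat \<Rightarrow> 'k" where
  "xcol X q p = (if p \<in> young m then X $$ (ix p, ix q) else 0)"

lemma xcol_nth: "i < n \<Longrightarrow> j < n \<Longrightarrow> xcol X (ps ! j) (ps ! i) = X $$ (i,j)"
  using ps_young ix by (simp add: xcol_def)

lemma xcol_supp: "xcol X q \<in> supp_in (young m)"
  by (simp add: xcol_def supp_in_def)

lemma antimono_m: "antimono m"
  using m by (simp add: shape_def)

lemma finite_young_m: "finite (young m)"
  using ps(2) by (metis List.finite_set)

lemma jop_zero_outside:
  fixes c :: "nat \<Rightarrow> 'k::field"
  assumes "p \<notin> young m" "f \<in> supp_in (young m)" shows "jshift c i f p = 0"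
  using jshift_supp[OF antimono_m assms(2), of c i] assms(1) by (cases p) (simp add: supp_in_def)

text \<open>Column \<open>(b,h)\<close> of \<open>jmat c ps\<close> has \<open>c h\<close> on the
  diagonal and 1 at \<open>(b,h - 1)\<close>, so equality of the two products, taken column by
  column, is a recursion along each row of the diagram.\<close>

lemma centralizer_iff:
  fixes X :: "'k::field mat"
  shows "X \<in> centralizer n (jmat c ps) \<longleftrightarrow> X \<in> carrier_mat n n \<and>
    (\<forall>b h. (b,h) \<in> young m \<longrightarrow> jshift c h (xcol X (b,h)) = (if h = 0 then 0 else xcol X (b,h - 1)))"
proof (cases "X \<in> carrier_mat n n")
  case True
  let ?J = "jmat c ps"
  have J: "?J \<in> carrier_mat n n" using jmat_carrier[of c ps] ps(3) by simp
  have JX: "(?J * X) $$ (i,j) = jop c (xcol X (ps ! j)) (ps ! i)" if ij: "i < n" "j < n" for i j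
  proof -
    have "col X j = vec (length ps) (\<lambda>i. xcol X (ps ! j) (ps ! i))"
      using True ij ps(3) by (intro eq_vecI) (auto simp: xcol_nth)
    then have "(?J * X) $$ (i,j) = (?J *\<^sub>v vec (length ps) (\<lambda>i. xcol X (ps ! j) (ps ! i))) $ i"
      using ij True J by simp
    then show ?thesis unfolding jmat_mult_vec[OF ps(1,2) xcol_supp] using ij ps(3) by simp
  qed
  have XJ: "(X * ?J) $$ (i,j) = c h * xcol X (b,h) (ps ! i) + (if h = 0 then 0 else xcol X (b,h - 1) (ps ! i))"
    if ij: "i < n" "j < n" and q: "ps ! j = (b,h)" for i j b h
  proof -
    have qy: "(b,h) \<in> young m" using ps_young[OF ij(2)] q by simp
    have "(X * ?J) $$ (i,j) = (\<Sum>k<length ps. xcol X (ps ! k) (ps ! i) * jent c (ps ! k) (b,h))"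
      using ij True J q ps(3) by (simp add: scalar_prod_def lessThan_atLeast0 jmat_def xcol_nth)
    also have "\<dots> = (\<Sum>q\<in>young m. xcol X q (ps ! i) * jent c q (b,h))"
      using sum_nth_distinct[OF ps(1), of "\<lambda>q. xcol X q (ps ! i) * jent c q (b,h)"] ps(2) by simp
    also have "\<dots> = c h * xcol X (b,h) (ps ! i) + (if h = 0 then 0 else xcol X (b,h - 1) (ps ! i))"
      by (rule jent_sum_left[OF finite_young_m qy]) (use qy in \<open>auto simp: young_iff\<close>)
    finally show ?thesis .
  qed
  have "?J * X = X * ?J \<longleftrightarrow> (\<forall>i<n. \<forall>j<n. (?J * X) $$ (i,j) = (X * ?J) $$ (i,j))"
  proof
    assume e: "\<forall>i<n. \<forall>j<n. (?J * X) $$ (i,j) = (X * ?J) $$ (i,j)"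
    show "?J * X = X * ?J" by (rule eq_matI) (use e True J in auto)
  qed simp
  also have "\<dots> \<longleftrightarrow> (\<forall>b h. (b,h) \<in> young m \<longrightarrow> jshift c h (xcol X (b,h)) = (if h = 0 then 0 else xcol X (b,h - 1)))"
  proof (intro iffI allI impI)
    fix b h assume e: "\<forall>i<n. \<forall>j<n. (?J * X) $$ (i,j) = (X * ?J) $$ (i,j)" and q: "(b,h) \<in> young m"
    note qi = ix_less[OF q]
    show "jshift c h (xcol X (b,h)) = (if h = 0 then 0 else xcol X (b,h - 1))"
    proof
      fix p
      show "jshift c h (xcol X (b,h)) p = (if h = 0 then 0 else xcol X (b,h - 1)) p"
      proof (cases "p \<in> young m")
        case p: True
        note pi = ix_less[OF p]
        have ij: "ix p < n" "ix (b,h) < n" and pp: "ps ! ix p = p" and qq: "ps ! ix (b,h) = (b,h)"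
          using pi qi by auto
        have "(?J * X) $$ (ix p, ix (b,h)) = (X * ?J) $$ (ix p, ix (b,h))" using e ij by blast
        then have "jop c (xcol X (b,h)) p = c h * xcol X (b,h) p + (if h = 0 then 0 else xcol X (b,h - 1) p)"
          unfolding JX[OF ij] XJ[OF ij qq] pp qq .
        then show ?thesis using jop_jshift[of c "xcol X (b,h)" p h] by (cases "h = 0") simp_all
      next
        case False
        then show ?thesis using jop_zero_outside[OF False xcol_supp, of c h X "(b,h)"] by (auto simp: xcol_def)
      qed
    qed
  next
    fix i j assume e: "\<forall>b h. (b,h) \<in> young m \<longrightarrow> jshift c h (xcol X (b,h)) = (if h = 0 then 0 else xcol X (b,h - 1))"
      and ij: "i < n" "j < n"
    obtain b h where q: "ps ! j = (b,h)" by fastforce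
    have "(b,h) \<in> young m" using ps_young[OF ij(2)] q by simp
    then have "jshift c h (xcol X (b,h)) (ps ! i) = (if h = 0 then 0 else xcol X (b,h - 1)) (ps ! i)" using e by simp
    then show "(?J * X) $$ (i,j) = (X * ?J) $$ (i,j)"
      unfolding JX[OF ij] XJ[OF ij q] q using jop_jshift[of c "xcol X (b,h)" "ps ! i" h] by (cases "h = 0") simp_all
  qed
  finally show ?thesis using True by (simp add: centralizer_def)
qed (simp add: centralizer_def)

text \<open>The possible systems of row-end columns. The constant \<open>c\<close> does not occur,
  which is what equates the dimensions of all centralizers.\<close>

definition tops :: "'k::field mat set" where
  "tops = {Y \<in> carrier_mat n n. \<forall>i<n. \<forall>j<n. Y $$ (i,j) \<noteq> 0 \<longrightarrow>
     Suc (snd (ps ! j)) = row_len m (fst (ps ! j)) \<and> snd (ps ! i) \<le> snd (ps ! j)}"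

lemma tops_mat_sub: "mat_sub n (tops :: 'k::field mat set)"
  unfolding mat_sub_def
proof (intro conjI ballI allI)
  show "(tops :: 'k mat set) \<subseteq> carrier_mat n n" "0\<^sub>m n n \<in> (tops :: 'k mat set)" by (auto simp: tops_def)
  fix X :: "'k mat" assume X: "X \<in> tops"
  show "a \<cdot>\<^sub>m X \<in> tops" for a using X by (auto simp: tops_def)
  fix Y :: "'k mat" assume Y: "Y \<in> tops"
  have "X $$ (i,j) \<noteq> 0 \<or> Y $$ (i,j) \<noteq> 0" if "(X + Y) $$ (i,j) \<noteq> 0" "i < n" "j < n" for i j
    using that X Y by (auto simp: tops_def)
  note nz = this
  show "X + Y \<in> tops"
    unfolding tops_def mem_Collect_eq
  proof (intro conjI[of "_ \<in> _"] allI impI)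
    show "X + Y \<in> carrier_mat n n" using X Y by (simp add: tops_def)
    fix i j assume "i < n" "j < n" "(X + Y) $$ (i,j) \<noteq> 0"
    then show "Suc (snd (ps ! j)) = row_len m (fst (ps ! j)) \<and> snd (ps ! i) \<le> snd (ps ! j)"
      using nz[of i j] X Y unfolding tops_def by blast
  qed
qed

definition mask :: "'k::field mat \<Rightarrow> 'k mat" where
  "mask X = mat n n (\<lambda>(i,j). if Suc (snd (ps ! j)) = row_len m (fst (ps ! j)) then X $$ (i,j) else 0)"

text \<open>The column that the recursion forces \<open>k\<close> steps before the end of row
  \<open>b\<close>.\<close>

fun lift :: "(nat \<Rightarrow> 'k::field) \<Rightarrow> 'k mat \<Rightarrow> nat \<Rightarrow> nat \<Rightarrow> nat \<times> nat \<Rightarrow> 'k" where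
  "lift c Y b 0 = xcol Y (b, row_len m b - 1)"
| "lift c Y b (Suc k) = jshift c (row_len m b - Suc k) (lift c Y b k)"

lemma lift_supp: "lift c Y b k \<in> supp_in (young m)"
  by (induction k) (auto simp: xcol_supp intro: jshift_supp[OF antimono_m])

text \<open>The cancellation of \<open>generic_subspace.wk_high\<close> again; the support condition
  in \<open>tops\<close> starts the induction.\<close>

lemma lift_high:
  assumes Y: "Y \<in> tops" and b: "0 < row_len m b" and h: "h \<ge> row_len m b - k"
  shows "lift c Y b k (b',h) = 0"
  using h
proof (induction k arbitrary: h)
  case 0
  have q: "(b, row_len m b - 1) \<in> young m" using b by (simp add: young_iff)
  show ?case
  proof (cases "(b',h) \<in> young m")
    case True
    note pi = ix_less[OF True] and qi = ix_less[OF q]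
    have "\<not> snd (ps ! ix (b',h)) \<le> snd (ps ! ix (b, row_len m b - 1))" using pi qi 0 b by auto
    then have "Y $$ (ix (b',h), ix (b, row_len m b - 1)) = 0" using Y pi qi unfolding tops_def by blast
    then show ?thesis by (simp add: xcol_def)
  qed (simp add: xcol_def)
next
  case (Suc k)
  show ?case
  proof (cases "h = row_len m b - Suc k")
    case True
    have "lift c Y b k (b', Suc h) = 0" using Suc.IH[of "Suc h"] True by simp
    then show ?thesis by (simp add: jshift_def True)
  next
    case False
    then have "h \<ge> row_len m b - k" using Suc.prems by simp
    then show ?thesis using Suc.IH[of h] Suc.IH[of "Suc h"] by (simp add: jshift_def)
  qed
qed

lemma centralizer_lift:
  fixes X :: "'k::field mat"
  assumes X: "X \<in> centralizer n (jmat c ps)" and q: "(b,h) \<in> young m"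
  shows "xcol X (b,h) = lift c X b (row_len m b - Suc h)"
proof -
  have *: "xcol X (b,row_len m b - Suc k) = lift c X b k" if "k < row_len m b" for k
    using that
  proof (induction k)
    case (Suc k)
    let ?h = "row_len m b - Suc k"
    have "(b,?h) \<in> young m" "?h \<noteq> 0" using Suc.prems by (auto simp: young_iff)
    then have "jshift c ?h (xcol X (b,?h)) = xcol X (b,?h - 1)" using X unfolding centralizer_iff by simp
    then show ?case using Suc by simp
  qed simp
  have h: "h < row_len m b" using q by (simp add: young_iff)
  then have eq: "row_len m b - Suc (row_len m b - Suc h) = h" by simp
  show ?thesis using *[of "row_len m b - Suc h", unfolded eq] h by simp
qed

lemma mask_top:
  assumes "0 < row_len m b" shows "xcol (mask X) (b, row_len m b - 1) = xcol X (b, row_len m b - 1)"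
proof
  fix p
  have "(b, row_len m b - 1) \<in> young m" using assms by (simp add: young_iff)
  then show "xcol (mask X) (b, row_len m b - 1) p = xcol X (b, row_len m b - 1) p"
    using ix_less[of p] ix_less[of "(b, row_len m b - 1)"] assms by (auto simp: xcol_def mask_def)
qed

lemma lift_mask: "0 < row_len m b \<Longrightarrow> lift c (mask X) b k = lift c X b k"
  by (induction k) (simp_all add: mask_top[unfolded One_nat_def])

text \<open>Injectivity: the row-end columns determine the others by the recursion. Image in
  \<open>tops\<close>: column \<open>(b,h)\<close> is killed by \<open>T (Suc h)\<close>, which
  \<open>T_kernel\<close> turns into a support condition. Onto: the lifted columns satisfy the
  recursion by construction, except at \<open>h = 0\<close>, where \<open>lift_high\<close> leaves
  only layer 0 and \<open>jshift c 0\<close> kills it.\<close>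

lemma mask_bij:
  fixes c :: "nat \<Rightarrow> 'k::field"
  shows "bij_betw mask (centralizer n (jmat c ps)) tops"
  unfolding bij_betw_def
proof (intro conjI equalityI subsetI inj_onI)
  fix X Y assume X: "X \<in> centralizer n (jmat c ps)" and Y: "Y \<in> centralizer n (jmat c ps)" and eq: "mask X = mask Y"
  have XY: "X \<in> carrier_mat n n" "Y \<in> carrier_mat n n" using X Y by (auto simp: centralizer_def)
  show "X = Y"
  proof (rule eq_matI)
    fix i j assume "i < dim_row Y" "j < dim_col Y"
    then have ij: "i < n" "j < n" using XY by auto
    obtain b h where q: "ps ! j = (b,h)" by fastforce
    have qy: "(b,h) \<in> young m" using ps_young[OF ij(2)] q by simp
    then have b: "0 < row_len m b" by (auto simp: young_iff)
    have "xcol X (b,h) = xcol Y (b,h)"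
      unfolding centralizer_lift[OF X qy] centralizer_lift[OF Y qy]
      using lift_mask[OF b, of c X] lift_mask[OF b, of c Y] eq by metis
    then show "X $$ (i,j) = Y $$ (i,j)" using xcol_nth[OF ij, of X] xcol_nth[OF ij, of Y] q by simp
  qed (use XY in auto)
next
  fix Y assume "Y \<in> mask ` centralizer n (jmat c ps)"
  then obtain X where X: "X \<in> centralizer n (jmat c ps)" "Y = mask X" by blast
  interpret jspace m c "row_len m 0"
    using antimono_m less_row_len[OF m, of _ 0] by unfold_locales (auto simp: not_less[symmetric])
  have T0: "T (Suc h) (xcol X (b,h)) = 0" if "(b,h) \<in> young m" for b h
    using that
  proof (induction h)
    case 0
    have "jshift c 0 (xcol X (b,0)) = 0" using X(1) 0 unfolding centralizer_iff by simp
    then show ?case by (simp only: T.simps)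
  next
    case (Suc h)
    have "(b,h) \<in> young m" using Suc.prems by (simp add: young_iff)
    moreover have "jshift c (Suc h) (xcol X (b,Suc h)) = xcol X (b,h)" using X(1) Suc.prems unfolding centralizer_iff by simp
    ultimately show ?case using Suc.IH T_commute[of "Suc h" "Suc h" "xcol X (b,Suc h)"] by (simp only: T.simps(2)[of "Suc h"])
  qed
  have "snd (ps ! i) \<le> snd (ps ! j)" if ij: "i < n" "j < n" and nz: "X $$ (i,j) \<noteq> 0" for i j
  proof (rule ccontr)
    assume le: "\<not> snd (ps ! i) \<le> snd (ps ! j)"
    obtain b h where q: "ps ! j = (b,h)" by fastforce
    obtain b' h' where p: "ps ! i = (b',h')" by fastforce
    have "(b,h) \<in> young m" using ps_young[OF ij(2)] q by simp
    from T_kernel[OF T0[OF this], of h' b'] have "xcol X (b,h) (b',h') = 0" using le p q by simp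
    then show False using nz xcol_nth[OF ij, of X] p q by simp
  qed
  then show "Y \<in> tops" unfolding X(2) tops_def by (auto simp: mask_def split: if_splits)
next
  fix Y :: "'k mat" assume Y: "Y \<in> tops"
  define x where "x q = lift c Y (fst q) (row_len m (fst q) - Suc (snd q))" for q
  define X where "X = mat n n (\<lambda>(i,j). x (ps ! j) (ps ! i))"
  have Xc: "X \<in> carrier_mat n n" by (simp add: X_def)
  have xX: "xcol X q = x q" if "q \<in> young m" for q
  proof
    fix p
    show "xcol X q p = x q p"
    proof (cases "p \<in> young m")
      case True
      then show ?thesis using ix_less[OF True] ix_less[OF that] by (simp add: xcol_def X_def)
    next
      case False
      then have "x q p = 0" using lift_supp unfolding x_def supp_in_def by blast
      then show ?thesis using False by (simp add: xcol_def)
    qed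
  qed
  have "X \<in> centralizer n (jmat c ps)"
    unfolding centralizer_iff
  proof (intro conjI allI impI Xc)
    fix b h assume q: "(b,h) \<in> young m"
    then have h: "h < row_len m b" by (simp add: young_iff)
    then have b: "0 < row_len m b" by simp
    show "jshift c h (xcol X (b,h)) = (if h = 0 then 0 else xcol X (b,h - 1))"
    proof (cases h)
      case 0
      have hi: "x (b,0) (b',i) = 0" if "i > 0" for b' i
        using lift_high[OF Y b, of "row_len m b - Suc 0" i c b'] that b by (simp add: x_def)
      have "jshift c 0 (x (b,0)) p = 0" for p
      proof -
        obtain b' i where p: "p = (b',i)" by fastforce
        show ?thesis using hi[of i b'] hi[of "Suc i" b'] by (cases "i = 0") (auto simp: p jshift_def)
      qed
      then have "jshift c 0 (x (b,0)) = 0" by (intro ext) (simp only: zero_fun_apply)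
      then show ?thesis using xX[OF q] 0 by (simp only: if_True simp_thms)
    next
      case (Suc h0)
      have q0: "(b,h0) \<in> young m" using h Suc by (simp add: young_iff)
      have "x (b,h0) = lift c Y b (Suc (row_len m b - Suc h))" using h Suc by (simp add: x_def Suc_diff_Suc)
      moreover have "row_len m b - Suc (row_len m b - Suc h) = h" using h by simp
      ultimately show ?thesis using xX[OF q] xX[OF q0] Suc by (simp add: x_def)
    qed
  qed
  moreover have "mask X = Y"
  proof (rule eq_matI)
    fix i j assume "i < dim_row Y" "j < dim_col Y"
    then have ij: "i < n" "j < n" using Y by (auto simp: tops_def)
    obtain b h where q: "ps ! j = (b,h)" by fastforce
    show "mask X $$ (i,j) = Y $$ (i,j)"
    proof (cases "Suc h = row_len m b")
      case True
      then have "x (b,h) = xcol Y (b,h)" by (simp add: x_def flip: True)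
      then show ?thesis using ij q True xcol_nth[OF ij, of Y] by (simp add: mask_def X_def)
    next
      case False
      then have "Y $$ (i,j) = 0" using Y ij q unfolding tops_def by fastforce
      then show ?thesis using ij q False by (simp add: mask_def)
    qed
  qed (use Y in \<open>auto simp: mask_def tops_def\<close>)
  ultimately show "Y \<in> mask ` centralizer n (jmat c ps)" by blast
qed

lemma centralizer_dim_jmat:
  fixes c :: "nat \<Rightarrow> 'k::field"
  shows "centralizer_dim n (jmat c ps) = vectorspace.dim class_ring (mat_sub_module n (tops :: 'k mat set))"
proof -
  have J: "jmat c ps \<in> carrier_mat n n" using jmat_carrier[of c ps] ps(3) by simp
  have a: "mask (X + Y) = mask X + mask Y" if "X \<in> centralizer n (jmat c ps)" "Y \<in> centralizer n (jmat c ps)" for X Y :: "'k mat"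
    using that by (intro eq_matI) (auto simp: mask_def centralizer_def)
  have b: "mask (a \<cdot>\<^sub>m X) = a \<cdot>\<^sub>m mask X" if "X \<in> centralizer n (jmat c ps)" for a and X :: "'k mat"
    using that by (intro eq_matI) (auto simp: mask_def centralizer_def)
  show ?thesis unfolding centralizer_dim_def
    by (rule mat_sub_dim_eq[OF centralizer_mat_sub[OF J] tops_mat_sub mask_bij a b])
qed

end

section \<open>Closures and the theorem\<close>

text \<open>The matrix conjugating \<open>B\<close> to \<open>jmat c ps\<close> is kept while the
  diagonal moves along a line: the resulting curve has polynomial entries, passes through
  \<open>B\<close> at \<open>t = 0\<close> and lies in \<open>D\<close> for \<open>t\<close> outside
  \<open>bad\<close>.\<close>

lemma jmat_line_closure:
  fixes c e :: "nat \<Rightarrow> 'k::field"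
  assumes inf: "infinite (UNIV :: 'k set)" and B: "similar_mat B (jmat c ps)" and n: "length ps = n"
    and fin: "finite bad"
    and good: "\<And>t B'. t \<notin> bad \<Longrightarrow> B' \<in> carrier_mat n n \<Longrightarrow> similar_mat B' (jmat (\<lambda>h. c h + t * e h) ps) \<Longrightarrow> B' \<in> D"
  shows "B \<in> zar_closure n n D"
proof -
  define J where "J t = jmat (\<lambda>h. c h + t * e h) ps" for t
  have J: "J t \<in> carrier_mat n n" for t unfolding J_def using jmat_carrier n by metis
  have J0: "jmat c ps = J 0" by (simp add: J_def)
  from similar_matE[OF B[unfolded J0] J] obtain P Q where
    PQ: "P \<in> carrier_mat n n" "Q \<in> carrier_mat n n" "P * Q = 1\<^sub>m n" "Q * P = 1\<^sub>m n" "B = P * J 0 * Q" .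
  have M: "P * J t * Q \<in> carrier_mat n n" for t using PQ(1,2) J[of t] by simp
  have "similar_mat_wit (P * J t * Q) (J t) P Q" for t
    by (rule similar_mat_witI[OF PQ(3,4) refl M J PQ(1,2)])
  then have sim: "similar_mat (P * J t * Q) (J t)" for t unfolding similar_mat_def by blast
  have "P * J 0 * Q \<in> zar_closure n n D"
  proof (rule zar_closure_curve[OF inf, of "\<lambda>t. P * J t * Q"])
    show "P * J 0 * Q \<in> carrier_mat n n" by (rule M)
    have "{t. P * J t * Q \<notin> D} \<subseteq> bad" using good[OF _ M] sim unfolding J_def by blast
    then show "finite {t. P * J t * Q \<notin> D}" using fin by (rule finite_subset)
    fix i j assume ij: "i < n" "j < n"
    define q where "q l k = (if ps ! l = ps ! k then [:c (snd (ps ! l)), e (snd (ps ! l)):] else [:jent c (ps ! l) (ps ! k):])" for l k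
    have q: "J t $$ (l,k) = poly (q l k) t" if "l < n" "k < n" for t l k
      using that n by (simp add: J_def jmat_def q_def jent_def)
    have "(P * J t * Q) $$ (i,j) = poly (\<Sum>l<n. [:P $$ (i,l):] * (\<Sum>k<n. q l k * [:Q $$ (k,j):])) t" for t
      using ij PQ(1,2) J[of t] q
      by (simp add: scalar_prod_def lessThan_atLeast0 poly_sum mult.commute)
    then show "\<exists>R. \<forall>t. (P * J t * Q) $$ (i,j) = poly R t" by blast
  qed
  then show ?thesis unfolding PQ(5) .
qed

lemma Dset_closure_injective:
  fixes c s :: "nat \<Rightarrow> 'k::field"
  assumes inf: "infinite (UNIV :: 'k set)" and m: "shape m" and n: "length (young_list m) = n"
    and A: "similar_mat A (jmat c (young_list m))" and S: "similar_mat S (jmat s (young_list m))" and s: "inj s"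
  shows "Dset n A \<subseteq> zar_closure n n (Dset n S)"
proof
  fix B assume "B \<in> Dset n A"
  then obtain f where B: "similar_mat B (jmat (f \<circ> c) (young_list m))" unfolding Dset_iff[OF m A] by blast
  let ?K = "row_len m 0" and ?c = "f \<circ> c"
  \<comment> \<open>The \<open>t\<close> at which two diagonal entries \<open>?c i + t * s i\<close>
    and \<open>?c j + t * s j\<close> coincide. Pairs with \<open>i = j\<close> contribute the value
    0, as division by zero gives 0.\<close>
  define bad where "bad = (\<Union>i<?K. \<Union>j<?K. {(?c i - ?c j) / (s j - s i)})"
  show "B \<in> zar_closure n n (Dset n S)"
  proof (rule jmat_line_closure[OF inf B n])
    show "finite bad" by (simp add: bad_def)
    fix t B' assume t: "t \<notin> bad" and B': "B' \<in> carrier_mat n n"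
      and sim: "similar_mat B' (jmat (\<lambda>h. ?c h + t * s h) (young_list m))"
    \<comment> \<open>The change of eigenvalues that takes \<open>s\<close> to the diagonal for the
      value \<open>t\<close>; \<open>the_inv s\<close> recovers a layer from its eigenvalue.\<close>
    let ?g = "\<lambda>x. ?c (the_inv s x) + t * x"
    have "inj_on ?g (s ` {..<?K})"
    proof (rule inj_onI, clarify)
      fix i j assume ij: "i < ?K" "j < ?K" and eq: "?c (the_inv s (s i)) + t * s i = ?c (the_inv s (s j)) + t * s j"
      show "s i = s j"
      proof (rule ccontr)
        assume ne: "s i \<noteq> s j"
        have "?c i + t * s i = ?c j + t * s j" using eq by (simp add: the_inv_f_f[OF s])
        then have "t * (s j - s i) = ?c i - ?c j" by (simp add: algebra_simps)
        then have "t = (?c i - ?c j) / (s j - s i)" using ne by (simp add: field_simps)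
        then show False using t ij unfolding bad_def by blast
      qed
    qed
    moreover have "?g \<circ> s = (\<lambda>h. ?c h + t * s h)" by (simp add: fun_eq_iff the_inv_f_f[OF s])
    ultimately show "B' \<in> Dset n S" unfolding Dset_iff[OF m S] using B' sim by metis
  qed
qed

text \<open>The line starts at a constant diagonal and runs in the direction \<open>c\<close>; for
  nonzero \<open>t\<close> its diagonal is \<open>c\<close> followed by an injective affine map,
  which is an admissible change of the eigenvalues of \<open>A\<close>.\<close>

lemma Dset_constant_closure:
  fixes c :: "nat \<Rightarrow> 'k::field"
  assumes inf: "infinite (UNIV :: 'k set)" and m: "shape m" and n: "length (young_list m) = n"
    and A: "similar_mat A (jmat c (young_list m))" and N: "similar_mat N (jmat (\<lambda>_. 0) (young_list m))"
  shows "Dset n N \<subseteq> zar_closure n n (Dset n A)"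
proof
  fix B assume "B \<in> Dset n N"
  then obtain f :: "'k \<Rightarrow> 'k" where B: "similar_mat B (jmat (f \<circ> (\<lambda>_. 0)) (young_list m))" unfolding Dset_iff[OF m N] by blast
  show "B \<in> zar_closure n n (Dset n A)"
  proof (rule jmat_line_closure[OF inf B n])
    show "finite {0 :: 'k}" by simp
    fix t B' assume t: "t \<notin> {0}" and B': "B' \<in> carrier_mat n n"
      and sim: "similar_mat B' (jmat (\<lambda>h. (f \<circ> (\<lambda>_. 0)) h + t * c h) (young_list m))"
    have "inj_on (\<lambda>x. f 0 + t * x) (c ` {..<row_len m 0})" using t by (auto intro: inj_onI)
    moreover have "(\<lambda>x. f 0 + t * x) \<circ> c = (\<lambda>h. (f \<circ> (\<lambda>_. 0)) h + t * c h)" by (simp add: fun_eq_iff)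
    ultimately show "B' \<in> Dset n A" unfolding Dset_iff[OF m A] using B' sim by metis
  qed
qed

lemma diagonal_jordan_matrix:
  fixes ns :: "(nat \<times> 'k::field) list"
  assumes "\<And>k a. (k,a) \<in> set ns \<Longrightarrow> k \<le> 1"
  shows "diagonal_mat (jordan_matrix ns)"
  using assms
proof (induction ns)
  case Nil
  then show ?case by (simp add: jordan_matrix_def diagonal_mat_def)
next
  case (Cons x ns)
  obtain k a where x: "x = (k,a)" by fastforce
  have D: "diagonal_mat (jordan_matrix ns)" using Cons.IH Cons.prems list.set_intros(2) by metis
  have k: "k \<le> 1" using Cons.prems[of k a] x by simp
  have "jordan_matrix ns \<in> carrier_mat (sum_list (map fst ns)) (sum_list (map fst ns))" by simp
  then show ?case using D k
    by (auto simp: jordan_matrix_Cons x diagonal_mat_def jordan_block_def)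
qed

text \<open>An injective \<open>s\<close> takes each value at most once in a row of the diagram, so
  all Jordan blocks have size 1.\<close>

lemma semisimple_jmat:
  fixes s :: "nat \<Rightarrow> 'k::field"
  assumes s: "inj s"
  shows "semisimple (jmat s (young_list m))"
proof -
  have "k \<le> 1" if "(k,a) \<in> set (jall s m)" for k a
  proof -
    have "count (mset (jall s m)) (k,a) \<noteq> 0" using that by (simp add: count_eq_zero_iff)
    then have "{b. b < m 0 \<and> k = card {i. i < row_len m b \<and> s i = a} \<and> k > 0} \<noteq> {}"
      unfolding count_jall by (metis card.empty)
    then obtain b where k: "k = card {i. i < row_len m b \<and> s i = a}" by blast
    have "\<forall>i\<in>{i. i < row_len m b \<and> s i = a}. \<forall>j\<in>{i. i < row_len m b \<and> s i = a}. i = j"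
      using s by (auto dest: injD)
    then show ?thesis unfolding k using card_le_Suc0_iff_eq[of "{i. i < row_len m b \<and> s i = a}"] by simp
  qed
  then have "diagonal_mat (jordan_matrix (jall s m))" by (rule diagonal_jordan_matrix)
  then show ?thesis
    using jordan_nf_jmat[of s m] unfolding semisimple_def jordan_nf_def by blast
qed

lemma equipotent_jmat:
  fixes m :: "nat \<Rightarrow> nat"
  assumes m: "shape m" and n: "0 < length (young_list m)"
  shows "equipotent (jmat (\<lambda>_. 0 :: 'k::field) (young_list m))"
proof -
  let ?N = "jmat (\<lambda>_. 0 :: 'k) (young_list m)"
  let ?ns = "jall (\<lambda>_. 0 :: 'k) m"
  have N: "?N \<in> carrier_mat (length (young_list m)) (length (young_list m))" by simp
  have jnf: "jordan_nf ?N ?ns" by (rule jordan_nf_jmat)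
  have pos: "0 \<notin> fst ` set ?ns" using jnf by (simp add: jordan_nf_def)
  \<comment> \<open>The list is not empty, so the diagram has a box and 0 does occur as an
    eigenvalue.\<close>
  obtain b h where "(b,h) \<in> young m" using n young_list(2)[OF m] by (metis length_greater_0_conv list.set_intros(1) neq_Nil_conv surj_pair)
  then have "h < row_len m 0" using less_row_len[OF m] by (auto simp: young_def)
  then have snd: "snd ` set ?ns = {0}" unfolding snd_jall[OF m] by auto
  have "eigenvalue ?N \<mu> \<longleftrightarrow> \<mu> = 0" for \<mu>
  proof -
    have "poly (\<Prod>(k,a)\<leftarrow>ns. [:- a, 1:] ^ k) \<mu> = 0 \<longleftrightarrow> \<mu> \<in> snd ` set ns"
      if "0 \<notin> fst ` set ns" for ns :: "(nat \<times> 'k) list"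
      using that by (induction ns) auto
    from this[OF pos] show ?thesis
      using eigenvalue_root_char_poly[OF N] jordan_nf_char_poly[OF jnf] unfolding snd by simp
  qed
  then show ?thesis unfolding equipotent_def by auto
qed

theorem theorem1p1:
  fixes A :: "'k::field mat" and n :: nat
  assumes "alg_closed_field TYPE('k)"
    and "n \<ge> 1"
    and "A \<in> carrier_mat n n"
  shows "\<exists>S N. S \<in> carrier_mat n n \<and> N \<in> carrier_mat n n \<and>
           semisimple S \<and> equipotent N \<and>
           Dset n A \<subseteq> zar_closure n n (Dset n S) \<and>
           Dset n N \<subseteq> zar_closure n n (Dset n A) \<and>
           centralizer_dim n A = centralizer_dim n S \<and>
           centralizer_dim n S = centralizer_dim n N \<and>
           (\<forall>d. 1 \<le> d \<and> d < n \<longrightarrow>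
              krull_dim (grass_closed n d) (fixed_grass n d A) =
                krull_dim (grass_closed n d) (fixed_grass n d S) \<and>
              krull_dim (grass_closed n d) (fixed_grass n d S) =
                krull_dim (grass_closed n d) (fixed_grass n d N))"
proof -
  have inf: "infinite (UNIV :: 'k set)" by (rule alg_closed_infinite[OF assms(1)])
  obtain ns where ns: "jordan_nf A ns" using jordan_nf_exists_alg_closed[OF assms(1,3)] by blast
  then have "0 \<notin> fst ` set ns" by (simp add: jordan_nf_def)
  then obtain m and c :: "nat \<Rightarrow> 'k" where m: "shape m" and mc: "mset (jall c m) = mset ns"
    using jordan_shape_exists by metis
  define ps where "ps = young_list m"
  have "jordan_nf A (jall c m)" by (rule jordan_nf_perm[OF ns mc[symmetric]])
  then have A: "similar_mat A (jmat c ps)"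
    using jordan_nf_jmat[of c m] unfolding jordan_nf_def ps_def
    by (metis similar_mat_sym similar_mat_trans)
  from similar_matE[OF A jmat_carrier] have "A \<in> carrier_mat (length ps) (length ps)" by metis
  then have n: "length ps = n" using assms(3) by auto
  note yl = young_list[OF m, folded ps_def]
  interpret jcentralizer m ps n by unfold_locales (use m yl n in auto)
  have J: "jmat e ps \<in> carrier_mat n n" for e :: "nat \<Rightarrow> 'k" using jmat_carrier n by metis
  obtain s :: "nat \<Rightarrow> 'k" where s: "inj s" using infinite_countable_subset[OF inf] by blast
  let ?S = "jmat s ps" and ?N = "jmat (\<lambda>_. 0 :: 'k) ps"
  have SS: "similar_mat ?S (jmat s ps)" and NN: "similar_mat ?N (jmat (\<lambda>_. 0 :: 'k) ps)"
    by (rule similar_mat_refl[OF J])+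
  have z: "m h = 0" if "h \<ge> row_len m 0" for h using that less_row_len[OF m, of h 0] by simp
  have cent: "centralizer_dim n A = centralizer_dim n (jmat e ps)" for e :: "nat \<Rightarrow> 'k"
    using centralizer_dim_similar[OF A J] centralizer_dim_jmat by metis
  have grass: "krull_dim (grass_closed n d) (fixed_grass n d A) = krull_dim (grass_closed n d) (fixed_grass n d (jmat e ps))"
    if "d < n" for d and e :: "nat \<Rightarrow> 'k"
    by (rule fixed_grass_dim_eq[OF inf A similar_mat_refl[OF J] yl n antimono_m z less_imp_le[OF that]])
  show ?thesis
  proof (rule exI[of _ ?S], rule exI[of _ ?N], intro conjI allI impI)
    show "semisimple ?S" unfolding ps_def by (rule semisimple_jmat[OF s])
    show "equipotent ?N" unfolding ps_def by (rule equipotent_jmat[OF m]) (use n assms(2) ps_def in simp)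
    show "Dset n A \<subseteq> zar_closure n n (Dset n ?S)"
      by (rule Dset_closure_injective[OF inf m n[unfolded ps_def] A[unfolded ps_def] SS[unfolded ps_def] s, folded ps_def])
    show "Dset n ?N \<subseteq> zar_closure n n (Dset n A)"
      by (rule Dset_constant_closure[OF inf m n[unfolded ps_def] A[unfolded ps_def] NN[unfolded ps_def], folded ps_def])
    show "centralizer_dim n A = centralizer_dim n ?S" "centralizer_dim n ?S = centralizer_dim n ?N"
      using cent by metis+
    fix d assume "1 \<le> d \<and> d < n"
    then have d: "d < n" by simp
    show "krull_dim (grass_closed n d) (fixed_grass n d A) = krull_dim (grass_closed n d) (fixed_grass n d ?S)"
      "krull_dim (grass_closed n d) (fixed_grass n d ?S) = krull_dim (grass_closed n d) (fixed_grass n d ?N)"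
      using grass[OF d] by metis+
  qed (rule J)+
qed

end
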